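(* Let $Q$ be an interval, assume that $e^\varphi\in A_\infty(Q)$, and let $C=[e^\varphi]_{A_\infty(Q)}$, $\xi^\pm=\xi^\pm(C)$. For all $C\ge1$, $$\xi^+\le\|\varphi\|_{\mathrm{BMO}^2(Q)}\le|\xi^-|\qquad(\mathrm i)$$ and $$\|\varphi\|_{\mathrm{BMO}^1(Q)}\ge k(C).\qquad(\mathrm{ii})$$ If $p\in(1,2)$ and $C\ge\frac{e^{p-2}}{p-1}$, then $$\|\varphi\|_{\mathrm{BMO}^p(Q)}\ge\varepsilon_0(p)\,\xi^+.\qquad(\mathrm{iii})$$ Inequalities (i) and (iii) are sharp, i.e., for every admissible $C$ (and $p$) the bounds $\xi^+$, $|\xi^-|$ in (i) and $\varepsilon_0(p)\xi^+$ in (iii) cannot be improved over the class of $\varphi$ with $[e^\varphi]_{A_\infty(Q)}=C$.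
   Context: For an interval $J$, $\langle\varphi\rangle_J=\frac1{|J|}\int_J\varphi$. For an interval $Q$ and $p>0$, $\|\varphi\|_{\mathrm{BMO}^p(Q)}=\sup_{J\subset Q}\langle|\varphi-\langle\varphi\rangle_J|^p\rangle_J^{1/p}$, the supremum being over all subintervals $J$ of $Q$; $\mathrm{BMO}(Q)$ is the set of locally integrable $\varphi$ for which this is finite (the set is the same for all $p>0$). An a.e. positive function $w$ is in $A_\infty(Q)$ if $w$ and $\log w$ are locally integrable and $[w]_{A_\infty(Q)}:=\sup_{J\subset Q}\langle w\rangle_Je^{-\langle\log w\rangle_J}<\infty$, the supremum being over all subintervals $J$ of $Q$. For $C\ge1$, $\xi^\pm=\xi^\pm(C)$ are the two solutions of $e^{-\xi}=C(1-\xi)$ with $-\infty<\xi^-\le0\le\xi^+<1$ (both are $0$ when $C=1$). For $C>1$, $k(C)=2\,\frac{(1-\xi^-)(1-\xi^+)}{\xi^+-\xi^-}\,(C-1)$, and $k(1)=0$. For $p>0$ and $\varepsilon\ge0$ let $C(\varepsilon,p)\in[1,\infty]$ be the smallest constant such that $\langle e^\varphi\rangle_J\le C(\varepsilon,p)\,e^{\langle\varphi\rangle_J}$ for every $\varphi\in\mathrm{BMO}((0,1))$ with $\|\varphi\|_{\mathrm{BMO}^p((0,1))}\le\varepsilon$ and every subinterval $J\subset(0,1)$. The John--Nirenberg constant $\varepsilon_0(p)$ is the largest number such that $C(\varepsilon,p)<\infty$ for all $0\le\varepsilon<\varepsilon_0(p)$. *)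

theory Defs
  imports "HOL-Analysis.Analysis"
begin

text \<open>
  Functions on an interval \<open>Q\<close> are represented by total functions \<^typ>\<open>real \<Rightarrow> real\<close>; only their
  values on \<open>Q\<close> matter.  Intervals are bounded and of positive length, with or without endpoints,
  so that averages over them make sense.
\<close>

definition finite_interval :: "real set \<Rightarrow> bool" where
  "finite_interval J \<longleftrightarrow> is_interval J \<and> bounded J \<and> interior J \<noteq> {}"

definition subintervals :: "real set \<Rightarrow> real set set" where
  "subintervals Q = {J. finite_interval J \<and> J \<subseteq> Q}"

definition locally_integrable_on :: "(real \<Rightarrow> real) \<Rightarrow> real set \<Rightarrow> bool"
    (infix "locally'_integrable'_on" 50) where
  "f locally_integrable_on Q \<longleftrightarrow> (\<forall>K. compact K \<and> K \<subseteq> Q \<longrightarrow> set_integrable lebesgue K f)"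

definition avg :: "real set \<Rightarrow> (real \<Rightarrow> real) \<Rightarrow> real" where
  "avg J f = (LINT x:J|lebesgue. f x) / measure lebesgue J"

text \<open>The average of a nonnegative function, with value \<open>\<infinity>\<close> if the function is not integrable.\<close>

definition nn_avg :: "real set \<Rightarrow> (real \<Rightarrow> real) \<Rightarrow> ennreal" where
  "nn_avg J f = (\<integral>\<^sup>+x\<in>J. ennreal (f x) \<partial>lebesgue) / emeasure lebesgue J"

text \<open>Powers of extended nonnegative reals, for exponents \<open>r > 0\<close>.\<close>

definition ennreal_powr :: "ennreal \<Rightarrow> real \<Rightarrow> ennreal" where
  "ennreal_powr x r = (if x = \<infinity> then \<infinity> else ennreal (enn2real x powr r))"

text \<open>
  A locally integrable function may fail to be integrable on a subinterval \<open>J\<close> that reaches an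
  endpoint not in \<open>Q\<close>, and then \<^const>\<open>avg\<close> is \<open>0\<close> by convention.  This is harmless: finiteness
  of either supremum below over the compact subintervals already implies (by the John--Nirenberg
  inequality) that \<open>\<phi>\<close>, respectively \<open>ln w\<close>, is integrable on all of \<open>Q\<close>.
\<close>

definition bmo_norm :: "real \<Rightarrow> real set \<Rightarrow> (real \<Rightarrow> real) \<Rightarrow> ennreal" where
  "bmo_norm p Q \<phi> =
     (SUP J\<in>subintervals Q. ennreal_powr (nn_avg J (\<lambda>x. \<bar>\<phi> x - avg J \<phi>\<bar> powr p)) (1 / p))"

definition BMO :: "real \<Rightarrow> real set \<Rightarrow> (real \<Rightarrow> real) set" where
  "BMO p Q = {\<phi>. \<phi> locally_integrable_on Q \<and> bmo_norm p Q \<phi> < \<infinity>}"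

definition A_infty_const :: "real set \<Rightarrow> (real \<Rightarrow> real) \<Rightarrow> ennreal" where
  "A_infty_const Q w =
     (SUP J\<in>subintervals Q. nn_avg J w * ennreal (exp (- avg J (\<lambda>x. ln (w x)))))"

definition A_infty :: "real set \<Rightarrow> (real \<Rightarrow> real) set" where
  "A_infty Q = {w. (AE x in lebesgue. x \<in> Q \<longrightarrow> 0 < w x) \<and>
     w locally_integrable_on Q \<and> (\<lambda>x. ln (w x)) locally_integrable_on Q \<and>
     A_infty_const Q w < \<infinity>}"

definition xi_plus :: "real \<Rightarrow> real" where
  "xi_plus C = (THE \<xi>. 0 \<le> \<xi> \<and> \<xi> < 1 \<and> exp (- \<xi>) = C * (1 - \<xi>))"

definition xi_minus :: "real \<Rightarrow> real" where
  "xi_minus C = (THE \<xi>. \<xi> \<le> 0 \<and> exp (- \<xi>) = C * (1 - \<xi>))"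

definition k_const :: "real \<Rightarrow> real" where
  "k_const C = (if C = 1 then 0
     else 2 * ((1 - xi_minus C) * (1 - xi_plus C) / (xi_plus C - xi_minus C)) * (C - 1))"

text \<open>The infimum and the supremum in the next two definitions are attained.\<close>

definition exp_const :: "real \<Rightarrow> real \<Rightarrow> ennreal" where
  "exp_const \<epsilon> p = Inf {c. 1 \<le> c \<and>
     (\<forall>\<phi>\<in>BMO p {0<..<1}. bmo_norm p {0<..<1} \<phi> \<le> ennreal \<epsilon> \<longrightarrow>
        (\<forall>J\<in>subintervals {0<..<1}.
           nn_avg J (\<lambda>x. exp (\<phi> x)) \<le> c * ennreal (exp (avg J \<phi>))))}"

definition JN_const :: "real \<Rightarrow> ennreal" where
  "JN_const p = Sup {e. \<forall>\<epsilon>\<ge>0. ennreal \<epsilon> < e \<longrightarrow> exp_const \<epsilon> p < \<infinity>}"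

text \<open>The functions \<open>\<phi>\<close> with \<open>e\<^sup>\<phi> \<in> A\<^sub>\<infinity>(Q)\<close> and \<open>[e\<^sup>\<phi>] = C\<close>, for \<open>C \<ge> 1\<close>.\<close>

definition exp_A_infty_class :: "real set \<Rightarrow> real \<Rightarrow> (real \<Rightarrow> real) set" where
  "exp_A_infty_class Q C =
     {\<phi>. (\<lambda>x. exp (\<phi> x)) \<in> A_infty Q \<and> A_infty_const Q (\<lambda>x. exp (\<phi> x)) = ennreal C}"

end

theory Submission
  imports Defs "HOL-Probability.Weak_Convergence" "HOL-Real_Asymp.Real_Asymp"
begin

text \<open>
  By the rising sun lemma, the averages of \<open>\<phi>\<close> and \<open>e\<^sup>\<phi>\<close> over the initial intervals \<open>(0, t)\<close> of
  the decreasing rearrangement \<open>f\<close> of \<open>\<phi>\<close> still satisfy \<open>\<langle>e\<^sup>f\<rangle> \<le> C e\<^sup>\<langle>\<^sup>f\<^sup>\<rangle>\<close>; the same holds for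
  \<open>-\<phi>\<close> and for the final intervals.  So the point \<open>x(t) = (\<langle>f\<rangle>, \<langle>e\<^sup>f\<rangle>)\<close> moves inside
  \<open>e\<^sup>x \<le> y \<le> C e\<^sup>x\<close> as \<open>t\<close> grows, always in the direction of the boundary point
  \<open>(f(t), e\<^sup>f\<^sup>(\<^sup>t\<^sup>))\<close>.  Let \<open>B\<close> be linear on the segments that join \<open>(v, e\<^sup>v)\<close> to the point of
  tangency \<open>(v + \<xi>\<^sup>+, C e\<^sup>v\<^sup>+\<^sup>\<xi>)\<close>, with boundary values \<open>B(u, e\<^sup>u) = \<bar>u\<bar>\<^sup>p\<close>.  Its supporting planes
  lie below \<open>\<bar>u\<bar>\<^sup>p\<close> for all \<open>u\<close> left of the point of tangency, which is where \<open>f(t)\<close> lies; hence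
  \<open>\<integral>\<^sub>0\<^sup>t \<bar>f\<bar>\<^sup>p - t B(x(t))\<close> increases, and \<open>\<langle>\<bar>\<phi>\<bar>\<^sup>p\<rangle> \<ge> B(0, C)\<close>.  This gives the lower bounds for
  \<open>1 < p \<le> 2\<close> with \<open>B(0, C)\<close> the \<open>p\<close>-th central moment of \<open>\<xi>\<^sup>+ log (1/t)\<close>; the condition on \<open>C\<close> says
  \<open>2 - p \<le> \<xi>\<^sup>+\<close>.  The upper bound is the same argument for \<open>-\<phi>\<close> with the other tangent, and for
  \<open>p = 1\<close> a single affine function suffices.

  The functions \<open>\<xi>\<^sup>\<plusminus> log (1/t)\<close> are extremal, by convexity of the moments.  Finally
  \<open>\<epsilon>\<^sub>0(p)\<close> is the \<open>BMO\<^sup>p\<close> norm of \<open>log (1/t)\<close>: it is not larger because \<open>1/t\<close> is not integrable,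
  and not smaller because the lower bound, applied to truncations, bounds the \<open>A\<^sub>\<infinity>\<close> constant.
\<close>

section \<open>The rising sun lemma\<close>

text \<open>The rearrangement is only monotone, so its averages need not be differentiable, and
  \<open>B\<close> is never constructed. Its place is taken by the maximum of affine functions over
  a window of touching points, and growth along the path is checked over short steps. The affine
  function that is best at the right end of a step lies below the integrand on the step and competes
  in the maximum at the left end. For this its touching point must still belong to the window at the
  left end, so the window is built with a tangency distance slightly larger than the one that
  belongs to \<open>C\<close>.

  Two limits remain. As t tends to 0, the term t B(x(t)) vanishes in the lower bound because B grows
  at most like e^x, while t e^x at the abscissa of x(t) is at most the integral of e^f over (0, t).
  Moreover the supremum \<open>C\<close> need not be attained, so the lower estimates on one
  interval contain the actual average of the exponential, and what is lost is proportional to its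
  distance from the extremal value.\<close>

lemma set_integral_countable_disjoint_nonpos:
  fixes g :: "'a \<Rightarrow> real"
  assumes "countable \<I>" "disjoint \<I>" "\<And>I. I \<in> \<I> \<Longrightarrow> I \<in> sets M"
    and int: "set_integrable M (\<Union>\<I>) g"
    and le: "\<And>I. I \<in> \<I> \<Longrightarrow> (LINT x:I|M. g x) \<le> 0"
  shows "(LINT x:\<Union>\<I>|M. g x) \<le> 0"
proof (cases "\<I> = {}")
  case True
  then show ?thesis by (simp add: set_lebesgue_integral_def)
next
  case False
  \<comment> \<open>Indices outside the range of the enumeration receive the empty set, so finite
    and infinite families are treated alike.\<close>
  define A where "A n = (if n \<in> to_nat_on \<I> ` \<I> then from_nat_into \<I> n else {})" for n
  define B where "B n = (\<Union>i<n. A i)" for n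
  have A_in: "A n \<in> \<I> \<or> A n = {}" for n
    using False by (auto simp: A_def from_nat_into)
  have A_sets: "A n \<in> sets M" for n
    using A_in[of n] assms(3) by auto
  have UA: "(\<Union>n. A n) = \<Union>\<I>"
  proof
    show "(\<Union>n. A n) \<subseteq> \<Union>\<I>" using A_in by blast
    show "\<Union>\<I> \<subseteq> (\<Union>n. A n)"
    proof (intro Union_least)
      fix I assume "I \<in> \<I>"
      then have "A (to_nat_on \<I> I) = I" using assms(1) by (auto simp: A_def)
      then show "I \<subseteq> (\<Union>n. A n)" by blast
    qed
  qed
  have disj: "A i \<inter> A j = {}" if "i \<noteq> j" for i j
  proof (cases "i \<in> to_nat_on \<I> ` \<I> \<and> j \<in> to_nat_on \<I> ` \<I>")
    case True
    then have "from_nat_into \<I> i \<noteq> from_nat_into \<I> j"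
      using assms(1) that by (auto)
    then show ?thesis
      using True assms(2) False from_nat_into[OF False] unfolding A_def disjoint_def by auto
  qed (auto simp: A_def)
  have intA: "set_integrable M (A i) g" for i
    by (rule set_integrable_subset[OF int A_sets]) (use UA in blast)
  have eint: "(LINT x:{}|M. g x) = 0" by (simp add: set_lebesgue_integral_def)
  have "(LINT x:B n|M. g x) \<le> 0" for n
  proof -
    have "(LINT x:B n|M. g x) = (\<Sum>i<n. LINT x:A i|M. g x)"
      unfolding B_def
      by (rule set_integral_finite_Union) (auto simp: disjoint_family_on_def disj intA A_sets)
    also have "\<dots> \<le> 0"
      using eint A_in le by (intro sum_nonpos) (metis order_refl eint)
    finally show ?thesis .
  qed
  moreover have "(\<lambda>n. LINT x:B n|M. g x) \<longlonglongrightarrow> (LINT x:(\<Union>n. B n)|M. g x)"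
  proof (rule set_integral_cont_up)
    show "B i \<in> sets M" for i using A_sets by (auto simp: B_def)
    show "incseq B" by (auto simp: B_def incseq_def intro: less_le_trans)
    have "(\<Union>n. B n) = \<Union>\<I>" unfolding UA[symmetric] B_def by blast
    then show "set_integrable M (\<Union>n. B n) g" using int by simp
  qed
  moreover have "(\<Union>n. B n) = \<Union>\<I>" unfolding UA[symmetric] B_def by blast
  ultimately show ?thesis by (metis LIMSEQ_le_const2)
qed

text \<open>Absolute continuity of the integral. The part of \<open>g\<close> above a height
  \<open>N\<close> has small integral by dominated convergence; the rest is at most the height times
  the measure of \<open>S\<close>.\<close>

lemma set_integral_abs_small:
  fixes g :: "real \<Rightarrow> real"
  assumes g: "integrable lebesgue g" and "0 < e"
  obtains d where "0 < d"
    "\<And>S. S \<in> lmeasurable \<Longrightarrow> measure lebesgue S < d \<Longrightarrow> (LINT x:S|lebesgue. \<bar>g x\<bar>) < e"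
proof -
  have [measurable]: "g \<in> borel_measurable lebesgue" using g by auto
  have "(\<lambda>n::nat. LINT x|lebesgue. indicator {x. real n < \<bar>g x\<bar>} x * \<bar>g x\<bar>) \<longlonglongrightarrow> (LINT x::real|lebesgue. (0::real))"
  proof (rule integral_dominated_convergence[where w = "\<lambda>x. \<bar>g x\<bar>" and M = lebesgue])
    show "AE x in lebesgue. (\<lambda>i::nat. indicat_real {x. real i < \<bar>g x\<bar>} x * \<bar>g x\<bar>) \<longlonglongrightarrow> 0"
    proof (rule AE_I2)
      fix x
      obtain N :: nat where "\<bar>g x\<bar> < N" using reals_Archimedean2 by blast
      then have "eventually (\<lambda>i::nat. indicat_real {x. real i < \<bar>g x\<bar>} x * \<bar>g x\<bar> = 0) sequentially"
        unfolding eventually_sequentially by (intro exI[of _ N]) (auto simp: indicator_def)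
      then show "(\<lambda>i::nat. indicat_real {x. real i < \<bar>g x\<bar>} x * \<bar>g x\<bar>) \<longlonglongrightarrow> 0"
        by (rule tendsto_eventually)
    qed
    show "AE x in lebesgue. norm (indicat_real {x. real i < \<bar>g x\<bar>} x * \<bar>g x\<bar>) \<le> \<bar>g x\<bar>" for i :: nat
      by (auto simp: indicator_def)
  qed (use g in auto)
  then have "eventually (\<lambda>n::nat. (LINT x|lebesgue. indicator {x. real n < \<bar>g x\<bar>} x * \<bar>g x\<bar>) < e/2) sequentially"
    using \<open>0 < e\<close> by (intro order_tendstoD(2)[where y = 0]) auto
  then obtain N :: nat where N: "(LINT x|lebesgue. indicator {x. real N < \<bar>g x\<bar>} x * \<bar>g x\<bar>) < e/2"
    unfolding eventually_sequentially by blast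
  define d where "d = e / (2 * (real N + 1))"
  show ?thesis
  proof
    show "0 < d" using \<open>0 < e\<close> by (simp add: d_def)
    fix S :: "real set" assume S: "S \<in> lmeasurable" "measure lebesgue S < d"
    have [measurable]: "S \<in> sets lebesgue" using S by auto
    have i1: "integrable lebesgue (\<lambda>x. indicator {x. real N < \<bar>g x\<bar>} x * \<bar>g x\<bar>)"
      by (rule Bochner_Integration.integrable_bound[OF g]) (auto simp: indicator_def)
    have i2: "integrable lebesgue (\<lambda>x. indicator S x * (real N + 1))"
      using S by (intro integrable_mult_left) (auto simp: fmeasurable_def)
    have "(LINT x:S|lebesgue. \<bar>g x\<bar>) \<le> (LINT x|lebesgue. indicator {x. real N < \<bar>g x\<bar>} x * \<bar>g x\<bar> + indicator S x * (real N + 1))"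
      unfolding set_lebesgue_integral_def
    proof (rule integral_mono)
      show "integrable lebesgue (\<lambda>x. indicat_real S x *\<^sub>R \<bar>g x\<bar>)"
        by (rule Bochner_Integration.integrable_bound[OF g]) (auto simp: indicator_def)
      show "integrable lebesgue (\<lambda>x. indicator {x. real N < \<bar>g x\<bar>} x * \<bar>g x\<bar> + indicator S x * (real N + 1))"
        using i1 i2 by (rule Bochner_Integration.integrable_add)
    qed (auto simp: indicator_def)
    also have "\<dots> = (LINT x|lebesgue. indicator {x. real N < \<bar>g x\<bar>} x * \<bar>g x\<bar>) + measure lebesgue S * (real N + 1)"
      using i1 i2 by (subst Bochner_Integration.integral_add) (auto)
    also have "\<dots> < e/2 + d * (real N + 1)"
      using N S(2) by (intro add_strict_mono mult_strict_right_mono) auto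
    also have "\<dots> = e" by (simp add: d_def field_simps)
    finally show "(LINT x:S|lebesgue. \<bar>g x\<bar>) < e" .
  qed
qed

lemma open_component_real:
  fixes U :: "real set"
  assumes "open U" "U \<subseteq> {a..b}" "I \<in> components U"
  obtains p q where "p < q" "I = {p<..<q}" "p \<notin> U" "q \<notin> U" "a \<le> p" "q \<le> b"
proof -
  have I: "open I" "connected I" "I \<noteq> {}" "I \<subseteq> U"
    using assms open_components in_components_connected in_components_nonempty in_components_subset by blast+
  define p q where "p = Inf I" and "q = Sup I"
  have "I \<subseteq> {a..b}" using I(4) assms(2) by (rule order_trans)
  then have bdd: "bdd_below I" "bdd_above I" by (auto intro: bdd_below_mono bdd_above_mono)
  have less: "p < x \<and> x < q" if xI: "x \<in> I" for x
  proof -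
    obtain e where "e > 0" "ball x e \<subseteq> I" using openE[OF I(1) xI] by metis
    then have "x - e/2 \<in> I" "x + e/2 \<in> I" by (auto intro!: subsetD[of "ball x e" I] simp: dist_real_def)
    then have "p \<le> x - e/2" "x + e/2 \<le> q" unfolding p_def q_def
      using cInf_lower[OF _ bdd(1)] cSup_upper[OF _ bdd(2)] by metis+
    then show ?thesis using \<open>e > 0\<close> by auto
  qed
  have eq: "I = {p<..<q}"
  proof
    show "I \<subseteq> {p<..<q}" using less by auto
    show "{p<..<q} \<subseteq> I"
    proof
      fix x assume x: "x \<in> {p<..<q}"
      obtain y z where "y \<in> I" "y < x" "z \<in> I" "x < z"
        using x cInf_less_iff[OF I(3) bdd(1), of x] less_cSup_iff[OF I(3) bdd(2), of x]
        unfolding p_def q_def greaterThanLessThan_iff by metis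
      then show "x \<in> I" using I(2) unfolding connected_iff_interval by (meson less_imp_le)
    qed
  qed
  obtain x where "x \<in> I" using I by auto
  then have pq: "p < q" using less by force
  have "p \<notin> U"
  proof
    assume "p \<in> U"
    then have "insert p I \<subseteq> U" using I by auto
    moreover have "connected (insert p I)"
    proof -
      have "insert p I = {p..<q}" using eq pq by auto
      then show ?thesis by (simp add: convex_connected)
    qed
    ultimately have "insert p I = I" using in_components_maximal[of I U] assms(3) I(3)
      by (metis inf_commute insert_not_empty Int_absorb1 subset_insertI subset_antisym)
    then show False using eq by auto
  qed
  moreover have "q \<notin> U"
  proof
    assume "q \<in> U"
    then have "insert q I \<subseteq> U" using I by auto
    moreover have "connected (insert q I)"
    proof -
      have "insert q I = {p<..q}" using eq pq by auto
      then show ?thesis by (simp add: convex_connected)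
    qed
    ultimately have "insert q I = I" using in_components_maximal[of I U] assms(3) I(3)
      by (metis inf_commute insert_not_empty Int_absorb1 subset_insertI subset_antisym)
    then show False using eq by auto
  qed
  moreover have "a \<le> p" "q \<le> b"
    unfolding p_def q_def using I assms(2) by (intro cInf_greatest cSup_least; force)+
  ultimately show ?thesis using that pq eq by blast
qed

lemma components_open_real:
  fixes U :: "real set"
  assumes "open U"
  shows "countable (components U)" "disjoint (components U)"
    "\<And>I. I \<in> components U \<Longrightarrow> I \<in> sets lebesgue"
proof -
  show d: "disjoint (components U)"
    using pairwise_disjoint_components[of U] unfolding pairwise_def disjnt_def by blast
  show "countable (components U)"
    by (rule countable_disjoint_open_subsets[OF _ d]) (use assms open_components in blast)
  show "I \<in> sets lebesgue" if "I \<in> components U" for I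
    using open_components[OF assms that] by simp
qed

text \<open>In the usual version a component that starts at \<open>a\<close> may have mean above
  \<open>\<alpha>\<close>, whereas here every mean has to be exact. Let \<open>\<Phi>\<close> be the
  primitive of \<open>\<psi> - \<alpha>\<close> and \<open>c\<close> its last zero, which exists
  because \<open>\<Phi>\<close> vanishes at \<open>a\<close> and is nonpositive at \<open>b\<close>.
  Everything left of \<open>c\<close> is taken as one interval, and the usual shade, the points from
  which a higher value of \<open>\<Phi>\<close> lies to the right, is used only beyond
  \<open>c\<close>.\<close>

lemma rising_sun:
  fixes \<psi> :: "real \<Rightarrow> real" and a b \<alpha> :: real
  assumes "a < b" and int: "\<psi> absolutely_integrable_on {a..b}"
    and mean: "integral {a..b} \<psi> \<le> \<alpha> * (b - a)"
  obtains U where "open U" "U \<subseteq> {a<..<b}"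
    "\<And>I. I \<in> components U \<Longrightarrow>
       \<exists>p q. a \<le> p \<and> p < q \<and> q \<le> b \<and> I = {p<..<q} \<and> integral {p..q} \<psi> = \<alpha> * (q - p)"
    "negligible {x \<in> {a..b} - U. \<alpha> < \<psi> x}"
proof -
  define \<Phi> where "\<Phi> x = integral {a..x} (\<lambda>y. \<psi> y - \<alpha>)" for x
  have aint: "(\<lambda>y. \<psi> y - \<alpha>) absolutely_integrable_on {a..b}"
    by (intro set_integral_diff int) (auto simp: absolutely_integrable_on_const)
  then have hint: "(\<lambda>y. \<psi> y - \<alpha>) integrable_on {a..b}"
    by (rule set_lebesgue_integral_eq_integral(1))
  have cont: "continuous_on {a..b} \<Phi>"
    unfolding \<Phi>_def by (rule indefinite_integral_continuous_1[OF hint])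
  have \<psi>_int: "\<psi> integrable_on {a..b}"
    using int by (rule set_lebesgue_integral_eq_integral(1))
  have \<Phi>_diff: "\<Phi> q - \<Phi> p = integral {p..q} (\<lambda>y. \<psi> y - \<alpha>)"
    if "a \<le> p" "p \<le> q" "q \<le> b" for p q
  proof -
    have "(\<lambda>y. \<psi> y - \<alpha>) integrable_on {a..q}"
      by (rule integrable_on_subinterval[OF hint]) (use that in auto)
    then show ?thesis unfolding \<Phi>_def using Henstock_Kurzweil_Integration.integral_combine[OF that(1,2)]
      by fastforce
  qed
  have int_sub: "integral {p..q} (\<lambda>y. \<psi> y - \<alpha>) = integral {p..q} \<psi> - \<alpha> * (q - p)"
    if "a \<le> p" "p \<le> q" "q \<le> b" for p q
  proof -
    have "\<psi> integrable_on {p..q}"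
      by (rule integrable_on_subinterval[OF \<psi>_int]) (use that in auto)
    then have "integral {p..q} (\<lambda>y. \<psi> y - \<alpha>) = integral {p..q} \<psi> - integral {p..q} (\<lambda>y. \<alpha>)"
      by (intro integral_diff) auto
    then show ?thesis using that by (simp add: mult.commute)
  qed
  have \<Phi>a: "\<Phi> a = 0" by (simp add: \<Phi>_def)
  have \<Phi>b: "\<Phi> b \<le> 0"
    using \<Phi>_diff[of a b] int_sub[of a b] mean \<open>a < b\<close> \<Phi>a by simp
  define Z where "Z = {x \<in> {a..b}. 0 \<le> \<Phi> x}"
  have "compact Z"
  proof -
    have "Z = {a..b} \<inter> \<Phi> -` {0..}" by (auto simp: Z_def)
    then have "closed Z" using continuous_closed_preimage[OF cont] by simp
    moreover have "bounded Z" by (rule bounded_subset[of "{a..b}"]) (auto simp: Z_def)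
    ultimately show ?thesis by (simp add: compact_eq_bounded_closed)
  qed
  have "a \<in> Z" using \<Phi>a \<open>a < b\<close> by (simp add: Z_def)
  define c where "c = Sup Z"
  have cZ: "c \<in> Z" unfolding c_def
    using closed_contains_Sup[of Z] \<open>compact Z\<close> \<open>a \<in> Z\<close> by (auto simp: compact_imp_closed compact_imp_bounded bounded_imp_bdd_above)
  have c_max: "x \<le> c" if "x \<in> Z" for x
    unfolding c_def by (intro cSup_upper that) (simp add: \<open>compact Z\<close> compact_imp_bounded bounded_imp_bdd_above)
  have c_ab: "a \<le> c" "c \<le> b" using cZ by (auto simp: Z_def)
  have c_neg: "\<Phi> y < 0" if "c < y" "y \<le> b" for y
    using c_max[of y] that c_ab by (force simp: Z_def)
  have \<Phi>c: "\<Phi> c = 0"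
  proof (rule ccontr)
    assume "\<Phi> c \<noteq> 0"
    then have "0 < \<Phi> c" using cZ by (auto simp: Z_def)
    then have "c < b" using \<Phi>b c_ab by (cases "c = b") auto
    moreover have "continuous_on {c..b} \<Phi>" by (rule continuous_on_subset[OF cont]) (use c_ab in auto)
    ultimately obtain y where "c \<le> y" "y \<le> b" "\<Phi> y = 0"
      using IVT2'[of \<Phi> b 0 c] \<Phi>b \<open>0 < \<Phi> c\<close> by auto
    then show False using c_neg[of y] \<open>0 < \<Phi> c\<close> by (cases "y = c") auto
  qed
  define U where "U = {a<..<c} \<union> {x \<in> {c<..<b}. \<exists>y. x < y \<and> y \<le> b \<and> \<Phi> x < \<Phi> y}"
  have U_sub: "U \<subseteq> {a<..<b}" using c_ab by (auto simp: U_def)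
  have cont_o: "continuous_on {c<..<b} \<Phi>" by (rule continuous_on_subset[OF cont]) (use c_ab in auto)
  have "open U"
  proof -
    have "{x \<in> {c<..<b}. \<exists>y. x < y \<and> y \<le> b \<and> \<Phi> x < \<Phi> y} = (\<Union>y\<in>{..b}. {..<y} \<inter> ({c<..<b} \<inter> \<Phi> -` {..<\<Phi> y}))"
      by auto
    moreover have "open \<dots>"
      by (intro open_UN ballI open_Int continuous_open_preimage[OF cont_o]) auto
    ultimately show ?thesis unfolding U_def by auto
  qed
  \<comment> \<open>Leaving out \<open>c\<close> makes \<open>{a<..<c}\<close> a component of its
    own; its mean is exact because \<open>\<Phi>\<close> vanishes at both ends.\<close>
  have c_notin: "c \<notin> U" by (auto simp: U_def)
  have notU: "\<Phi> y \<le> \<Phi> x" if "x \<notin> U" "c \<le> x" "x \<le> y" "y \<le> b" for x y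
  proof (cases "x = y")
    case False
    show ?thesis
    proof (cases "x = c")
      case True
      then show ?thesis using c_neg[of y] \<Phi>c that False by auto
    next
      case False
      then show ?thesis using that \<open>x \<noteq> y\<close> by (force simp: U_def not_less)
    qed
  qed simp
  have comp: "\<exists>p q. a \<le> p \<and> p < q \<and> q \<le> b \<and> I = {p<..<q} \<and> integral {p..q} \<psi> = \<alpha> * (q - p)"
    if I: "I \<in> components U" for I
  proof -
    obtain p q where pq: "p < q" "I = {p<..<q}" "p \<notin> U" "q \<notin> U" "a \<le> p" "q \<le> b"
      using open_component_real[of U a b I] \<open>open U\<close> U_sub I by (metis greaterThanLessThan_subseteq_atLeastAtMost_iff order_refl order_trans)
    have IU: "I \<subseteq> U" using I by (rule in_components_subset)
    have "\<Phi> p = \<Phi> q"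
    proof (cases "p < c")
      case True
      have "p = a"
      proof (rule ccontr)
        assume "p \<noteq> a"
        then have "p \<in> U" using True pq(5) by (auto simp: U_def)
        then show False using pq(3) by simp
      qed
      moreover have "\<not> c < q" using IU pq(2) c_notin True by auto
      moreover have "\<not> q < c" using pq(1,4) \<open>p = a\<close> by (auto simp: U_def)
      ultimately show ?thesis using \<Phi>a \<Phi>c by force
    next
      case False
      then have "c \<le> p" by simp
      have le: "\<Phi> q \<le> \<Phi> p" using notU[of p q] pq \<open>c \<le> p\<close> by simp
      have ge: "\<Phi> x \<le> \<Phi> q" if x: "p < x" "x < q" for x
      proof (rule ccontr)
        assume "\<not> \<Phi> x \<le> \<Phi> q"
        then have xq: "\<Phi> q < \<Phi> x" by simp
        \<comment> \<open>The last point \<open>z\<close> of \<open>W\<close> belongs to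
          \<open>U\<close>, so a later point is higher still. Up to \<open>q\<close> this
          contradicts the choice of \<open>z\<close>; beyond \<open>q\<close> it contradicts
          \<open>q \<notin> U\<close>.\<close>
        define W where "W = {y \<in> {x..q}. \<Phi> x \<le> \<Phi> y}"
        have "continuous_on {x..q} \<Phi>" by (rule continuous_on_subset[OF cont]) (use x pq in auto)
        moreover have "W = {x..q} \<inter> \<Phi> -` {\<Phi> x..}" by (auto simp: W_def)
        ultimately have "closed W" using continuous_closed_preimage[of "{x..q}" \<Phi> "{\<Phi> x..}"] by simp
        have bW: "bdd_above W" by (rule bdd_aboveI[of _ q]) (auto simp: W_def)
        have "x \<in> W" using x by (auto simp: W_def)
        define z where "z = Sup W"
        have zW: "z \<in> W" unfolding z_def by (rule closed_contains_Sup) (use \<open>closed W\<close> \<open>x \<in> W\<close> bW in auto)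
        have "z < q" using zW xq by (cases "z = q") (auto simp: W_def)
        then have "z \<in> U" using zW IU pq(2) x by (auto simp: W_def)
        then obtain y where y: "z < y" "y \<le> b" "\<Phi> z < \<Phi> y"
          using zW \<open>c \<le> p\<close> x by (auto simp: U_def W_def)
        show False
        proof (cases "y \<le> q")
          case True
          then have "y \<in> W" using y zW by (auto simp: W_def)
          then have "y \<le> z" unfolding z_def by (intro cSup_upper bW)
          then show False using y by simp
        next
          case False
          then have "\<Phi> y \<le> \<Phi> q" using notU[of q y] pq y \<open>c \<le> p\<close> by simp
          then show False using y zW xq by (auto simp: W_def)
        qed
      qed
      have "\<Phi> p \<le> \<Phi> q"
      proof (rule tendsto_upperbound[where F = "at_right p" and f = \<Phi>])
        have "continuous_on {p..q} \<Phi>" by (rule continuous_on_subset[OF cont]) (use pq in auto)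
        then show "(\<Phi> \<longlongrightarrow> \<Phi> p) (at_right p)"
          using pq(1) by (simp add: continuous_on_Icc_at_rightD)
        show "eventually (\<lambda>x. \<Phi> x \<le> \<Phi> q) (at_right p)"
          unfolding eventually_at_right[OF pq(1)] using ge pq(1) by auto
      qed simp
      then show ?thesis using le by simp
    qed
    then have "integral {p..q} \<psi> = \<alpha> * (q - p)"
      using \<Phi>_diff[of p q] int_sub[of p q] pq by simp
    then show ?thesis using pq by blast
  qed
  define A where "A = {x \<in> {a<..<b} - U. \<alpha> < \<psi> x}"
  define g where "g x = indicator {a..b} x * (\<psi> x - \<alpha>)" for x
  have gint: "integrable lebesgue g"
    using aint by (simp add: g_def[abs_def] set_integrable_def)
  then have [measurable]: "g \<in> borel_measurable lebesgue" by auto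
  have A_eq: "A = ({a<..<b} - U) \<inter> {x \<in> space lebesgue. 0 < g x}"
    by (auto simp: A_def g_def indicator_def)
  have A_meas[measurable]: "A \<in> sets lebesgue"
  proof -
    have "{x \<in> space lebesgue. 0 < g x} \<in> sets lebesgue" by measurable
    then show ?thesis unfolding A_eq using \<open>open U\<close> by (intro sets.Int sets.Diff) auto
  qed
  have g_sint: "set_integrable lebesgue S g" if "S \<in> sets lebesgue" for S
    unfolding set_integrable_def using integrable_mult_indicator[OF that gint] .
  have g_integral: "(LINT x:{p<..<q}|lebesgue. g x) = \<Phi> q - \<Phi> p" if "a \<le> p" "p \<le> q" "q \<le> b" for p q
  proof -
    have "(LINT x:{p<..<q}|lebesgue. g x) = integral {p<..<q} g"
      by (rule set_lebesgue_integral_eq_integral(2)[OF g_sint]) simp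
    also have "\<dots> = integral {p..q} g"
      using integral_open_interval_real[of p q g] by simp
    also have "\<dots> = integral {p..q} (\<lambda>y. \<psi> y - \<alpha>)"
      by (rule integral_cong) (use that in \<open>auto simp: g_def\<close>)
    finally show ?thesis using \<Phi>_diff[OF that] by simp
  qed
  \<comment> \<open>Cover \<open>A\<close> by an open set of small excess and cut off from each
    component the piece left of the first point of \<open>A\<close>. To the right of a point of
    \<open>A\<close> the primitive never exceeds its value there, so \<open>g\<close> has
    nonpositive integral over what remains of the component. The remaining pieces cover
    \<open>A\<close> up to a countable set and exceed it by a set on which the integral of
    \<open>\<bar>g x\<bar>\<close> is below \<open>e\<close>.\<close>
  have "(LINT x:A|lebesgue. g x) \<le> 0"
  proof (rule field_le_epsilon)
    fix e :: real assume "0 < e"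
    then obtain d where d: "0 < d" and small: "\<And>S. S \<in> lmeasurable \<Longrightarrow> measure lebesgue S < d \<Longrightarrow> (LINT x:S|lebesgue. \<bar>g x\<bar>) < e"
      using set_integral_abs_small[OF gint] by metis
    obtain T0 where T0: "open T0" "A \<subseteq> T0" "(T0 - A) \<in> lmeasurable" "emeasure lebesgue (T0 - A) < ennreal d"
      using sets_lebesgue_outer_open[OF A_meas d] by metis
    define T where "T = T0 \<inter> {a<..<b}"
    have T: "open T" "A \<subseteq> T" "T \<subseteq> {a..b}" using T0 by (auto simp: T_def A_def)
    define K where "K = {I \<in> components T. I \<inter> A \<noteq> {}}"
    define s where "s I = {Inf (I \<inter> A)<..<Sup I}" for I :: "real set"
    have KI: "\<exists>p r q. a \<le> p \<and> p \<le> r \<and> r < q \<and> q \<le> b \<and> I = {p<..<q} \<and> s I = {r<..<q} \<and> r = Inf (I \<inter> A) \<and> \<Phi> q \<le> \<Phi> r"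
      if "I \<in> K" for I
    proof -
      have "I \<in> components T" using that by (simp add: K_def)
      then obtain p q where pq: "p < q" "I = {p<..<q}" "p \<notin> T" "q \<notin> T" "a \<le> p" "q \<le> b"
        using open_component_real[OF T(1) T(3)] by metis
      define r where "r = Inf (I \<inter> A)"
      have ne: "I \<inter> A \<noteq> {}" using that by (simp add: K_def)
      have bb: "bdd_below (I \<inter> A)" by (rule bdd_belowI[of _ p]) (use pq in auto)
      obtain x where x: "x \<in> I" "x \<in> A" using ne by auto
      have "r \<le> x" unfolding r_def by (rule cInf_lower) (use x bb in auto)
      then have rq: "r < q" using x pq by auto
      have pr: "p \<le> r" unfolding r_def by (rule cInf_greatest[OF ne]) (use pq in auto)
      have "r \<in> closure (I \<inter> A)" unfolding r_def by (rule closure_contains_Inf[OF ne bb])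
      have "\<Phi> q \<le> \<Phi> y" if y: "y \<in> I \<inter> A" for y
      proof -
        have "y \<notin> U" "y \<in> {a<..<b}" using y by (auto simp: A_def)
        then have "c \<le> y" by (auto simp: U_def not_less)
        then show ?thesis using notU[of y q] \<open>y \<notin> U\<close> y pq by auto
      qed
      then have "I \<inter> A \<subseteq> {a..b} \<inter> \<Phi> -` {\<Phi> q..}" using pq by auto
      moreover have "closed ({a..b} \<inter> \<Phi> -` {\<Phi> q..})"
        by (intro continuous_closed_preimage cont) auto
      ultimately have "closure (I \<inter> A) \<subseteq> {a..b} \<inter> \<Phi> -` {\<Phi> q..}" by (rule closure_minimal)
      then have "\<Phi> q \<le> \<Phi> r" using \<open>r \<in> closure (I \<inter> A)\<close> by auto
      moreover have "s I = {r<..<q}" using pq by (simp add: s_def r_def)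
      ultimately show ?thesis using pq pr rq r_def by blast
    qed
    define \<I> where "\<I> = s ` K"
    have K_sub: "K \<subseteq> components T" by (auto simp: K_def)
    have s_sub: "s I \<subseteq> I" if "I \<in> K" for I using KI[OF that] by auto
    have cI: "countable \<I>"
      unfolding \<I>_def by (intro countable_image countable_subset[OF K_sub] components_open_real T)
    have dI: "disjoint \<I>"
    proof (rule disjointI)
      fix X Y assume "X \<in> \<I>" "Y \<in> \<I>" "X \<noteq> Y"
      then obtain I J where IJ: "I \<in> K" "J \<in> K" "X = s I" "Y = s J" "I \<noteq> J" by (auto simp: \<I>_def)
      then have "I \<inter> J = {}" using components_open_real(2)[OF T(1)] K_sub by (meson disjointD subsetD)
      then show "X \<inter> Y = {}" using s_sub IJ by blast
    qed
    have mI: "I \<in> sets lebesgue" if "I \<in> \<I>" for I using that KI by (auto simp: \<I>_def s_def)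
    have leI: "(LINT x:I|lebesgue. g x) \<le> 0" if I: "I \<in> \<I>" for I
    proof -
      obtain J where J: "J \<in> K" "I = s J" using I by (auto simp: \<I>_def)
      from KI[OF J(1)] obtain p r q where "a \<le> p" "p \<le> r" "r < q" "q \<le> b" "s J = {r<..<q}" "\<Phi> q \<le> \<Phi> r" by blast
      then show ?thesis using g_integral[of r q] J by simp
    qed
    have UI: "\<Union>\<I> \<in> sets lebesgue" using cI mI by (intro sets.countable_Union) auto
    have neg: "(LINT x:\<Union>\<I>|lebesgue. g x) \<le> 0"
      by (rule set_integral_countable_disjoint_nonpos[OF cI dI mI g_sint[OF UI] leI])
    have UT: "\<Union>\<I> \<subseteq> T0" using s_sub K_sub in_components_subset by (fastforce simp: \<I>_def T_def)
    \<comment> \<open>The infimum of \<open>I \<inter> A\<close> may itself lie in \<open>A\<close>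
      and is lost in the open interval \<open>s I\<close>; there is at most one such point for each
      component.\<close>
    define E where "E = {x. x \<in> A \<and> x \<notin> \<Union>\<I>}"
    have "E \<subseteq> (\<lambda>I. Inf (I \<inter> A)) ` K"
    proof
      fix x assume x: "x \<in> E"
      then have "x \<in> T" using T by (auto simp: E_def)
      then obtain I where I: "I \<in> components T" "x \<in> I" using Union_components[of T] by blast
      then have "I \<in> K" using x by (auto simp: K_def E_def)
      from KI[OF this] obtain p r q where *: "I = {p<..<q}" "s I = {r<..<q}" "r = Inf (I \<inter> A)" by blast
      have "r \<le> x" unfolding *(3) by (rule cInf_lower) (use I x * in \<open>auto simp: E_def intro!: bdd_belowI[of _ p]\<close>)
      moreover have "\<not> r < x" using * I x \<open>I \<in> K\<close> by (auto simp: E_def \<I>_def)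
      ultimately show "x \<in> (\<lambda>I. Inf (I \<inter> A)) ` K" using *(3) \<open>I \<in> K\<close> by (intro image_eqI[of _ _ I]) auto
    qed
    then have "countable E"
      using countable_subset[OF K_sub components_open_real(1)[OF T(1)]] by (meson countable_image countable_subset)
    then have "E \<in> null_sets lebesgue" using countable_imp_null_set_lborel null_sets_completionI by blast
    then have AE_E: "AE x in lebesgue. x \<notin> E" by (rule AE_not_in)
    have dA: "\<Union>\<I> - A \<in> sets lebesgue" using UI by auto
    have "(LINT x:A|lebesgue. g x) = (LINT x:A \<inter> \<Union>\<I>|lebesgue. g x)"
      unfolding set_lebesgue_integral_def
    proof (rule integral_cong_AE)
      show "(\<lambda>x. indicat_real A x *\<^sub>R g x) \<in> borel_measurable lebesgue" by measurable
      show "(\<lambda>x. indicat_real (A \<inter> \<Union>\<I>) x *\<^sub>R g x) \<in> borel_measurable lebesgue" using UI by measurable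
      show "AE x in lebesgue. indicat_real A x *\<^sub>R g x = indicat_real (A \<inter> \<Union>\<I>) x *\<^sub>R g x"
        using AE_E by eventually_elim (auto simp: E_def indicator_def)
    qed
    also have "\<dots> = (LINT x:\<Union>\<I>|lebesgue. g x) - (LINT x:\<Union>\<I> - A|lebesgue. g x)"
    proof -
      have "(LINT x:(A \<inter> \<Union>\<I>) \<union> (\<Union>\<I> - A)|lebesgue. g x) = (LINT x:A \<inter> \<Union>\<I>|lebesgue. g x) + (LINT x:\<Union>\<I> - A|lebesgue. g x)"
        by (rule set_integral_Un) (use UI dA in \<open>auto intro!: g_sint\<close>)
      moreover have "(A \<inter> \<Union>\<I>) \<union> (\<Union>\<I> - A) = \<Union>\<I>" by blast
      ultimately show ?thesis by simp
    qed
    also have "\<dots> \<le> 0 + e"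
    proof -
      have sub: "\<Union>\<I> - A \<subseteq> T0 - A" using UT by blast
      have lm: "\<Union>\<I> - A \<in> lmeasurable" by (rule fmeasurableI2[OF T0(3) sub dA])
      have "measure lebesgue (\<Union>\<I> - A) \<le> measure lebesgue (T0 - A)"
        by (rule measure_mono_fmeasurable[OF sub dA T0(3)])
      also have "\<dots> < d" using T0(3,4) d by (simp add: emeasure_eq_measure2 ennreal_less_iff)
      finally have "(LINT x:\<Union>\<I> - A|lebesgue. \<bar>g x\<bar>) < e" using small[OF lm] by simp
      moreover have "\<bar>LINT x:\<Union>\<I> - A|lebesgue. g x\<bar> \<le> (LINT x:\<Union>\<I> - A|lebesgue. \<bar>g x\<bar>)"
        using set_integral_norm_bound[OF g_sint[OF dA]] by simp
      ultimately show ?thesis using neg by simp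
    qed
    finally show "(LINT x:A|lebesgue. g x) \<le> 0 + e" .
  qed
  moreover have g_pos: "0 < g x" if "x \<in> A" for x using that by (auto simp: A_def g_def)
  ultimately have "(LINT x|lebesgue. indicator A x * g x) = 0"
    by (intro antisym integral_nonneg_AE) (auto simp: set_lebesgue_integral_def indicator_def less_imp_le)
  then have "AE x in lebesgue. indicator A x * g x = 0"
    using g_sint[OF A_meas] g_pos
    by (subst (asm) integral_nonneg_eq_0_iff_AE) (auto simp: set_integrable_def indicator_def less_imp_le)
  then have "AE x in lebesgue. x \<notin> A"
    by eventually_elim (use g_pos in \<open>force simp: indicator_def\<close>)
  then have "negligible A"
    by (simp add: negligible_iff_null_sets AE_iff_null_sets)
  then have "negligible (A \<union> {a, b})" by (intro negligible_Un) auto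
  moreover have "{x \<in> {a..b} - U. \<alpha> < \<psi> x} \<subseteq> A \<union> {a, b}" by (auto simp: A_def)
  ultimately have "negligible {x \<in> {a..b} - U. \<alpha> < \<psi> x}" by (rule negligible_subset)
  then show ?thesis using that[OF \<open>open U\<close> U_sub comp] by blast
qed

section \<open>Decreasing rearrangements\<close>

lemma borel_measurable_indicator_compose:
  fixes F \<psi> :: "real \<Rightarrow> real"
  assumes "set_borel_measurable lebesgue S \<psi>" "F \<in> borel_measurable borel" "S \<in> sets lebesgue"
  shows "set_borel_measurable lebesgue S (\<lambda>x. F (\<psi> x))"
proof -
  have "(\<lambda>x. indicator S x *\<^sub>R F (indicator S x *\<^sub>R \<psi> x)) \<in> borel_measurable lebesgue"
    by (rule borel_measurable_scaleR[OF borel_measurable_indicator[OF assms(3)]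
          measurable_compose[OF assms(1)[unfolded set_borel_measurable_def] assms(2)]])
  also have "(\<lambda>x. indicator S x *\<^sub>R F (indicator S x *\<^sub>R \<psi> x)) = (\<lambda>x. indicator S x *\<^sub>R F (\<psi> x))"
    by (auto simp: indicator_def)
  finally show ?thesis by (simp add: set_borel_measurable_def)
qed

lemma set_integrable_imp_set_borel_measurable:
  "set_integrable M S f \<Longrightarrow> set_borel_measurable M S f"
  unfolding set_integrable_def set_borel_measurable_def by auto

lemma set_integrable_compose_bound:
  fixes F P \<psi> :: "real \<Rightarrow> real"
  assumes "set_integrable lebesgue S \<psi>" "set_integrable lebesgue S (\<lambda>x. P (\<psi> x))"
    and "F \<in> borel_measurable borel" "S \<in> lmeasurable"
    and "\<And>u. \<bar>F u\<bar> \<le> A + B * \<bar>u\<bar> + D * P u"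
  shows "set_integrable lebesgue S (\<lambda>x. F (\<psi> x))"
proof (rule set_integrable_bound[where f = "\<lambda>x. A + B * \<bar>\<psi> x\<bar> + D * P (\<psi> x)"])
  show "set_integrable lebesgue S (\<lambda>x. A + B * \<bar>\<psi> x\<bar> + D * P (\<psi> x))"
    using assms by (intro set_integral_add set_integrable_mult_right absolutely_integrable_on_const
        set_integrable_abs) auto
  show "set_borel_measurable lebesgue S (\<lambda>x. F (\<psi> x))"
    by (rule borel_measurable_indicator_compose)
      (use assms in \<open>auto intro: set_integrable_imp_set_borel_measurable\<close>)
  show "AE x in lebesgue. x \<in> S \<longrightarrow> norm (F (\<psi> x)) \<le> norm (A + B * \<bar>\<psi> x\<bar> + D * P (\<psi> x))"
  proof (intro AE_I2 impI)
    fix x show "norm (F (\<psi> x)) \<le> norm (A + B * \<bar>\<psi> x\<bar> + D * P (\<psi> x))"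
      using assms(5)[of "\<psi> x"] by auto
  qed
qed

lemma convex_on_real_chord:
  fixes P :: "real \<Rightarrow> real"
  assumes P: "convex_on UNIV P" and "l < r"
  defines "s \<equiv> (P r - P l) / (r - l)"
  shows "l \<le> u \<Longrightarrow> u \<le> r \<Longrightarrow> P u \<le> P r + s * (u - r)"
    and "u \<le> l \<or> r \<le> u \<Longrightarrow> P r + s * (u - r) \<le> P u"
proof -
  have s: "s * (r - l) = P r - P l" using \<open>l < r\<close> by (simp add: s_def)
  show "P u \<le> P r + s * (u - r)" if "l \<le> u" "u \<le> r"
  proof -
    have "P u \<le> (P r - P l) / (r - l) * (u - l) + P l"
      by (rule convex_onD_Icc'[of l r]) (use that convex_on_subset[OF P] in auto)
    also have "\<dots> = P r + s * (u - r)" using s by (simp add: s_def[symmetric]) (simp add: algebra_simps)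
    finally show ?thesis .
  qed
  show "P r + s * (u - r) \<le> P u" if u: "u \<le> l \<or> r \<le> u"
  proof (cases "u = l \<or> u = r")
    case True
    then show ?thesis using s by (auto simp: algebra_simps)
  next
    case False
    then consider "u < l" | "r < u" using u by linarith
    then show ?thesis
    proof cases
      case 1
      have "P l \<le> (P r - P u) / (r - u) * (l - u) + P u"
        by (rule convex_onD_Icc'[of u r]) (use 1 \<open>l < r\<close> convex_on_subset[OF P] in auto)
      then have "P l * (r - u) \<le> (P r - P u) * (l - u) + P u * (r - u)"
        using 1 \<open>l < r\<close> by (simp add: field_simps)
      then have "(P r - P l) * (r - u) \<ge> (r - l) * (P r - P u)" by (simp add: algebra_simps)
      then have "s * (r - u) \<ge> P r - P u" using \<open>l < r\<close> by (simp add: s_def field_simps)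
      then show ?thesis by (simp add: algebra_simps)
    next
      case 2
      have "P r \<le> (P u - P l) / (u - l) * (r - l) + P l"
        by (rule convex_onD_Icc'[of l u]) (use 2 \<open>l < r\<close> convex_on_subset[OF P] in auto)
      then have "P r * (u - l) \<le> (P u - P l) * (r - l) + P l * (u - l)"
        using 2 \<open>l < r\<close> by (simp add: field_simps)
      then have "(P r - P l) * (u - r) \<le> (r - l) * (P u - P r)" by (simp add: algebra_simps)
      then have "s * (u - r) \<le> P u - P r" using \<open>l < r\<close> by (simp add: s_def field_simps)
      then show ?thesis by (simp add: algebra_simps)
    qed
  qed
qed

text \<open>Subtract from \<open>P\<close> the line through its values at \<open>l\<close> and
  \<open>\<alpha>\<close>. The difference \<open>G\<close> is nonpositive between \<open>l\<close>
  and \<open>\<alpha>\<close> and nonnegative elsewhere. Take the rising sun set \<open>U\<close> at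
  height \<open>\<alpha>\<close>: outside \<open>U\<close> the values above \<open>l\<close> lie in
  the range where \<open>G\<close> is nonpositive, and inside \<open>U\<close> the values up to
  \<open>l\<close> contribute nonnegatively, so the integral of \<open>G\<close> over the level set
  is at most that over \<open>U\<close>. On the components of \<open>U\<close> the mean is exactly
  \<open>\<alpha>\<close> and the hypothesis applies. In terms of the decreasing rearrangement,
  \<open>l\<close> is its value at \<open>t\<close> and \<open>\<alpha>\<close> its mean over the
  initial interval of length \<open>t\<close>; the left side is then the integral of
  \<open>P\<close> over that interval. Written with \<open>l\<close>, it does not depend on how a
  plateau at height \<open>l\<close> is cut.\<close>

lemma level_set_inequality:
  fixes \<psi> P :: "real \<Rightarrow> real"
  assumes "a < b" and int: "\<psi> absolutely_integrable_on {a..b}"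
    and intP: "(\<lambda>x. P (\<psi> x)) absolutely_integrable_on {a..b}"
    and P: "convex_on UNIV P" "\<And>u. 0 < P u"
    and A: "\<And>p q. a \<le> p \<Longrightarrow> p < q \<Longrightarrow> q \<le> b \<Longrightarrow>
        integral {p..q} (\<lambda>x. P (\<psi> x)) \<le> C * (q - p) * P (integral {p..q} \<psi> / (q - p))"
    and "1 \<le> C" and t: "0 < t" "t \<le> b - a"
    and level: "integral {a..b} (\<lambda>x. max 0 (\<psi> x - l)) = t * (\<alpha> - l)"
  shows "integral {a..b} (\<lambda>x. if l < \<psi> x then P (\<psi> x) - P l else 0) + t * P l \<le> C * t * P \<alpha>"
proof -
  have [measurable]: "P \<in> borel_measurable borel"
    using convex_on_continuous[OF open_UNIV P(1)] by (rule borel_measurable_continuous_onI)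
  have lm: "{a..b} \<in> lmeasurable" by simp
  have comp: "set_integrable lebesgue {a..b} (\<lambda>x. F (\<psi> x))"
    if "F \<in> borel_measurable borel" "\<And>u. \<bar>F u\<bar> \<le> A + B * \<bar>u\<bar> + D * P u" for F A B D
    by (rule set_integrable_compose_bound[where A = A and B = B and D = D and P = P]) (use int intP that in auto)
  have imax: "set_integrable lebesgue {a..b} (\<lambda>x. max 0 (\<psi> x - l))"
    by (rule comp[where A = "\<bar>l\<bar>" and B = 1 and D = 0]) auto
  have Lmax: "(LINT x:{a..b}|lebesgue. max 0 (\<psi> x - l)) = t * (\<alpha> - l)"
    using level set_lebesgue_integral_eq_integral(2)[OF imax] by simp
  have "0 \<le> t * (\<alpha> - l)"
    unfolding Lmax[symmetric] set_lebesgue_integral_def by (intro integral_nonneg_AE) auto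
  then have "l \<le> \<alpha>" using t by (simp add: zero_le_mult_iff)
  have iPl: "set_integrable lebesgue {a..b} (\<lambda>x. if l < \<psi> x then P (\<psi> x) - P l else 0)"
  proof (rule comp[where A = "P l" and B = 0 and D = 1])
    show "\<bar>if l < u then P u - P l else 0\<bar> \<le> P l + 0 * \<bar>u\<bar> + 1 * P u" for u
      using P(2)[of u] P(2)[of l] by auto
  qed measurable
  show ?thesis
  \<comment> \<open>The chord degenerates here, but then \<open>\<psi> \<le> l\<close> almost
    everywhere on the interval.\<close>
  proof (cases "l = \<alpha>")
    case True
    then have "(LINT x|lebesgue. indicator {a..b} x *\<^sub>R max 0 (\<psi> x - l)) = 0"
      using Lmax by (simp add: set_lebesgue_integral_def)
    then have "AE x in lebesgue. indicator {a..b} x *\<^sub>R max 0 (\<psi> x - l) = 0"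
      using imax by (subst (asm) integral_nonneg_eq_0_iff_AE) (auto simp: set_integrable_def)
    then have "AE x in lebesgue. indicator {a..b} x *\<^sub>R (if l < \<psi> x then P (\<psi> x) - P l else 0) = 0"
      by eventually_elim (auto simp: indicator_def max_def split: if_splits)
    then have "(LINT x:{a..b}|lebesgue. (if l < \<psi> x then P (\<psi> x) - P l else 0)) = 0"
      unfolding set_lebesgue_integral_def by (rule integral_eq_zero_AE)
    then have "integral {a..b} (\<lambda>x. if l < \<psi> x then P (\<psi> x) - P l else 0) = 0"
      using set_lebesgue_integral_eq_integral(2)[OF iPl] by simp
    then show ?thesis using True \<open>1 \<le> C\<close> t P(2)[of \<alpha>] by simp
  next
    case False
    with \<open>l \<le> \<alpha>\<close> have la: "l < \<alpha>" by simp
    define s where "s = (P \<alpha> - P l) / (\<alpha> - l)"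
    define G where "G u = P u - P \<alpha> - s * (u - \<alpha>)" for u
    have G_neg: "G u \<le> 0" if "l \<le> u" "u \<le> \<alpha>" for u
      using convex_on_real_chord(1)[OF P(1) la that] by (simp add: G_def s_def)
    have G_pos: "0 \<le> G u" if "u \<le> l \<or> \<alpha> \<le> u" for u
      using convex_on_real_chord(2)[OF P(1) la that] by (simp add: G_def s_def)
    have Gl: "G l = 0" using la by (simp add: G_def s_def field_simps)
    have [measurable]: "G \<in> borel_measurable borel" unfolding G_def[abs_def] by measurable
    have mean: "integral {a..b} \<psi> \<le> \<alpha> * (b - a)"
    proof -
      have "integral {a..b} \<psi> \<le> integral {a..b} (\<lambda>x. max 0 (\<psi> x - l) + l)"
        by (rule integral_le)
          (use int imax in \<open>auto intro!: Henstock_Kurzweil_Integration.integrable_add set_lebesgue_integral_eq_integral(1)\<close>)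
      also have "\<dots> = t * (\<alpha> - l) + l * (b - a)"
        using level \<open>a < b\<close> set_lebesgue_integral_eq_integral(1)[OF imax]
        by (subst Henstock_Kurzweil_Integration.integral_add) (auto simp: mult.commute)
      also have "\<dots> \<le> (b - a) * (\<alpha> - l) + l * (b - a)"
        using t la by (intro add_mono mult_right_mono) auto
      finally show ?thesis by (simp add: algebra_simps)
    qed
    obtain U where U: "open U" "U \<subseteq> {a<..<b}"
      "\<And>I. I \<in> components U \<Longrightarrow>
       \<exists>p q. a \<le> p \<and> p < q \<and> q \<le> b \<and> I = {p<..<q} \<and> integral {p..q} \<psi> = \<alpha> * (q - p)"
      "negligible {x \<in> {a..b} - U. \<alpha> < \<psi> x}"
      using rising_sun[OF \<open>a < b\<close> int mean] by blast
    have U_ab: "U \<subseteq> {a..b}" using U(2) by auto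
    have U_sets[measurable]: "U \<in> sets lebesgue" using U(1) by simp
    have U_lm: "U \<in> lmeasurable" by (rule fmeasurableI2[OF lm U_ab U_sets])
    have subU: "set_integrable lebesgue S f" if "set_integrable lebesgue {a..b} f" "S \<subseteq> {a..b}" "S \<in> sets lebesgue" for f :: "real \<Rightarrow> real" and S
      by (rule set_integrable_subset[OF that(1) that(3) that(2)])
    have on_comps: "(LINT x:U|lebesgue. f x) \<le> 0"
      if f: "set_integrable lebesgue {a..b} f" and le: "\<And>p q. a \<le> p \<Longrightarrow> p < q \<Longrightarrow> q \<le> b \<Longrightarrow> integral {p..q} \<psi> = \<alpha> * (q - p) \<Longrightarrow> integral {p..q} f \<le> 0" for f :: "real \<Rightarrow> real"
    proof -
      have "(LINT x:\<Union>(components U)|lebesgue. f x) \<le> 0"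
      proof (rule set_integral_countable_disjoint_nonpos[OF components_open_real[OF U(1)]])
        show "set_integrable lebesgue (\<Union>(components U)) f" using subU[OF f U_ab U_sets] by simp
        fix I assume "I \<in> components U"
        then obtain p q where pq: "a \<le> p" "p < q" "q \<le> b" "I = {p<..<q}" "integral {p..q} \<psi> = \<alpha> * (q - p)"
          using U(3) by blast
        have "set_integrable lebesgue I f" using pq by (intro subU[OF f]) auto
        then have "(LINT x:I|lebesgue. f x) = integral I f" by (rule set_lebesgue_integral_eq_integral(2))
        also have "\<dots> = integral {p..q} f" using integral_open_interval_real[of p q f] pq by simp
        finally show "(LINT x:I|lebesgue. f x) \<le> 0" using le[OF pq(1,2,3,5)] by simp
      qed
      then show ?thesis by simp
    qed
    define m where "m = measure lebesgue U"
    have const: "(LINT x:U|lebesgue. k) = k * m" for k :: real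
      using U_lm by (simp add: set_lebesgue_integral_def m_def fmeasurable_def)
    have hk: "f integrable_on {p..q}" if "set_integrable lebesgue {a..b} f" "a \<le> p" "q \<le> b" for f :: "real \<Rightarrow> real" and p q
      by (rule integrable_on_subinterval[OF set_lebesgue_integral_eq_integral(1)[OF that(1)]]) (use that in auto)
    have intc: "set_integrable lebesgue {a..b} (\<lambda>x. k)" for k :: real
      by (simp add: absolutely_integrable_on_const)
    have iG: "set_integrable lebesgue {a..b} (\<lambda>x. G (\<psi> x))"
      unfolding G_def using int intP intc by (intro set_integral_diff set_integrable_mult_right) auto
    have UG: "(LINT x:U|lebesgue. G (\<psi> x)) \<le> (C - 1) * P \<alpha> * m"
    proof -
      have "(LINT x:U|lebesgue. G (\<psi> x) - (C - 1) * P \<alpha>) \<le> 0"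
      proof (rule on_comps)
        show "set_integrable lebesgue {a..b} (\<lambda>x. G (\<psi> x) - (C - 1) * P \<alpha>)"
          using iG intc by (intro set_integral_diff) auto
        fix p q assume pq: "a \<le> p" "p < q" "q \<le> b" "integral {p..q} \<psi> = \<alpha> * (q - p)"
        have eq: "G (\<psi> x) - (C - 1) * P \<alpha> = P (\<psi> x) - s * \<psi> x - (C * P \<alpha> - s * \<alpha>)" for x
          by (simp add: G_def algebra_simps)
        have "integral {p..q} (\<lambda>x. G (\<psi> x) - (C - 1) * P \<alpha>) =
            integral {p..q} (\<lambda>x. P (\<psi> x)) - s * integral {p..q} \<psi> - (C * P \<alpha> - s * \<alpha>) * (q - p)"
        proof (rule integral_unique)
          have "((\<lambda>x. C * P \<alpha> - s * \<alpha>) has_integral (C * P \<alpha> - s * \<alpha>) * (q - p)) {p..q}"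
            using has_integral_const_real[of "C * P \<alpha> - s * \<alpha>" p q] pq(2) by (simp add: mult.commute)
          then show "((\<lambda>x. G (\<psi> x) - (C - 1) * P \<alpha>) has_integral
              integral {p..q} (\<lambda>x. P (\<psi> x)) - s * integral {p..q} \<psi> - (C * P \<alpha> - s * \<alpha>) * (q - p)) {p..q}"
            unfolding eq by (intro has_integral_diff has_integral_mult_right integrable_integral
                hk[OF intP pq(1,3)] hk[OF int pq(1,3)])
        qed
        also have "\<dots> = integral {p..q} (\<lambda>x. P (\<psi> x)) - C * (q - p) * P \<alpha>"
          unfolding pq(4) by (simp add: algebra_simps)
        also have "\<dots> \<le> 0" using A[OF pq(1-3)] pq(2) unfolding pq(4) by simp
        finally show "integral {p..q} (\<lambda>x. G (\<psi> x) - (C - 1) * P \<alpha>) \<le> 0" .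
      qed
      moreover have "(LINT x:U|lebesgue. G (\<psi> x) - (C - 1) * P \<alpha>) = (LINT x:U|lebesgue. G (\<psi> x)) - (C - 1) * P \<alpha> * m"
        using subU[OF iG U_ab U_sets] subU[OF intc U_ab U_sets] const by (subst set_integral_diff(2)) auto
      ultimately show ?thesis by simp
    qed
    \<comment> \<open>The mean over \<open>U\<close> is \<open>\<alpha>\<close>, so
      \<open>\<psi> - l\<close> has integral \<open>(\<alpha> - l) * m\<close> there, and this is at
      most the integral of the positive part over the whole interval.\<close>
    have mt: "m \<le> t"
    proof -
      have i1: "set_integrable lebesgue {a..b} (\<lambda>x. \<alpha> - \<psi> x)" using int intc by (intro set_integral_diff) auto
      have i2: "set_integrable lebesgue {a..b} (\<lambda>x. \<psi> x - l)" using int intc by (intro set_integral_diff) auto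
      have "(LINT x:U|lebesgue. \<alpha> - \<psi> x) \<le> 0"
      proof (rule on_comps[OF i1])
        fix p q assume pq: "a \<le> p" "p < q" "q \<le> b" "integral {p..q} \<psi> = \<alpha> * (q - p)"
        then show "integral {p..q} (\<lambda>x. \<alpha> - \<psi> x) \<le> 0"
          using hk[OF int pq(1,3)] by (subst Henstock_Kurzweil_Integration.integral_diff) (auto simp: algebra_simps)
      qed
      moreover have "(LINT x:U|lebesgue. \<alpha> - \<psi> x) + (LINT x:U|lebesgue. \<psi> x - l) = (LINT x:U|lebesgue. \<alpha> - l)"
        by (subst set_integral_add(2)[symmetric]) (use subU[OF i1 U_ab U_sets] subU[OF i2 U_ab U_sets] in auto)
      moreover have "(LINT x:U|lebesgue. \<psi> x - l) \<le> t * (\<alpha> - l)"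
        unfolding Lmax[symmetric] set_lebesgue_integral_def
        by (rule integral_mono) (use subU[OF i2 U_ab U_sets] imax U_ab in \<open>auto simp: set_integrable_def indicator_def\<close>)
      ultimately have "(\<alpha> - l) * m \<le> t * (\<alpha> - l)" using const by simp
      then show ?thesis using la by (simp add: mult.commute)
    qed
    have iGl: "set_integrable lebesgue {a..b} (\<lambda>x. if l < \<psi> x then G (\<psi> x) else 0)"
    proof (rule comp[where A = "P \<alpha> + \<bar>s\<bar> * \<bar>\<alpha>\<bar>" and B = "\<bar>s\<bar>" and D = 1])
      fix u
      have "\<bar>G u\<bar> \<le> \<bar>P u\<bar> + \<bar>P \<alpha>\<bar> + \<bar>s * (u - \<alpha>)\<bar>" unfolding G_def by linarith
      also have "\<bar>s * (u - \<alpha>)\<bar> \<le> \<bar>s\<bar> * (\<bar>u\<bar> + \<bar>\<alpha>\<bar>)" unfolding abs_mult by (intro mult_left_mono) auto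
      finally have "\<bar>G u\<bar> \<le> P \<alpha> + \<bar>s\<bar> * \<bar>\<alpha>\<bar> + \<bar>s\<bar> * \<bar>u\<bar> + 1 * P u" using P(2)[of u] P(2)[of \<alpha>] by (simp add: algebra_simps)
      then show "\<bar>if l < u then G u else 0\<bar> \<le> P \<alpha> + \<bar>s\<bar> * \<bar>\<alpha>\<bar> + \<bar>s\<bar> * \<bar>u\<bar> + 1 * P u"
        by (auto split: if_splits)
    qed measurable
    have "integral {a..b} (\<lambda>x. if l < \<psi> x then P (\<psi> x) - P l else 0)
       = integral {a..b} (\<lambda>x. (if l < \<psi> x then G (\<psi> x) else 0) + s * max 0 (\<psi> x - l))"
    proof (rule integral_cong)
      have "P u - P l = G u + s * (u - l)" for u using Gl by (simp add: G_def algebra_simps)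
      then show "(if l < \<psi> x then P (\<psi> x) - P l else 0) = (if l < \<psi> x then G (\<psi> x) else 0) + s * max 0 (\<psi> x - l)" for x
        by (auto simp: max_def)
    qed
    also have "\<dots> = (LINT x:{a..b}|lebesgue. if l < \<psi> x then G (\<psi> x) else 0) + s * (t * (\<alpha> - l))"
      using hk[OF iGl, of a b] hk[OF imax, of a b] level set_lebesgue_integral_eq_integral(2)[OF iGl]
      by (subst Henstock_Kurzweil_Integration.integral_add) (auto intro: integrable_on_mult_right)
    also have "(LINT x:{a..b}|lebesgue. if l < \<psi> x then G (\<psi> x) else 0) \<le> (LINT x:U|lebesgue. G (\<psi> x))"
      unfolding set_lebesgue_integral_def
    proof (rule integral_mono_AE)
      show "integrable lebesgue (\<lambda>x. indicat_real {a..b} x *\<^sub>R (if l < \<psi> x then G (\<psi> x) else 0))"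
        using iGl by (simp add: set_integrable_def)
      show "integrable lebesgue (\<lambda>x. indicat_real U x *\<^sub>R G (\<psi> x))"
        using subU[OF iG U_ab U_sets] by (simp add: set_integrable_def)
      have "AE x in lebesgue. x \<notin> {x \<in> {a..b} - U. \<alpha> < \<psi> x}"
        using U(4) unfolding negligible_iff_null_sets by (rule AE_not_in)
      then show "AE x in lebesgue. indicat_real {a..b} x *\<^sub>R (if l < \<psi> x then G (\<psi> x) else 0) \<le> indicat_real U x *\<^sub>R G (\<psi> x)"
      proof eventually_elim
        case (elim x)
        show ?case
        proof (cases "x \<in> U")
          case True
          then show ?thesis using U_ab G_pos[of "\<psi> x"] by auto
        next
          case False
          then show ?thesis using elim G_neg[of "\<psi> x"] by (auto simp: indicator_def)
        qed
      qed
    qed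
    also have "\<dots> \<le> (C - 1) * P \<alpha> * m" by (rule UG)
    also have "\<dots> \<le> (C - 1) * P \<alpha> * t"
      using mt \<open>1 \<le> C\<close> P(2)[of \<alpha>] by (intro mult_left_mono) auto
    finally have "integral {a..b} (\<lambda>x. if l < \<psi> x then P (\<psi> x) - P l else 0) \<le> (C - 1) * P \<alpha> * t + s * (t * (\<alpha> - l))"
      by simp
    also have "s * (t * (\<alpha> - l)) = t * (P \<alpha> - P l)" using la by (simp add: s_def)
    finally show ?thesis by (simp add: algebra_simps)
  qed
qed

section \<open>Existence of the rearrangement\<close>

text \<open>The function \<open>f\<close> is the quantile function of \<open>\<psi>\<close> under
  normalised Lebesgue measure, that is, the generalised inverse of the distribution function, read
  backwards. Equimeasurability is stated for all Borel \<open>F\<close>, with integrability as an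
  equivalence, so that moments, exponentials and truncations transfer in the same way.\<close>

lemma decreasing_rearrangement:
  fixes \<psi> :: "real \<Rightarrow> real"
  assumes "a < b" and int: "\<psi> absolutely_integrable_on {a..b}"
  obtains f :: "real \<Rightarrow> real" where "antimono_on {0<..<1} f"
    "\<And>F :: real \<Rightarrow> real. F \<in> borel_measurable borel \<Longrightarrow>
       (\<lambda>t. F (f t)) absolutely_integrable_on {0<..<1} \<longleftrightarrow> (\<lambda>x. F (\<psi> x)) absolutely_integrable_on {a..b}"
    "\<And>F :: real \<Rightarrow> real. F \<in> borel_measurable borel \<Longrightarrow>
       (LINT t:{0<..<1}|lebesgue. F (f t)) = (LINT x:{a..b}|lebesgue. F (\<psi> x)) / (b - a)"
proof -
  \<comment> \<open>The cut-off makes the function measurable on the whole line; the density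
    \<open>g\<close> vanishes where the values were changed.\<close>
  define \<psi>' where "\<psi>' x = indicator {a..b} x *\<^sub>R \<psi> x" for x
  have \<psi>'[measurable]: "\<psi>' \<in> borel_measurable lebesgue"
    using int unfolding \<psi>'_def[abs_def] set_integrable_def by auto
  define g where "g x = indicator {a..b} x / (b - a)" for x :: real
  have [measurable]: "g \<in> borel_measurable lebesgue" unfolding g_def[abs_def]
    by (intro borel_measurable_divide borel_measurable_indicator) auto
  have g0: "0 \<le> g x" for x using \<open>a < b\<close> by (simp add: g_def)
  define N where "N = density lebesgue g"
  have sN: "space N = UNIV" "sets N = sets lebesgue" by (auto simp: N_def)
  interpret N: prob_space N
  proof
    have "emeasure N (space N) = (\<integral>\<^sup>+x. ennreal (g x) \<partial>lebesgue)"
      by (simp add: N_def emeasure_density)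
    also have "\<dots> = (\<integral>\<^sup>+x. ennreal (1 / (b - a)) * indicator {a..b} x \<partial>lebesgue)"
      by (intro nn_integral_cong) (auto simp: g_def indicator_def)
    also have "\<dots> = ennreal (1 / (b - a)) * emeasure lebesgue {a..b}"
      by (intro nn_integral_cmult_indicator) simp
    also have "\<dots> = ennreal (1 / (b - a)) * ennreal (b - a)" using \<open>a < b\<close> by simp
    also have "\<dots> = 1" using \<open>a < b\<close> by (simp add: ennreal_mult[symmetric])
    finally show "emeasure N (space N) = 1" .
  qed
  define M where "M = distr N borel \<psi>'"
  have mN: "\<psi>' \<in> borel_measurable N" using \<psi>' measurable_cong_sets[OF sN(2) refl] by blast
  interpret M: cdf_distribution M
    unfolding cdf_distribution_def M_def by (rule N.real_distribution_distr[OF mN])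
  define I where "I = M.I"
  define h where "h s = indicator {0<..<1} s *\<^sub>R I s" for s
  have hm[measurable]: "h \<in> borel_measurable borel"
    using M.measurable_CI unfolding h_def[abs_def] I_def by (subst (asm) borel_measurable_restrict_space_iff) auto
  define f where "f t = h (1 - t)" for t
  have fm[measurable]: "f \<in> borel_measurable borel" unfolding f_def[abs_def] by measurable
  have anti: "antimono_on {0<..<1} f"
  proof (rule monotone_onI)
    fix s t :: real assume st: "s \<in> {0<..<1}" "t \<in> {0<..<1}" "s \<le> t"
    have "I (1 - t) \<le> I (1 - s)" unfolding I_def
      by (rule mono_onD[OF M.mono_I]) (use st in auto)
    then show "f t \<le> f s" using st by (simp add: f_def h_def)
  qed
  let ?R = "restrict_space lborel {0<..<1::real}"
  have hR: "distr ?R borel h = M"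
  proof -
    have "distr ?R borel h = distr ?R borel I"
      by (rule distr_cong) (auto simp: h_def space_restrict_space)
    then show ?thesis using M.distr_I_eq_M by (simp add: I_def)
  qed
  have hmR: "h \<in> borel_measurable ?R" by (intro measurable_restrict_space1) simp
  have chain: "((\<lambda>t. F (f t)) absolutely_integrable_on {0<..<1} \<longleftrightarrow> (\<lambda>x. F (\<psi> x)) absolutely_integrable_on {a..b}) \<and>
     (LINT t:{0<..<1}|lebesgue. F (f t)) = (LINT x:{a..b}|lebesgue. F (\<psi> x)) / (b - a)"
    if F[measurable]: "F \<in> borel_measurable borel" for F
  proof -
    define k where "k s = indicator {0<..<1} s *\<^sub>R F (h s)" for s :: real
    have [measurable]: "k \<in> borel_measurable borel" unfolding k_def[abs_def] by measurable
    have k: "indicator {0<..<1} t *\<^sub>R F (f t) = k (1 + (-1) * t)" for t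
      by (auto simp: k_def f_def indicator_def)
    have 1: "set_integrable lebesgue {0<..<1} (\<lambda>t. F (f t)) \<longleftrightarrow> integrable lborel k"
      unfolding set_integrable_def k
      by (subst integrable_completion) (auto simp: lborel_integrable_real_affine_iff[of "-1" k 1, simplified])
    have 2: "(LINT t:{0<..<1}|lebesgue. F (f t)) = integral\<^sup>L lborel k"
      unfolding set_lebesgue_integral_def k
      by (subst integral_completion) (auto simp: lborel_integral_real_affine[of "-1" k 1, simplified])
    have 3: "integrable lborel k \<longleftrightarrow> integrable M F"
      unfolding k_def[abs_def] hR[symmetric]
      by (subst integrable_restrict_space[symmetric]) (auto simp: integrable_distr_eq[OF hmR])
    have 4: "integral\<^sup>L lborel k = integral\<^sup>L M F"
      unfolding k_def[abs_def] hR[symmetric]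
      by (subst integral_restrict_space[symmetric]) (auto simp: integral_distr[OF hmR])
    have g\<psi>: "g x *\<^sub>R F (\<psi>' x) = (indicator {a..b} x *\<^sub>R F (\<psi> x)) / (b - a)" for x
      by (auto simp: g_def \<psi>'_def indicator_def)
    have F\<psi>: "(\<lambda>x. F (\<psi>' x)) \<in> borel_measurable lebesgue" by (rule measurable_compose[OF \<psi>' F])
    have 5: "integrable M F \<longleftrightarrow> set_integrable lebesgue {a..b} (\<lambda>x. F (\<psi> x))"
    proof -
      have "integrable M F \<longleftrightarrow> integrable N (\<lambda>x. F (\<psi>' x))"
        unfolding M_def by (rule integrable_distr_eq[OF mN F])
      also have "\<dots> \<longleftrightarrow> integrable lebesgue (\<lambda>x. g x *\<^sub>R F (\<psi>' x))"
        unfolding N_def using F\<psi> g0 by (intro integrable_density) auto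
      also have "\<dots> \<longleftrightarrow> set_integrable lebesgue {a..b} (\<lambda>x. F (\<psi> x))"
        unfolding g\<psi> set_integrable_def divide_inverse using \<open>a < b\<close> by (subst integrable_mult_right_iff) simp
      finally show ?thesis .
    qed
    have 6: "integral\<^sup>L M F = (LINT x:{a..b}|lebesgue. F (\<psi> x)) / (b - a)"
    proof -
      have "integral\<^sup>L M F = integral\<^sup>L N (\<lambda>x. F (\<psi>' x))"
        unfolding M_def by (rule integral_distr[OF mN F])
      also have "\<dots> = integral\<^sup>L lebesgue (\<lambda>x. g x *\<^sub>R F (\<psi>' x))"
        unfolding N_def using F\<psi> g0 by (intro integral_density) auto
      also have "\<dots> = (LINT x:{a..b}|lebesgue. F (\<psi> x)) / (b - a)"
        unfolding g\<psi> set_lebesgue_integral_def by simp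
      finally show ?thesis .
    qed
    show ?thesis using 1 2 3 4 5 6 by simp
  qed
  then show ?thesis using that[OF anti] by blast
qed

text \<open>For \<open>P = exp\<close> this is the condition on the weight over all subintervals.
  With \<open>P\<close> kept abstract, the weight formed from \<open>exp (- u)\<close> is covered as
  well, which the upper bound for the variance and the final intervals require.\<close>

locale reverse_jensen =
  fixes \<psi> P :: "real \<Rightarrow> real" and a b C :: real
  assumes ab: "a < b" and int: "\<psi> absolutely_integrable_on {a..b}"
    and intP: "(\<lambda>x. P (\<psi> x)) absolutely_integrable_on {a..b}"
    and convP: "convex_on UNIV P" and posP: "\<And>u. 0 < P u"
    and rev: "\<And>p q. a \<le> p \<Longrightarrow> p < q \<Longrightarrow> q \<le> b \<Longrightarrow>
        integral {p..q} (\<lambda>x. P (\<psi> x)) \<le> C * (q - p) * P (integral {p..q} \<psi> / (q - p))"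
    and C1: "1 \<le> C"

text \<open>A change of sign exchanges the lowest and the highest values. It reduces final intervals
  of the rearrangement to initial ones, and it later converts a statement about \<open>exp\<close>
  into the form used for the upper bound.\<close>

lemma (in reverse_jensen) uminus: "reverse_jensen (\<lambda>x. - \<psi> x) (\<lambda>u. P (- u)) a b C"
proof
  show "convex_on UNIV (\<lambda>u. P (- u))"
    unfolding convex_on_def
  proof (intro conjI ballI allI impI)
    fix x y u v :: real assume uv: "0 \<le> u" "0 \<le> v" "u + v = 1"
    have "P (u *\<^sub>R (- x) + v *\<^sub>R (- y)) \<le> u * P (- x) + v * P (- y)"
      using convP uv unfolding convex_on_def by blast
    then show "P (- (u *\<^sub>R x + v *\<^sub>R y)) \<le> u * P (- x) + v * P (- y)" by simp
  qed simp
  show "integral {p..q} (\<lambda>x. P (- (- \<psi> x))) \<le> C * (q - p) * P (- (integral {p..q} (\<lambda>x. - \<psi> x) / (q - p)))"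
    if "a \<le> p" "p < q" "q \<le> b" for p q
    using rev[OF that] by simp
  show "(\<lambda>x. - \<psi> x) absolutely_integrable_on {a..b}"
    using set_integrable_mult_right[of "-1", OF int] by simp
qed (use ab intP posP C1 in auto)

locale rearranged = reverse_jensen +
  fixes f :: "real \<Rightarrow> real"
  assumes anti: "antimono_on {0<..<1} f"
    and equi_int: "\<And>F :: real \<Rightarrow> real. F \<in> borel_measurable borel \<Longrightarrow>
       (\<lambda>t. F (f t)) absolutely_integrable_on {0<..<1} \<longleftrightarrow> (\<lambda>x. F (\<psi> x)) absolutely_integrable_on {a..b}"
    and equi: "\<And>F :: real \<Rightarrow> real. F \<in> borel_measurable borel \<Longrightarrow>
       (LINT t:{0<..<1}|lebesgue. F (f t)) = (LINT x:{a..b}|lebesgue. F (\<psi> x)) / (b - a)"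

lemma (in reverse_jensen) rearranged_exists: "\<exists>f. rearranged \<psi> P a b C f"
proof -
  obtain f :: "real \<Rightarrow> real" where "antimono_on {0<..<1} f"
    "\<And>F :: real \<Rightarrow> real. F \<in> borel_measurable borel \<Longrightarrow>
       (\<lambda>t. F (f t)) absolutely_integrable_on {0<..<1} \<longleftrightarrow> (\<lambda>x. F (\<psi> x)) absolutely_integrable_on {a..b}"
    "\<And>F :: real \<Rightarrow> real. F \<in> borel_measurable borel \<Longrightarrow>
       (LINT t:{0<..<1}|lebesgue. F (f t)) = (LINT x:{a..b}|lebesgue. F (\<psi> x)) / (b - a)"
    using decreasing_rearrangement[OF ab int] by blast
  then have "rearranged \<psi> P a b C f" by unfold_locales auto
  then show ?thesis by blast
qed

section \<open>Inequalities inherited by initial and final intervals\<close>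

context rearranged
begin

lemma P_measurable[measurable]: "P \<in> borel_measurable borel"
  using convex_on_continuous[OF open_UNIV convP] by (rule borel_measurable_continuous_onI)

lemma equi_int_closed:
  fixes F :: "real \<Rightarrow> real"
  assumes "F \<in> borel_measurable borel"
  shows "(\<lambda>t. F (f t)) absolutely_integrable_on {0..1} \<longleftrightarrow> (\<lambda>x. F (\<psi> x)) absolutely_integrable_on {a..b}"
  using equi_int[OF assms] absolutely_integrable_on_open_interval[of 0 1 "\<lambda>t. F (f t)"] by simp

lemma equi_closed:
  fixes F :: "real \<Rightarrow> real"
  assumes "F \<in> borel_measurable borel" "(\<lambda>t. F (f t)) absolutely_integrable_on {0..1}"
  shows "integral {0..1} (\<lambda>t. F (f t)) = integral {a..b} (\<lambda>x. F (\<psi> x)) / (b - a)"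
proof -
  have "(\<lambda>t. F (f t)) absolutely_integrable_on {0<..<1}"
    using assms(2) absolutely_integrable_on_open_interval[of 0 1 "\<lambda>t. F (f t)"] by simp
  moreover have "(\<lambda>x. F (\<psi> x)) absolutely_integrable_on {a..b}"
    using equi_int_closed[OF assms(1)] assms(2) by simp
  ultimately show ?thesis
    using equi[OF assms(1)] integral_open_interval_real[of 0 1 "\<lambda>t. F (f t)"]
    by (simp add: set_lebesgue_integral_eq_integral(2))
qed

lemma f_int: "f absolutely_integrable_on {0..1}"
  using equi_int_closed[of "\<lambda>x. x"] int by simp

lemma Pf_int: "(\<lambda>t. P (f t)) absolutely_integrable_on {0..1}"
  using equi_int_closed[of P] intP by simp

lemma f_ge: "0 < s \<Longrightarrow> s \<le> t \<Longrightarrow> t < 1 \<Longrightarrow> f t \<le> f s"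
  using anti by (auto simp: monotone_on_def)

lemma integrable_on_sub:
  "(g :: real \<Rightarrow> real) absolutely_integrable_on {0..1} \<Longrightarrow> 0 \<le> s \<Longrightarrow> t \<le> 1 \<Longrightarrow> g integrable_on {s..t}"
  by (rule integrable_on_subinterval[OF set_lebesgue_integral_eq_integral(1)]) auto

text \<open>If \<open>f\<close> has a plateau at height \<open>f t\<close>, the set where
  \<open>f\<close> exceeds \<open>f t\<close> is shorter than the interval up to \<open>t\<close>.
  The difference does not matter because \<open>F\<close> vanishes at that height.\<close>

lemma integral_head:
  assumes t: "0 < t" "t < 1" and F: "(\<lambda>s. F (f s)) absolutely_integrable_on {0..1}"
    and "F (f t) = (0::real)"
    and G: "\<And>u. G u = (if f t < u then F u else 0)"
  shows "integral {0..1} (\<lambda>s. G (f s)) = integral {0..t} (\<lambda>s. F (f s))"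
proof -
  have "((\<lambda>s. F (f s)) has_integral integral {0..t} (\<lambda>s. F (f s))) {0..t}"
    using integrable_on_sub[OF F, of 0 t] t by (simp add: integrable_integral)
  then have 1: "((\<lambda>s. G (f s)) has_integral integral {0..t} (\<lambda>s. F (f s))) {0..t}"
  proof (rule has_integral_spike_finite[rotated 2])
    show "finite {0, t}" by simp
    fix s assume "s \<in> {0..t} - {0, t}"
    then have "f t \<le> f s" using f_ge[of s t] t by auto
    then show "G (f s) = F (f s)" using assms(4) by (auto simp: G)
  qed
  have "((\<lambda>s. 0::real) has_integral 0) {t..1}" by simp
  then have 2: "((\<lambda>s. G (f s)) has_integral 0) {t..1}"
  proof (rule has_integral_spike_finite[rotated 2])
    show "finite {1, t}" by simp
    fix s assume "s \<in> {t..1} - {1, t}"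
    then have "f s \<le> f t" using f_ge[of t s] t by auto
    then show "G (f s) = 0" by (auto simp: G)
  qed
  show ?thesis using has_integral_combine[OF _ _ 1 2] t by (simp add: integral_unique)
qed

lemma integral_tail:
  assumes t: "0 < t" "t < 1" and F: "(\<lambda>s. F (f s)) absolutely_integrable_on {0..1}"
    and "F (f t) = (0::real)"
    and G: "\<And>u. G u = (if u < f t then F u else 0)"
  shows "integral {0..1} (\<lambda>s. G (f s)) = integral {t..1} (\<lambda>s. F (f s))"
proof -
  have "((\<lambda>s. F (f s)) has_integral integral {t..1} (\<lambda>s. F (f s))) {t..1}"
    using integrable_on_sub[OF F, of t 1] t by (simp add: integrable_integral)
  then have 1: "((\<lambda>s. G (f s)) has_integral integral {t..1} (\<lambda>s. F (f s))) {t..1}"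
  proof (rule has_integral_spike_finite[rotated 2])
    show "finite {1, t}" by simp
    fix s assume "s \<in> {t..1} - {1, t}"
    then have "f s \<le> f t" using f_ge[of t s] t by auto
    then show "G (f s) = F (f s)" using assms(4) by (auto simp: G)
  qed
  have "((\<lambda>s. 0::real) has_integral 0) {0..t}" by simp
  then have 2: "((\<lambda>s. G (f s)) has_integral 0) {0..t}"
  proof (rule has_integral_spike_finite[rotated 2])
    show "finite {0, t}" by simp
    fix s assume "s \<in> {0..t} - {0, t}"
    then have "f t \<le> f s" using f_ge[of s t] t by auto
    then show "G (f s) = 0" by (auto simp: G)
  qed
  show ?thesis using has_integral_combine[OF _ _ 2 1] t by (simp add: integral_unique)
qed

lemma const_int: "(\<lambda>t. c :: real) absolutely_integrable_on {0..1::real}"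
  by (simp add: absolutely_integrable_on_const)

lemma integral_diff_const:
  assumes "g absolutely_integrable_on {0..1}" "0 \<le> s" "s \<le> t" "t \<le> 1"
  shows "integral {s..t} (\<lambda>x. g x - c) = integral {s..t} g - (t - s) * (c::real)"
  using integrable_on_sub[OF assms(1,2,4)] assms by (subst Henstock_Kurzweil_Integration.integral_diff) auto

lemma full_ineq: "integral {0..1} (\<lambda>s. P (f s)) \<le> C * P (integral {0..1} f)"
proof -
  have "integral {0..1} (\<lambda>s. P (f s)) = integral {a..b} (\<lambda>x. P (\<psi> x)) / (b - a)"
    by (rule equi_closed[OF P_measurable Pf_int])
  also have "\<dots> \<le> C * P (integral {a..b} \<psi> / (b - a))" using rev[of a b] ab by (simp add: field_simps)
  also have "integral {a..b} \<psi> / (b - a) = integral {0..1} f"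
    using equi_closed[of "\<lambda>x. x"] f_int by simp
  finally show ?thesis .
qed

lemma int_if:
  assumes "(\<lambda>s. F (f s)) absolutely_integrable_on {0..1}" "F \<in> borel_measurable borel" "S \<in> sets borel"
  shows "(\<lambda>s. if f s \<in> S then F (f s) else 0 :: real) absolutely_integrable_on {0..1}"
    and "(\<lambda>u. if u \<in> S then F u else 0) \<in> borel_measurable borel"
proof -
  show m: "(\<lambda>u. if u \<in> S then F u else 0) \<in> borel_measurable borel" using assms(2,3) by measurable
  have i: "(\<lambda>x. F (\<psi> x)) absolutely_integrable_on {a..b}" using assms(1) equi_int_closed[OF assms(2)] by simp
  have "(\<lambda>x. if \<psi> x \<in> S then F (\<psi> x) else 0) absolutely_integrable_on {a..b}"
  proof (rule set_integrable_bound[OF i])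
    show "set_borel_measurable lebesgue {a..b} (\<lambda>x. if \<psi> x \<in> S then F (\<psi> x) else 0)"
      by (rule borel_measurable_indicator_compose[OF set_integrable_imp_set_borel_measurable[OF int] m]) simp
  qed auto
  then show "(\<lambda>s. if f s \<in> S then F (f s) else 0 :: real) absolutely_integrable_on {0..1}"
    using equi_int_closed[OF m] by simp
qed

text \<open>Apply \<open>level_set_inequality\<close> at the level \<open>f t\<close>, with the mean
  of \<open>f\<close> over the initial interval as \<open>\<alpha>\<close> and with \<open>t\<close>
  rescaled by the length \<open>b - a\<close>.\<close>

lemma head_ineq:
  assumes "0 < t" "t \<le> 1"
  shows "integral {0..t} (\<lambda>s. P (f s)) \<le> C * t * P (integral {0..t} f / t)"
proof (cases "t = 1")
  case True
  then show ?thesis using full_ineq by simp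
next
  case False
  with assms have t: "0 < t" "t < 1" by auto
  define l where "l = f t"
  define \<alpha> where "\<alpha> = integral {0..t} f / t"
  have i1: "(\<lambda>s. f s - l) absolutely_integrable_on {0..1}" by (intro set_integral_diff f_int const_int)
  have i2: "(\<lambda>s. P (f s) - P l) absolutely_integrable_on {0..1}" by (intro set_integral_diff Pf_int const_int)
  note j1 = int_if[of "\<lambda>u. u - l" "{l<..}", OF i1]
  note j2 = int_if[of "\<lambda>u. P u - P l" "{l<..}", OF i2]
  have max_eq: "max 0 (u - l) = (if u \<in> {l<..} then u - l else 0)" for u by (auto simp: max_def)
  have "integral {a..b} (\<lambda>x. max 0 (\<psi> x - l)) = (b - a) * integral {0..1} (\<lambda>s. if f s \<in> {l<..} then f s - l else 0)"
    using equi_closed[OF j1(2) j1(1)] ab by (simp add: max_eq)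
  also have "integral {0..1} (\<lambda>s. if f s \<in> {l<..} then f s - l else 0) = integral {0..t} (\<lambda>s. f s - l)"
    by (rule integral_head[OF t, of "\<lambda>u. u - l" "\<lambda>u. if u \<in> {l<..} then u - l else 0"]) (use i1 in \<open>auto simp: l_def\<close>)
  also have "\<dots> = t * (\<alpha> - l)" using integral_diff_const[OF f_int, of 0 t l] t by (simp add: \<alpha>_def right_diff_distrib)
  finally have level: "integral {a..b} (\<lambda>x. max 0 (\<psi> x - l)) = ((b - a) * t) * (\<alpha> - l)" by simp
  have "integral {a..b} (\<lambda>x. if l < \<psi> x then P (\<psi> x) - P l else 0) + ((b - a) * t) * P l \<le> C * ((b - a) * t) * P \<alpha>"
    by (rule level_set_inequality[OF ab int intP convP posP rev C1 _ _ level]) (use t ab in auto)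
  moreover have "integral {a..b} (\<lambda>x. if l < \<psi> x then P (\<psi> x) - P l else 0) = (b - a) * integral {0..t} (\<lambda>s. P (f s) - P l)"
  proof -
    have "integral {a..b} (\<lambda>x. if l < \<psi> x then P (\<psi> x) - P l else 0) = (b - a) * integral {0..1} (\<lambda>s. if f s \<in> {l<..} then P (f s) - P l else 0)"
      using equi_closed[OF j2(2) j2(1)] ab by simp
    also have "integral {0..1} (\<lambda>s. if f s \<in> {l<..} then P (f s) - P l else 0) = integral {0..t} (\<lambda>s. P (f s) - P l)"
      by (rule integral_head[OF t, of "\<lambda>u. P u - P l" "\<lambda>u. if u \<in> {l<..} then P u - P l else 0"]) (use i2 in \<open>auto simp: l_def\<close>)
    finally show ?thesis .
  qed
  moreover have "integral {0..t} (\<lambda>s. P (f s) - P l) = integral {0..t} (\<lambda>s. P (f s)) - t * P l"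
    using integral_diff_const[OF Pf_int, of 0 t "P l"] t by simp
  ultimately have "(b - a) * integral {0..t} (\<lambda>s. P (f s)) \<le> (b - a) * (C * t * P \<alpha>)"
    by (simp add: algebra_simps)
  then show ?thesis using ab by (simp add: \<alpha>_def)
qed

text \<open>The same estimate for \<open>- \<psi>\<close> at the level \<open>- f t\<close>: values
  below \<open>f t\<close> become values above the level.\<close>

lemma tail_ineq:
  assumes t: "0 < t" "t < 1"
  shows "integral {t..1} (\<lambda>s. P (f s)) \<le> C * (1 - t) * P (integral {t..1} f / (1 - t))"
proof -
  define l where "l = f t"
  define \<alpha> where "\<alpha> = integral {t..1} f / (1 - t)"
  have i1: "(\<lambda>s. l - f s) absolutely_integrable_on {0..1}" by (intro set_integral_diff f_int const_int)
  have i2: "(\<lambda>s. P (f s) - P l) absolutely_integrable_on {0..1}" by (intro set_integral_diff Pf_int const_int)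
  note j1 = int_if[of "\<lambda>u. l - u" "{..<l}", OF i1]
  note j2 = int_if[of "\<lambda>u. P u - P l" "{..<l}", OF i2]
  interpret m: reverse_jensen "\<lambda>x. - \<psi> x" "\<lambda>u. P (- u)" a b C by (rule uminus)
  have max_eq: "max 0 (- u - (- l)) = (if u \<in> {..<l} then l - u else 0)" for u by (auto simp: max_def)
  have "integral {a..b} (\<lambda>x. max 0 (- \<psi> x - (- l))) = (b - a) * integral {0..1} (\<lambda>s. if f s \<in> {..<l} then l - f s else 0)"
    unfolding max_eq using equi_closed[OF j1(2) j1(1)] ab by simp
  also have "integral {0..1} (\<lambda>s. if f s \<in> {..<l} then l - f s else 0) = integral {t..1} (\<lambda>s. l - f s)"
    by (rule integral_tail[OF t, of "\<lambda>u. l - u" "\<lambda>u. if u \<in> {..<l} then l - u else 0"]) (use i1 in \<open>auto simp: l_def\<close>)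
  also have "\<dots> = (1 - t) * (- \<alpha> - (- l))"
    using integrable_on_sub[OF f_int, of t 1] t
    by (subst Henstock_Kurzweil_Integration.integral_diff) (auto simp: \<alpha>_def field_simps)
  finally have level: "integral {a..b} (\<lambda>x. max 0 (- \<psi> x - (- l))) = ((b - a) * (1 - t)) * (- \<alpha> - (- l))" by simp
  have "integral {a..b} (\<lambda>x. if - l < - \<psi> x then P (- (- \<psi> x)) - P (- (- l)) else 0) + ((b - a) * (1 - t)) * P (- (- l)) \<le> C * ((b - a) * (1 - t)) * P (- (- \<alpha>))"
    by (rule level_set_inequality[OF ab m.int m.intP m.convP m.posP m.rev C1 _ _ level]) (use t ab in auto)
  moreover have "integral {a..b} (\<lambda>x. if - l < - \<psi> x then P (- (- \<psi> x)) - P (- (- l)) else 0) = (b - a) * integral {t..1} (\<lambda>s. P (f s) - P l)"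
  proof -
    have "integral {a..b} (\<lambda>x. if - l < - \<psi> x then P (- (- \<psi> x)) - P (- (- l)) else 0) = (b - a) * integral {0..1} (\<lambda>s. if f s \<in> {..<l} then P (f s) - P l else 0)"
      unfolding minus_minus using equi_closed[OF j2(2) j2(1)] ab by simp
    also have "integral {0..1} (\<lambda>s. if f s \<in> {..<l} then P (f s) - P l else 0) = integral {t..1} (\<lambda>s. P (f s) - P l)"
      by (rule integral_tail[OF t, of "\<lambda>u. P u - P l" "\<lambda>u. if u \<in> {..<l} then P u - P l else 0"]) (use i2 in \<open>auto simp: l_def\<close>)
    finally show ?thesis .
  qed
  moreover have "integral {t..1} (\<lambda>s. P (f s) - P l) = integral {t..1} (\<lambda>s. P (f s)) - (1 - t) * P l"
    using integral_diff_const[OF Pf_int, of t 1 "P l"] t by simp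
  ultimately have "(b - a) * integral {t..1} (\<lambda>s. P (f s)) \<le> (b - a) * (C * (1 - t) * P \<alpha>)"
    by (simp add: algebra_simps)
  then show ?thesis using ab by (simp add: \<alpha>_def)
qed

end

section \<open>Bellman functions along a rearrangement\<close>

text \<open>The function \<open>S\<close> will contain a choice of maximisers, so no regularity of
  it is at hand. Uniform continuity of the auxiliary function \<open>F\<close> splits the interval
  into finitely many steps short enough for the local comparison.\<close>

lemma mono_by_small_steps:
  fixes S F :: "real \<Rightarrow> real"
  assumes "\<tau> < r" "continuous_on {\<tau>..r} F" "0 < \<epsilon>"
    and step: "\<And>s t. \<tau> \<le> s \<Longrightarrow> s < t \<Longrightarrow> t \<le> r \<Longrightarrow> F s - F t \<le> \<epsilon> \<Longrightarrow> S s \<le> S t"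
  shows "S \<tau> \<le> S r"
proof -
  have "uniformly_continuous_on {\<tau>..r} F" using assms(2) by (intro compact_uniformly_continuous) auto
  then obtain d where d: "0 < d" "\<And>s t. s \<in> {\<tau>..r} \<Longrightarrow> t \<in> {\<tau>..r} \<Longrightarrow> dist t s < d \<Longrightarrow> dist (F t) (F s) < \<epsilon>"
    unfolding uniformly_continuous_on_def using \<open>0 < \<epsilon>\<close> by metis
  obtain n :: nat where n: "(r - \<tau>) / d < n" using reals_Archimedean2 by blast
  have "0 < (r - \<tau>) / d" using assms(1) d by simp
  then have n0: "0 < real n" using n by linarith
  define p where "p k = \<tau> + real k * (r - \<tau>) / n" for k :: nat
  have pd: "(r - \<tau>) / n < d" using n n0 d by (simp add: field_simps)
  have p_in: "p k \<in> {\<tau>..r}" if "k \<le> n" for k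
  proof -
    have "real k * (r - \<tau>) \<le> real n * (r - \<tau>)" using that assms(1) by (intro mult_right_mono) auto
    moreover have "0 \<le> real k * (r - \<tau>)" using assms(1) by simp
    ultimately show ?thesis using n0 by (auto simp: p_def pos_divide_le_eq mult.commute)
       (simp add: field_simps)
  qed
  have "S \<tau> \<le> S (p k)" if "k \<le> n" for k
    using that
  proof (induction k)
    case 0
    then show ?case by (simp add: p_def)
  next
    case (Suc k)
    have diff: "p (Suc k) - p k = (r - \<tau>) / n" by (simp add: p_def distrib_right add_divide_distrib)
    then have lt: "p k < p (Suc k)" using n0 assms(1) by (metis diff_gt_0_iff_gt divide_pos_pos)
    have "dist (F (p (Suc k))) (F (p k)) < \<epsilon>"
      using d(2)[of "p k" "p (Suc k)"] p_in[of k] p_in[of "Suc k"] Suc.prems diff lt pd by (auto simp: dist_real_def)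
    then have "S (p k) \<le> S (p (Suc k))"
      using p_in[of k] p_in[of "Suc k"] Suc.prems lt by (intro step) (auto simp: dist_real_def)
    then show ?case using Suc by simp
  qed
  from this[of n] show ?thesis using n0 by (simp add: p_def)
qed

context rearranged
begin

text \<open>\<open>mean_f t\<close> and \<open>mean_P t\<close> are the coordinates of the moving
  point.\<close>

definition mean_f :: "real \<Rightarrow> real" where "mean_f t = integral {0..t} f / t"
definition mean_P :: "real \<Rightarrow> real" where "mean_P t = integral {0..t} (\<lambda>s. P (f s)) / t"

lemma integral_split:
  assumes "(g :: real \<Rightarrow> real) absolutely_integrable_on {0..1}" "0 \<le> s" "s \<le> t" "t \<le> 1"
  shows "integral {0..t} g = integral {0..s} g + integral {s..t} g"
  using Henstock_Kurzweil_Integration.integral_combine[OF assms(2,3) integrable_on_sub[OF assms(1) order_refl assms(4)]] by simp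

lemma integral_le_open:
  fixes g k :: "real \<Rightarrow> real"
  assumes "g integrable_on {s..t}" "k integrable_on {s..t}" "\<And>r. s < r \<Longrightarrow> r < t \<Longrightarrow> g r \<le> k r"
  shows "integral {s..t} g \<le> integral {s..t} k"
proof -
  have "integral {s<..<t} g \<le> integral {s<..<t} k"
    by (rule integral_le) (use assms in \<open>auto simp: integrable_on_Icc_iff_Ioo\<close>)
  then show ?thesis by (simp add: integral_open_interval_real)
qed

lemma f_le_mean: "0 < s \<Longrightarrow> s < 1 \<Longrightarrow> f s \<le> mean_f s"
proof -
  assume s: "0 < s" "s < 1"
  have "integral {0..s} (\<lambda>_. f s) \<le> integral {0..s} f"
    by (rule integral_le_open) (use s integrable_on_sub[OF f_int, of 0 s] f_ge in auto)
  then show ?thesis using s by (simp add: mean_f_def field_simps)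
qed

lemma mean_f_antimono:
  assumes "0 < s" "s \<le> t" "t \<le> 1" shows "mean_f t \<le> mean_f s"
proof (cases "s = 1")
  case False
  then have s: "s < 1" using assms by simp
  have "integral {s..t} f \<le> integral {s..t} (\<lambda>_. mean_f s)"
    by (rule integral_le_open)
      (use assms integrable_on_sub[OF f_int, of s t] in \<open>auto intro: order_trans[OF f_ge[of s] f_le_mean[OF assms(1) s]]\<close>)
  then have "integral {0..t} f \<le> s * mean_f s + (t - s) * mean_f s"
    using integral_split[OF f_int, of s t] assms by (simp add: mean_f_def)
  then show ?thesis using assms by (simp add: mean_f_def[of t] field_simps)
qed (use assms in auto)

lemma mean_f_continuous:
  assumes "0 < \<tau>" shows "continuous_on {\<tau>..1} mean_f"
proof -
  have "continuous_on {0..1} (\<lambda>t. integral {0..t} f)"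
    by (rule indefinite_integral_continuous_1) (use integrable_on_sub[OF f_int, of 0 1] in auto)
  then have "continuous_on {\<tau>..1} (\<lambda>t. integral {0..t} f)"
    by (rule continuous_on_subset) (use assms in auto)
  then show ?thesis unfolding mean_f_def[abs_def] by (intro continuous_intros) (use assms in auto)
qed

lemma mean_P_le: "0 < t \<Longrightarrow> t \<le> 1 \<Longrightarrow> mean_P t \<le> C * P (mean_f t)"
  using head_ineq[of t] by (simp add: mean_P_def mean_f_def field_simps)

lemma mean_P_ge:
  assumes sub: "\<And>u. P (mean_f t) + m * (u - mean_f t) \<le> P u" and t: "0 < t" "t \<le> 1"
  shows "P (mean_f t) \<le> mean_P t"
proof -
  have i: "f integrable_on {0..t}" "(\<lambda>s. P (f s)) integrable_on {0..t}"
    using integrable_on_sub[OF f_int, of 0 t] integrable_on_sub[OF Pf_int, of 0 t] t by auto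
  have h: "((\<lambda>s. P (mean_f t) + m * (f s - mean_f t)) has_integral
      (t * P (mean_f t) + m * (integral {0..t} f - t * mean_f t))) {0..t}"
    using i t has_integral_const_real[of "P (mean_f t)" 0 t] has_integral_const_real[of "mean_f t" 0 t]
    by (intro has_integral_add has_integral_mult_right has_integral_diff integrable_integral) auto
  have "t * P (mean_f t) + m * (integral {0..t} f - t * mean_f t) \<le> integral {0..t} (\<lambda>s. P (f s))"
    by (rule has_integral_le[OF h integrable_integral[OF i(2)]]) (rule sub)
  then show ?thesis using t by (simp add: mean_P_def mean_f_def field_simps)
qed

end

text \<open>A candidate Bellman function, given as an envelope of affine functions of the point
  \<open>(\<langle>f\<rangle>, \<langle>P f\<rangle>)\<close>.  The slack \<open>\<xi> < \<xi>'\<close> keeps the points away from the upper boundary of the domain,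
  where the envelope is not differentiable.\<close>

locale bellman_candidate =
  fixes P h \<alpha> \<beta> \<kappa> :: "real \<Rightarrow> real" and C \<xi> \<xi>' :: real
  assumes xi: "0 \<le> \<xi>" "\<xi> < \<xi>'"
    and subgrad: "\<And>x. \<exists>m. \<forall>u. P x + m * (u - x) \<le> P u"
    and below: "\<And>v u. - \<xi>' \<le> v \<Longrightarrow> u \<le> v + \<xi>' \<Longrightarrow> \<alpha> v + \<beta> v * u + \<kappa> v * P u \<le> h u"
    and select: "\<And>x y. 0 \<le> x \<Longrightarrow> P x \<le> y \<Longrightarrow> y \<le> C * P x \<Longrightarrow>
       \<exists>v\<in>{x - \<xi>..x}. \<forall>w\<in>{x - \<xi>'..x}. \<alpha> w + \<beta> w * x + \<kappa> w * y \<le> \<alpha> v + \<beta> v * x + \<kappa> v * y"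

text \<open>Follow the integral of \<open>h (f s)\<close> up to \<open>t\<close> minus
  \<open>t\<close> times the best affine value at the point for \<open>t\<close>. For a fixed
  parameter \<open>w\<close>, the change of \<open>t * L w t\<close> over a step is exactly the
  integral of the affine function along \<open>(f, P f)\<close>, hence at most the integral of
  \<open>h (f s)\<close>. With \<open>w\<close> the best parameter at the right end, passing to the
  best one at the left end only helps. The path begins at \<open>\<tau> > 0\<close> since
  \<open>f\<close> may be unbounded near 0; the affine value at \<open>\<tau>\<close> stays in the
  conclusion and is treated separately in each application.\<close>

lemma (in rearranged) trajectory:
  assumes bc: "bellman_candidate P h \<alpha> \<beta> \<kappa> C \<xi> \<xi>'"
    and mean0: "integral {0..1} f = 0" and \<tau>: "0 < \<tau>" "\<tau> < 1"
    and hf: "(\<lambda>s. h (f s)) integrable_on {\<tau>..1}"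
  shows "\<exists>v\<in>{mean_f \<tau> - \<xi>..mean_f \<tau>}. \<forall>w\<in>{-\<xi>'..0}.
    \<alpha> w + \<kappa> w * integral {0..1} (\<lambda>s. P (f s))
      \<le> \<tau> * (\<alpha> v + \<beta> v * mean_f \<tau> + \<kappa> v * mean_P \<tau>) + integral {\<tau>..1} (\<lambda>s. h (f s))"
proof -
  interpret bellman_candidate P h \<alpha> \<beta> \<kappa> C \<xi> \<xi>' by (rule bc)
  have m1: "mean_f 1 = 0" using mean0 by (simp add: mean_f_def)
  have pos: "0 \<le> mean_f t" if "0 < t" "t \<le> 1" for t using mean_f_antimono[of t 1] that m1 by simp
  define L where "L v t = \<alpha> v + \<beta> v * mean_f t + \<kappa> v * mean_P t" for v t
  have "\<exists>v. v \<in> {mean_f t - \<xi>..mean_f t} \<and> (\<forall>w\<in>{mean_f t - \<xi>'..mean_f t}. L w t \<le> L v t)" if t: "0 < t" "t \<le> 1" for t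
  proof -
    obtain m where "\<And>u. P (mean_f t) + m * (u - mean_f t) \<le> P u" using subgrad by blast
    then have "P (mean_f t) \<le> mean_P t" using mean_P_ge t by blast
    then show ?thesis using select[of "mean_f t" "mean_P t"] pos[OF t] mean_P_le[OF t] unfolding L_def by blast
  qed
  then obtain v where v: "\<And>t. 0 < t \<Longrightarrow> t \<le> 1 \<Longrightarrow> v t \<in> {mean_f t - \<xi>..mean_f t}"
    "\<And>t w. 0 < t \<Longrightarrow> t \<le> 1 \<Longrightarrow> w \<in> {mean_f t - \<xi>'..mean_f t} \<Longrightarrow> L w t \<le> L (v t) t" by metis
  define S where "S t = integral {\<tau>..t} (\<lambda>s. h (f s)) - t * L (v t) t" for t
  have "S \<tau> \<le> S 1"
  proof (rule mono_by_small_steps[OF \<tau>(2) mean_f_continuous[OF \<tau>(1)], of "\<xi>' - \<xi>"])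
    show "0 < \<xi>' - \<xi>" using xi by simp
    fix s t assume st: "\<tau> \<le> s" "s < t" "t \<le> 1" "mean_f s - mean_f t \<le> \<xi>' - \<xi>"
    have s0: "0 < s" "s < 1" using st \<tau> by auto
    have t0: "0 < t" "t \<le> 1" using st \<tau> by auto
    define w where "w = v t"
    have w: "mean_f t - \<xi> \<le> w" "w \<le> mean_f t" using v(1)[OF t0] by (auto simp: w_def)
    have tL: "r * L w r = r * \<alpha> w + \<beta> w * integral {0..r} f + \<kappa> w * integral {0..r} (\<lambda>s. P (f s))" if "0 < r" for r
      using that by (simp add: L_def mean_f_def mean_P_def field_simps)
    have i: "f integrable_on {s..t}" "(\<lambda>s. P (f s)) integrable_on {s..t}"
      using integrable_on_sub[OF f_int, of s t] integrable_on_sub[OF Pf_int, of s t] s0 t0 by auto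
    have ih: "(\<lambda>s. h (f s)) integrable_on {s..t}"
      by (rule integrable_on_subinterval[OF hf]) (use st in auto)
    have hl: "((\<lambda>r. \<alpha> w + \<beta> w * f r + \<kappa> w * P (f r)) has_integral
      ((t - s) * \<alpha> w + \<beta> w * integral {s..t} f + \<kappa> w * integral {s..t} (\<lambda>s. P (f s)))) {s..t}"
      using i st has_integral_const_real[of "\<alpha> w" s t]
      by (intro has_integral_add has_integral_mult_right integrable_integral) auto
    have "integral {s..t} (\<lambda>r. \<alpha> w + \<beta> w * f r + \<kappa> w * P (f r)) \<le> integral {s..t} (\<lambda>r. h (f r))"
    proof (rule integral_le_open)
      show "(\<lambda>r. \<alpha> w + \<beta> w * f r + \<kappa> w * P (f r)) integrable_on {s..t}" using hl by blast
      fix r assume r: "s < r" "r < t"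
      have "f r \<le> f s" using f_ge[of s r] r s0 t0 by simp
      also have "f s \<le> mean_f s" by (rule f_le_mean[OF s0])
      \<comment> \<open>Here the slack is spent: over the step the mean drops by at most
        \<open>\<xi>' - \<xi>\<close>, and \<open>w\<close> is within \<open>\<xi>\<close> of the
        mean at \<open>t\<close>. The same count shows below that \<open>w\<close> lies in the
        window at \<open>s\<close>.\<close>
      finally have "f r \<le> w + \<xi>'" using st w by simp
      moreover have "- \<xi>' \<le> w" using w pos[OF t0] xi by simp
      ultimately show "\<alpha> w + \<beta> w * f r + \<kappa> w * P (f r) \<le> h (f r)" by (rule below[rotated])
    qed (rule ih)
    then have "t * L w t \<le> s * L w s + integral {s..t} (\<lambda>r. h (f r))"
      unfolding tL[OF t0(1)] tL[OF s0(1)]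
      using integral_unique[OF hl] integral_split[OF f_int, of s t] integral_split[OF Pf_int, of s t] s0 t0 st
      by (simp add: algebra_simps)
    also have "L w s \<le> L (v s) s"
      by (rule v(2)) (use s0 w st mean_f_antimono[of s t] xi in auto)
    finally have "t * L w t \<le> s * L (v s) s + integral {s..t} (\<lambda>r. h (f r))" using s0 by (simp add: mult_left_mono)
    moreover have "integral {\<tau>..t} (\<lambda>r. h (f r)) = integral {\<tau>..s} (\<lambda>r. h (f r)) + integral {s..t} (\<lambda>r. h (f r))"
    proof -
      have "(\<lambda>s. h (f s)) integrable_on {\<tau>..t}" by (rule integrable_on_subinterval[OF hf]) (use st in auto)
      then show ?thesis using Henstock_Kurzweil_Integration.integral_combine[of \<tau> s t "\<lambda>s. h (f s)"] st by simp
    qed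
    ultimately show "S s \<le> S t" by (simp add: S_def w_def)
  qed
  then have main: "L (v 1) 1 \<le> \<tau> * L (v \<tau>) \<tau> + integral {\<tau>..1} (\<lambda>s. h (f s))" by (simp add: S_def)
  have "L w 1 \<le> L (v 1) 1" if "w \<in> {-\<xi>'..0}" for w using v(2)[of 1 w] that m1 by simp
  then have "\<forall>w\<in>{-\<xi>'..0}. \<alpha> w + \<kappa> w * integral {0..1} (\<lambda>s. P (f s)) \<le> \<tau> * L (v \<tau>) \<tau> + integral {\<tau>..1} (\<lambda>s. h (f s))"
    using main m1 by (force simp: L_def mean_P_def)
  then show ?thesis using v(1)[of \<tau>] \<tau> unfolding L_def by (intro bexI[of _ "v \<tau>"]) auto
qed

section \<open>Moments of the exponential distribution\<close>

lemma powr_le_tangent: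
  fixes x q :: real
  assumes "0 \<le> x" "0 < q" "q \<le> 1"
  shows "x powr q \<le> 1 + q * (x - 1)"
proof (cases "x = 0")
  case False
  then have x: "0 < x" using assms by simp
  define z where "z = q * x + (1 - q)"
  have z: "0 < z" unfolding z_def using x assms by (intro add_pos_nonneg) auto
  have "q * ln (x / z) + (1 - q) * ln (1 / z) \<le> q * (x / z - 1) + (1 - q) * (1 / z - 1)"
    using x z assms by (intro add_mono mult_left_mono ln_le_minus_one) auto
  also have "\<dots> = 0" using z by (simp add: field_simps) (simp add: z_def algebra_simps)
  finally have "q * ln x \<le> ln z" using x z by (simp add: ln_div algebra_simps)
  then have "x powr q \<le> z" using x z by (simp add: powr_def ln_ge_iff[symmetric])
  then show ?thesis by (simp add: z_def algebra_simps)
qed (use assms in auto)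

text \<open>Bernoulli's inequality at \<open>y / (y + 1)\<close>, cleared of denominators. It makes
  \<open>p * (y + 1) powr (p - 1)\<close> a supersolution below and closes the estimate at the point
  of tangency.\<close>

lemma powr_Suc_le_tangent:
  fixes y q :: real
  assumes "0 \<le> y" "0 < q" "q \<le> 1"
  shows "y powr q * (y + 1) \<le> (y + 1) powr q * (y + 1 - q)"
proof -
  define x where "x = y / (y + 1)"
  have "x powr q \<le> 1 + q * (x - 1)" by (rule powr_le_tangent) (use assms in \<open>auto simp: x_def\<close>)
  also have "1 + q * (x - 1) = (y + 1 - q) / (y + 1)" using assms by (simp add: x_def field_simps)
  finally have "y powr q / (y + 1) powr q \<le> (y + 1 - q) / (y + 1)" using assms by (simp add: x_def powr_divide)
  moreover have "0 < (y + 1) powr q" using assms by simp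
  ultimately show ?thesis using assms by (simp add: field_simps)
qed

lemma powr_add_one_le:
  fixes y q :: real
  assumes "0 \<le> y" "0 < q" "q \<le> 1"
  shows "(y + 1) powr q \<le> y powr q + 1"
proof (cases "y = 0")
  case False
  then have y: "0 < y" using assms by simp
  have "(y + 1) powr q = y * (y + 1) powr (q - 1) + (y + 1) powr (q - 1)"
    using y powr_mult_base[of "y + 1" "q - 1"] by (simp add: algebra_simps)
  also have "\<dots> \<le> y * y powr (q - 1) + 1 powr (q - 1)"
    using y assms by (intro add_mono mult_left_mono powr_mono2') auto
  also have "\<dots> = y powr q + 1" using y powr_mult_base[of y "q - 1"] by simp
  finally show ?thesis .
qed (use assms in simp)

text \<open>For \<open>p < 2\<close> the second derivative of \<open>\<bar>u\<bar> powr p\<close> is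
  unbounded at 0, so an interval that contains 0 is split there and only continuity is used at that
  point.\<close>

lemma deriv_nonneg_imp_le_except_zero:
  fixes f f' :: "real \<Rightarrow> real"
  assumes "a \<le> b" "continuous_on {a..b} f"
    and "\<And>x. a < x \<Longrightarrow> x < b \<Longrightarrow> x \<noteq> 0 \<Longrightarrow> (f has_real_derivative f' x) (at x)"
    and "\<And>x. a < x \<Longrightarrow> x < b \<Longrightarrow> x \<noteq> 0 \<Longrightarrow> 0 \<le> f' x"
  shows "f a \<le> f b"
proof -
  have *: "f c \<le> f d" if "a \<le> c" "c \<le> d" "d \<le> b" "0 \<notin> {c<..<d}" for c d
  proof (rule DERIV_nonneg_imp_increasing_open[OF that(2)])
    fix x assume "c < x" "x < d"
    then show "\<exists>y. (f has_real_derivative y) (at x) \<and> 0 \<le> y" using assms that by (intro exI[of _ "f' x"]) auto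
  qed (use assms(2) that in \<open>auto intro: continuous_on_subset\<close>)
  show ?thesis
  proof (cases "0 \<in> {a<..<b}")
    case True
    then have "f a \<le> f 0" "f 0 \<le> f b" by (intro *; auto)+
    then show ?thesis by simp
  qed (use * assms in auto)
qed

lemma deriv_nonneg_tendsto_imp_nonpos:
  fixes f f' :: "real \<Rightarrow> real"
  assumes "continuous_on {a..} f" "(f \<longlongrightarrow> 0) at_top"
    and "\<And>x. a < x \<Longrightarrow> x \<noteq> 0 \<Longrightarrow> (f has_real_derivative f' x) (at x)"
    and "\<And>x. a < x \<Longrightarrow> x \<noteq> 0 \<Longrightarrow> 0 \<le> f' x"
  shows "f a \<le> 0"
proof (rule tendsto_lowerbound[OF assms(2)])
  show "eventually (\<lambda>x. f a \<le> f x) at_top"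
    using eventually_ge_at_top[of a]
  proof eventually_elim
    case (elim x)
    show ?case by (rule deriv_nonneg_imp_le_except_zero[OF elim, of f f'])
        (use assms in \<open>auto intro: continuous_on_subset\<close>)
  qed
qed simp

section \<open>Derivatives of the power function\<close>

definition apow' :: "real \<Rightarrow> real \<Rightarrow> real" where "apow' p u = p * sgn u * \<bar>u\<bar> powr (p - 1)"
text \<open>At 0 the value is 0 by the convention for \<open>powr\<close>, not a second derivative;
  differentiation of \<open>apow'\<close> is therefore stated away from 0.\<close>

definition apow'' :: "real \<Rightarrow> real \<Rightarrow> real" where "apow'' p u = p * (p - 1) * \<bar>u\<bar> powr (p - 2)"

lemma powr_has_deriv:
  fixes u :: real assumes "0 < u"
  shows "((\<lambda>u. u powr q) has_real_derivative q * u powr (q - 1)) (at u)"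
  using has_real_derivative_powr[OF assms] by simp

lemma apow_deriv_aux:
  fixes u q :: real assumes "u \<noteq> 0"
  shows "((\<lambda>u. \<bar>u\<bar> powr q) has_real_derivative q * sgn u * \<bar>u\<bar> powr (q - 1)) (at u)"
proof (cases "0 < u")
  case True
  show ?thesis
    by (rule has_field_derivative_transform_within_open[where S = "{0<..}" and f = "\<lambda>u. u powr q"])
      (use True powr_has_deriv[OF True] in auto)
next
  case False
  then have u: "u < 0" using assms by simp
  have "((\<lambda>u. (- u) powr q) has_real_derivative q * sgn u * \<bar>u\<bar> powr (q - 1)) (at u)"
    by (rule DERIV_cong[OF DERIV_chain2[OF powr_has_deriv]]) (use u in \<open>auto intro!: derivative_eq_intros\<close>)
  then show ?thesis
    by (rule has_field_derivative_transform_within_open[where S = "{..<0}"]) (use u in auto)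
qed

lemma apow_deriv:
  fixes u :: real assumes "1 < p"
  shows "((\<lambda>u. \<bar>u\<bar> powr p) has_real_derivative apow' p u) (at u)"
proof (cases "u = 0")
  case False
  then show ?thesis using apow_deriv_aux[OF False, of p] by (simp add: apow'_def)
next
  case True
  have "((\<lambda>h. \<bar>h\<bar> powr (p - 1)) \<longlongrightarrow> \<bar>0\<bar> powr (p - 1)) (at (0::real))"
    using assms by (intro tendsto_powr' tendsto_intros) auto
  then have *: "((\<lambda>h. \<bar>h\<bar> powr (p - 1)) \<longlongrightarrow> 0) (at (0::real))" by simp
  have "((\<lambda>h. \<bar>h\<bar> powr p / h) \<longlongrightarrow> 0) (at (0::real))"
  proof (rule tendsto_rabs_zero_cancel, rule Lim_transform_eventually[OF *])
    show "eventually (\<lambda>h::real. \<bar>h\<bar> powr (p - 1) = \<bar>\<bar>h\<bar> powr p / h\<bar>) (at 0)"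
      unfolding eventually_at_filter
    proof (rule always_eventually, intro allI impI)
      fix h :: real assume "h \<noteq> 0"
      then show "\<bar>h\<bar> powr (p - 1) = \<bar>\<bar>h\<bar> powr p / h\<bar>" by (simp add: powr_diff abs_divide)
    qed
  qed
  then show ?thesis using True assms by (simp add: DERIV_def apow'_def)
qed

lemma apow'_deriv:
  fixes u :: real assumes "u \<noteq> 0"
  shows "(apow' p has_real_derivative apow'' p u) (at u)"
proof -
  have "((\<lambda>x. (p * sgn u) * \<bar>x\<bar> powr (p - 1)) has_real_derivative (p * sgn u) * ((p - 1) * sgn u * \<bar>u\<bar> powr (p - 1 - 1))) (at u)"
    using apow_deriv_aux[OF assms, of "p - 1"] by (intro DERIV_cmult)
  moreover have "(p * sgn u) * ((p - 1) * sgn u * \<bar>u\<bar> powr (p - 1 - 1)) = apow'' p u"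
    using assms by (auto simp: apow''_def sgn_if)
  ultimately have "((\<lambda>x. (p * sgn u) * \<bar>x\<bar> powr (p - 1)) has_real_derivative apow'' p u) (at u)" by simp
  then show ?thesis
    by (rule has_field_derivative_transform_within_open[where S = "if 0 < u then {0<..} else {..<0}"])
      (use assms in \<open>auto simp: apow'_def sgn_if split: if_splits\<close>)
qed

lemma apow'_cont: assumes "1 < p" shows "continuous_on UNIV (apow' p)"
proof -
  have "apow' p = (\<lambda>u. p * (max u 0) powr (p - 1) - p * (max (- u) 0) powr (p - 1))"
    using assms by (auto simp: apow'_def sgn_if fun_eq_iff max_def)
  moreover have "continuous_on UNIV (\<lambda>u::real. p * (max u 0) powr (p - 1) - p * (max (- u) 0) powr (p - 1))"
    using assms by (intro continuous_intros continuous_on_powr') auto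
  ultimately show ?thesis by simp
qed

lemma apow'_pos: "0 < u \<Longrightarrow> apow' p u = p * u powr (p - 1)"
  by (simp add: apow'_def)
lemma apow'_neg: "0 < u \<Longrightarrow> apow' p (- u) = - (p * u powr (p - 1))"
  by (simp add: apow'_def)

text \<open>Here \<open>M y = \<integral>\<^sub>0\<^sup>\<infinity> \<bar>y + s\<bar>\<^sup>p e\<^sup>-\<^sup>s ds\<close> is the \<open>p\<close>-th moment of \<open>log (1/t)\<close> about \<open>-y\<close>, and \<open>m\<close>, \<open>N\<close>
  are its first two derivatives.  All bounds come from the equation \<open>m' = m - h'\<close> with
  \<open>h = \<bar>\<cdot>\<bar>\<^sup>p\<close> by comparison with supersolutions at infinity.  The lower limit \<open>-2\<close> is any number
  below \<open>-1\<close>.\<close>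

locale exponent =
  fixes p :: real assumes p: "1 < p" "p \<le> 2"
begin

definition gk :: "real \<Rightarrow> real" where "gk z = \<bar>z\<bar> powr p * exp (- z)"
text \<open>The integral of \<open>gk\<close> from \<open>y\<close> to infinity, written as a
  difference so that the fundamental theorem of calculus applies at \<open>y\<close>.\<close>

definition K :: "real \<Rightarrow> real" where "K y = (LINT x:{-2..}|lebesgue. gk x) - integral {-2..y} gk"
definition M :: "real \<Rightarrow> real" where "M y = exp y * K y"
definition m :: "real \<Rightarrow> real" where "m y = M y - \<bar>y\<bar> powr p"
definition N :: "real \<Rightarrow> real" where "N y = m y - apow' p y"

lemma gk_cont: "continuous_on S gk"
  unfolding gk_def[abs_def] using p by (intro continuous_intros continuous_on_powr') auto

lemma gk_int: "set_integrable lebesgue {-2..} gk"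
proof -
  have 1: "gk absolutely_integrable_on {-2..0}" by (rule absolutely_integrable_continuous_real[OF gk_cont])
  have "(\<lambda>t. complex_of_real t powr (complex_of_real (p + 1) - 1) / of_real (exp t)) absolutely_integrable_on {0<..}"
    using absolutely_integrable_Gamma_integral'[of "complex_of_real (p + 1)"] p by simp
  then have "(\<lambda>t. norm (complex_of_real t powr (complex_of_real (p + 1) - 1) / of_real (exp t))) absolutely_integrable_on {0<..}"
    by (rule absolutely_integrable_norm[unfolded o_def])
  then have 2: "gk absolutely_integrable_on {0<..}"
  proof (rule set_integrable_cong[THEN iffD1, rotated 3])
    fix t :: real assume "t \<in> {0<..}"
    then show "norm (complex_of_real t powr (complex_of_real (p + 1) - 1) / of_real (exp t)) = gk t"
      by (simp add: norm_divide norm_powr_real_powr gk_def exp_minus field_simps)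
  qed auto
  have "{-2..} = {-2..0} \<union> {0::real<..}" by auto
  then show ?thesis using set_integrable_Un[OF 1 2] by simp
qed

lemma K_deriv: assumes "-2 < y" shows "(K has_real_derivative - gk y) (at y)"
proof -
  have "((\<lambda>y. integral {-2..y} gk) has_real_derivative gk y) (at y within {-2..y+1})"
    using integral_has_real_derivative[of "-2" "y + 1" gk y] gk_cont assms by simp
  then have "((\<lambda>y. integral {-2..y} gk) has_real_derivative gk y) (at y)"
    using assms by (subst (asm) at_within_interior) auto
  then show ?thesis unfolding K_def[abs_def] by (auto intro!: derivative_eq_intros)
qed

lemma K_tendsto: "(K \<longlongrightarrow> 0) at_top"
proof -
  have "((\<lambda>b. LINT x:{-2..b}|lebesgue. gk x) \<longlongrightarrow> (LINT x:{-2..}|lebesgue. gk x)) at_top"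
    by (rule tendsto_set_lebesgue_integral_at_top[OF _ gk_int]) auto
  moreover have "(LINT x:{-2..b}|lebesgue. gk x) = integral {-2..b} gk" for b
    by (rule set_lebesgue_integral_eq_integral(2)[OF absolutely_integrable_continuous_real[OF gk_cont]])
  ultimately have "((\<lambda>b. (LINT x:{-2..}|lebesgue. gk x) - integral {-2..b} gk) \<longlongrightarrow> (LINT x:{-2..}|lebesgue. gk x) - (LINT x:{-2..}|lebesgue. gk x)) at_top"
    by (intro tendsto_diff tendsto_const) simp
  then show ?thesis by (simp add: K_def[abs_def])
qed

lemma M_deriv: assumes "-2 < y" shows "(M has_real_derivative m y) (at y)"
proof -
  have "exp y * gk y = \<bar>y\<bar> powr p" by (simp add: gk_def exp_minus)
  then show ?thesis unfolding M_def[abs_def] m_def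
    using K_deriv[OF assms] by (auto intro!: derivative_eq_intros simp: algebra_simps)
qed

lemma m_deriv: assumes "-2 < y" shows "(m has_real_derivative N y) (at y)"
  using DERIV_diff[OF M_deriv[OF assms] apow_deriv[OF p(1), of y]]
  by (simp add: m_def[abs_def] N_def)

lemma N_deriv: assumes "-2 < y" "y \<noteq> 0" shows "(N has_real_derivative N y - apow'' p y) (at y)"
  using DERIV_diff[OF m_deriv[OF assms(1)] apow'_deriv[OF assms(2), of p]]
  by (simp add: N_def[abs_def])

lemma m_cont: "continuous_on {-2<..} m"
  using m_deriv by (intro continuous_at_imp_continuous_on) (auto intro: DERIV_isCont)

lemma N_cont: "continuous_on {-2<..} N"
  unfolding N_def[abs_def] using m_cont continuous_on_subset[OF apow'_cont[OF p(1)]]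
  by (intro continuous_intros) auto

lemma exp_m_tendsto: "((\<lambda>y. exp (- y) * m y) \<longlongrightarrow> 0) at_top"
proof -
  have "((\<lambda>y::real. exp (- y) * y powr p) \<longlongrightarrow> 0) at_top" by real_asymp
  then have "((\<lambda>y. exp (- y) * \<bar>y\<bar> powr p) \<longlongrightarrow> 0) at_top"
    by (rule Lim_transform_eventually) (use eventually_gt_at_top[of 0] in eventually_elim, simp)
  then have "((\<lambda>y. K y - exp (- y) * \<bar>y\<bar> powr p) \<longlongrightarrow> 0 - 0) at_top"
    by (intro tendsto_diff K_tendsto)
  moreover have "exp (- y) * m y = K y - exp (- y) * \<bar>y\<bar> powr p" for y
    by (simp add: m_def M_def right_diff_distrib exp_minus)
  ultimately show ?thesis by simp
qed

lemma exp_N_tendsto: "((\<lambda>y. exp (- y) * N y) \<longlongrightarrow> 0) at_top"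
proof -
  have "((\<lambda>y::real. exp (- y) * (p * y powr (p - 1))) \<longlongrightarrow> 0) at_top" by real_asymp
  then have "((\<lambda>y. exp (- y) * apow' p y) \<longlongrightarrow> 0) at_top"
    by (rule Lim_transform_eventually) (use eventually_gt_at_top[of 0] in eventually_elim, simp add: apow'_pos)
  then have "((\<lambda>y. exp (- y) * m y - exp (- y) * apow' p y) \<longlongrightarrow> 0 - 0) at_top"
    by (intro tendsto_diff exp_m_tendsto)
  then show ?thesis by (simp add: N_def algebra_simps)
qed

text \<open>If \<open>n - n'\<close> is at least \<open>apow' p\<close>, then
  \<open>exp (- x) * (m x - n x)\<close> is nondecreasing by the equation for \<open>m\<close>. It
  tends to 0 at infinity, so it is nonpositive.\<close>

lemma m_supersolution:
  assumes "-2 < y" and "continuous_on {y..} n" "((\<lambda>y. exp (- y) * n y) \<longlongrightarrow> 0) at_top"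
    and n: "\<And>x. y < x \<Longrightarrow> x \<noteq> 0 \<Longrightarrow> (n has_real_derivative n' x) (at x)"
    and le: "\<And>x. y < x \<Longrightarrow> x \<noteq> 0 \<Longrightarrow> apow' p x \<le> n x - n' x"
  shows "m y \<le> n y"
proof -
  define f where "f x = exp (- x) * (m x - n x)" for x
  have "f y \<le> 0"
  proof (rule deriv_nonneg_tendsto_imp_nonpos[where f = f and a = y and f' = "\<lambda>x. exp (- x) * (n x - n' x - apow' p x)"])
    show "continuous_on {y..} f" unfolding f_def[abs_def]
      using assms(1,2) by (intro continuous_intros continuous_on_subset[OF m_cont]) auto
    show "(f \<longlongrightarrow> 0) at_top" unfolding f_def[abs_def] right_diff_distrib
      using tendsto_diff[OF exp_m_tendsto assms(3)] by simp
    fix x assume x: "y < x" "x \<noteq> 0"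
    show "(f has_real_derivative exp (- x) * (n x - n' x - apow' p x)) (at x)"
      unfolding f_def[abs_def] using m_deriv[of x] n[OF x] x assms(1)
      by (auto intro!: derivative_eq_intros simp: N_def algebra_simps)
    show "0 \<le> exp (- x) * (n x - n' x - apow' p x)" using le[OF x] by simp
  qed
  then show ?thesis by (simp add: f_def mult_le_0_iff)
qed

text \<open>The number \<open>m y\<close> is the average of \<open>apow' p (y + s)\<close> with
  density e^(-s), whose barycentre is s = 1. On the positive axis \<open>apow' p\<close> is concave,
  so Jensen's inequality suggests its value at \<open>y + 1\<close> as a bound; the proof verifies
  that this is a supersolution.\<close>

lemma m_le_Suc:
  assumes "0 \<le> y" shows "m y \<le> p * (y + 1) powr (p - 1)"
proof (rule m_supersolution[where n' = "\<lambda>x. p * ((p - 1) * (x + 1) powr (p - 2))"])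
  show "continuous_on {y..} (\<lambda>y. p * (y + 1) powr (p - 1))" using assms by (intro continuous_intros) auto
  show "((\<lambda>y. exp (- y) * (p * (y + 1) powr (p - 1))) \<longlongrightarrow> 0) at_top" by real_asymp
  fix x assume x: "y < x" "x \<noteq> 0"
  have x0: "0 < x" using x assms by simp
  show "((\<lambda>y. p * (y + 1) powr (p - 1)) has_real_derivative p * ((p - 1) * (x + 1) powr (p - 2))) (at x)"
  proof (intro DERIV_cmult)
    have "((\<lambda>y. (y + 1) powr (p - 1)) has_real_derivative (p - 1) * (x + 1) powr (p - 1 - 1) * 1) (at x)"
      by (rule DERIV_chain2[OF powr_has_deriv]) (use x0 in \<open>auto intro!: derivative_eq_intros\<close>)
    then show "((\<lambda>y. (y + 1) powr (p - 1)) has_real_derivative (p - 1) * (x + 1) powr (p - 2)) (at x)" by simp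
  qed
  have "x powr (p - 1) * (x + 1) \<le> (x + 1) powr (p - 1) * (x + 1 - (p - 1))"
    by (rule powr_Suc_le_tangent) (use x0 p in auto)
  also have "(x + 1) powr (p - 1) = (x + 1) * (x + 1) powr (p - 2)" using powr_mult_base[of "x + 1" "p - 2"] x0 by simp
  finally have "x powr (p - 1) * (x + 1) \<le> ((x + 1) * (x + 1) powr (p - 2) - (p - 1) * (x + 1) powr (p - 2)) * (x + 1)"
    by (simp add: algebra_simps)
  then have "x powr (p - 1) \<le> (x + 1) * (x + 1) powr (p - 2) - (p - 1) * (x + 1) powr (p - 2)"
    using x0 by (simp add: mult_le_cancel_right)
  then have "p * x powr (p - 1) \<le> p * ((x + 1) powr (p - 1) - (p - 1) * (x + 1) powr (p - 2))"
    using p powr_mult_base[of "x + 1" "p - 2"] x0 by (intro mult_left_mono) auto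
  then show "apow' p x \<le> p * (x + 1) powr (p - 1) - p * ((p - 1) * (x + 1) powr (p - 2))"
    using x0 by (simp add: apow'_pos algebra_simps)
qed (use assms in auto)

text \<open>\<open>N y\<close> averages \<open>apow'' p\<close> over arguments right of
  \<open>y\<close>, where it is smaller. As a supersolution for \<open>m\<close> serves the sum of
  the first two derivatives of the power: it misses equality only by the third derivative, which is
  nonpositive on the positive axis.\<close>

lemma N_le_apow'':
  assumes "0 < y" shows "N y \<le> apow'' p y"
proof -
  have "m y \<le> apow' p y + apow'' p y"
  proof (rule m_supersolution[where n' = "\<lambda>x. apow'' p x + p * (p - 1) * ((p - 2) * x powr (p - 3))"])
    show "continuous_on {y..} (\<lambda>y. apow' p y + apow'' p y)"
      using assms unfolding apow''_def by (intro continuous_intros continuous_on_subset[OF apow'_cont[OF p(1)]]) auto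
    have "((\<lambda>y::real. exp (- y) * (p * y powr (p - 1) + p * (p - 1) * y powr (p - 2))) \<longlongrightarrow> 0) at_top" by real_asymp
    then show "((\<lambda>y. exp (- y) * (apow' p y + apow'' p y)) \<longlongrightarrow> 0) at_top"
      by (rule Lim_transform_eventually)
        (use eventually_gt_at_top[of 0] in eventually_elim, simp add: apow'_pos apow''_def)
    fix x assume x: "y < x" "x \<noteq> 0"
    have x0: "0 < x" using x assms by simp
    have "((\<lambda>x. p * (p - 1) * \<bar>x\<bar> powr (p - 2)) has_real_derivative p * (p - 1) * ((p - 2) * sgn x * \<bar>x\<bar> powr (p - 2 - 1))) (at x)"
      by (intro DERIV_cmult apow_deriv_aux x)
    then have "(apow'' p has_real_derivative p * (p - 1) * ((p - 2) * x powr (p - 3))) (at x)"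
      using x0 by (simp add: apow''_def[abs_def])
    then show "((\<lambda>y. apow' p y + apow'' p y) has_real_derivative apow'' p x + p * (p - 1) * ((p - 2) * x powr (p - 3))) (at x)"
      by (intro DERIV_add apow'_deriv x)
    have "p * (p - 1) * ((p - 2) * x powr (p - 3)) \<le> 0"
      using p by (intro mult_nonneg_nonpos mult_nonpos_nonneg) auto
    then show "apow' p x \<le> apow' p x + apow'' p x - (apow'' p x + p * (p - 1) * ((p - 2) * x powr (p - 3)))" by simp
  qed (use assms in auto)
  then show ?thesis by (simp add: N_def)
qed

text \<open>On this range \<open>\<bar>x\<bar>\<close> is at most
  \<open>\<bar>x\<bar> powr (p - 1)\<close>, so the linear function, which is exact for
  \<open>p = 2\<close>, keeps to the left the order that it has at 0.\<close>

lemma m_neg_le: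
  assumes "-1 \<le> y" "y \<le> 0" shows "m y \<le> p * (1 + y)"
proof -
  define f where "f x = exp (- x) * (m x - p * (1 + x))" for x
  have "f y \<le> f 0"
  proof (rule deriv_nonneg_imp_le_except_zero[where f = f and f' = "\<lambda>x. exp (- x) * (p * x - apow' p x)"])
    show "continuous_on {y..0} f" unfolding f_def[abs_def]
      using assms by (intro continuous_intros continuous_on_subset[OF m_cont]) auto
    fix x assume x: "y < x" "x < 0"
    show "(f has_real_derivative exp (- x) * (p * x - apow' p x)) (at x)"
      unfolding f_def[abs_def] using m_deriv[of x] x assms
      by (auto intro!: derivative_eq_intros simp: N_def algebra_simps)
    have "(- x) powr 1 \<le> (- x) powr (p - 1)" using x assms p by (intro powr_mono') auto
    then have "p * (- x) \<le> p * (- x) powr (p - 1)" using p x by (intro mult_left_mono) auto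
    then show "0 \<le> exp (- x) * (p * x - apow' p x)" using apow'_neg[of "- x" p] x by simp
  qed (rule assms)
  also have "f 0 \<le> 0" using m_le_Suc[of 0] by (simp add: f_def)
  finally show ?thesis by (simp add: f_def mult_le_0_iff)
qed

lemma N_nonneg:
  assumes "-2 < y" shows "0 \<le> N y"
proof -
  have "- (exp (- y) * N y) \<le> 0"
  proof (rule deriv_nonneg_tendsto_imp_nonpos[where f = "\<lambda>y. - (exp (- y) * N y)" and a = y and f' = "\<lambda>x. exp (- x) * apow'' p x"])
    show "continuous_on {y..} (\<lambda>y. - (exp (- y) * N y))"
      using assms by (intro continuous_intros continuous_on_subset[OF N_cont]) auto
    show "((\<lambda>y. - (exp (- y) * N y)) \<longlongrightarrow> 0) at_top" using tendsto_minus[OF exp_N_tendsto] by simp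
    fix x assume x: "y < x" "x \<noteq> 0"
    show "((\<lambda>y. - (exp (- y) * N y)) has_real_derivative exp (- x) * apow'' p x) (at x)"
      using N_deriv[of x] x assms by (auto intro!: derivative_eq_intros simp: algebra_simps)
    show "0 \<le> exp (- x) * apow'' p x" using p by (simp add: apow''_def)
  qed
  then show ?thesis by (simp add: zero_le_mult_iff)
qed

lemma N_pos_le: assumes "0 \<le> y" shows "N y \<le> p * ((y + 1) powr (p - 1) - y powr (p - 1))" "N y \<le> p"
proof -
  have "apow' p y = p * y powr (p - 1)" using assms by (cases "y = 0") (auto simp: apow'_def)
  then show 1: "N y \<le> p * ((y + 1) powr (p - 1) - y powr (p - 1))" using m_le_Suc[OF assms] by (simp add: N_def algebra_simps)
  also have "\<dots> \<le> p * 1" using powr_add_one_le[OF assms, of "p - 1"] p by (intro mult_left_mono) auto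
  finally show "N y \<le> p" by simp
qed

lemma N_neg_le:
  assumes "0 \<le> b" "b \<le> 1" shows "N (- b) \<le> p * (1 - b + b powr (p - 1))"
proof -
  have "apow' p (- b) = - (p * b powr (p - 1))" 
  proof (cases "b = 0")
    case False
    then show ?thesis using apow'_neg[of b p] assms by simp
  qed (use p in \<open>simp add: apow'_def\<close>)
  then show ?thesis using m_neg_le[of "- b"] assms by (simp add: N_def algebra_simps)
qed

lemma M_convex: "convex_on {-2<..} M"
  by (rule f''_ge0_imp_convex[where f' = m and f'' = N]) (auto intro: M_deriv m_deriv N_nonneg)

lemma M_pos: assumes "-2 < y" shows "0 < M y"
proof -
  have c: "continuous_on {z..} K" if z: "-2 < z" for z
  proof (intro continuous_at_imp_continuous_on ballI)
    show "isCont K x" if "x \<in> {z..}" for x using DERIV_isCont[OF K_deriv[of x]] that z by simp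
  qed
  have le: "- K z \<le> 0" if "-2 < z" for z
  proof (rule deriv_nonneg_tendsto_imp_nonpos[where f = "\<lambda>y. - K y" and a = z and f' = gk])
    show "continuous_on {z..} (\<lambda>y. - K y)" using c[OF that] by (intro continuous_intros)
    show "((\<lambda>y. - K y) \<longlongrightarrow> 0) at_top" using tendsto_minus[OF K_tendsto] by simp
    show "((\<lambda>y. - K y) has_real_derivative gk x) (at x)" if "z < x" for x
      using DERIV_minus[OF K_deriv[of x]] that \<open>-2 < z\<close> by simp
  qed (simp add: gk_def)
  \<comment> \<open>Since \<open>gk\<close> vanishes at 0, strict decrease of \<open>K\<close> is
    read off on a unit interval to the right of both \<open>y\<close> and 0.\<close>
  define z where "z = max y 0"
  have "- K y \<le> - K z"
  proof (rule deriv_nonneg_imp_le_except_zero[where f = "\<lambda>y. - K y" and f' = gk])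
    show "continuous_on {y..z} (\<lambda>y. - K y)"
      by (intro continuous_on_minus continuous_on_subset[OF c[OF assms]]) auto
    show "((\<lambda>y. - K y) has_real_derivative gk x) (at x)" if "y < x" for x
      using DERIV_minus[OF K_deriv[of x]] that assms by simp
  qed (auto simp: z_def gk_def)
  also have "- K z < - K (z + 1)"
  proof (rule DERIV_pos_imp_increasing_open[of z "z + 1" "\<lambda>y. - K y"])
    fix x assume x: "z < x" "x < z + 1"
    have "((\<lambda>y. - K y) has_real_derivative gk x) (at x)"
      using DERIV_minus[OF K_deriv[of x]] x by (simp add: z_def)
    moreover have "0 < gk x" using x by (simp add: gk_def z_def)
    ultimately show "\<exists>d. ((\<lambda>y. - K y) has_real_derivative d) (at x) \<and> 0 < d" by blast
  next
    show "continuous_on {z..z + 1} (\<lambda>y. - K y)"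
    proof -
      have "-2 < z" by (simp add: z_def)
      then have "continuous_on {z..z + 1} K" by (rule continuous_on_subset[OF c]) auto
      then show ?thesis by (rule continuous_on_minus)
    qed
  qed simp
  also have "- K (z + 1) \<le> 0" by (rule le) (simp add: z_def)
  finally show ?thesis by (simp add: M_def)
qed

text \<open>The difference \<open>D\<close> to the polynomial solution has derivative 0 and limit 0
  at infinity. This yields the value 1 for \<open>M (- 1)\<close>.\<close>

lemma M_two:
  assumes "p = 2" "-2 < y" shows "M y = y\<^sup>2 + 2 * y + 2"
proof -
  define D where "D x = K x - exp (- x) * (x\<^sup>2 + 2 * x + 2)" for x
  have D: "(D has_real_derivative 0) (at x)" if "-2 < x" for x
  proof -
    have "gk x = \<bar>x\<bar> powr p * exp (- x)" by (rule gk_def)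
    then have "gk x = x\<^sup>2 * exp (- x)" unfolding assms(1) by (cases "x = 0") (auto simp: powr_numeral)
    then show ?thesis unfolding D_def[abs_def] using K_deriv[OF that]
      by (auto intro!: derivative_eq_intros simp: algebra_simps power2_eq_square)
  qed
  have c: "continuous_on {y..} D"
  proof (intro continuous_at_imp_continuous_on ballI)
    show "isCont D x" if "x \<in> {y..}" for x using DERIV_isCont[OF D[of x]] that assms by simp
  qed
  have e: "((\<lambda>x::real. exp (- x) * (x\<^sup>2 + 2 * x + 2)) \<longlongrightarrow> 0) at_top" by real_asymp
  have t: "(D \<longlongrightarrow> 0) at_top" unfolding D_def[abs_def] using tendsto_diff[OF K_tendsto e] by simp
  have "D y \<le> 0"
    by (rule deriv_nonneg_tendsto_imp_nonpos[OF c t, where f' = "\<lambda>_. 0"]) (use D[of x for x] assms in \<open>simp_all\<close>)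
  moreover have "- D y \<le> 0"
  proof (rule deriv_nonneg_tendsto_imp_nonpos[where f = "\<lambda>y. - D y" and a = y and f' = "\<lambda>_. 0"])
    show "continuous_on {y..} (\<lambda>y. - D y)" by (rule continuous_on_minus[OF c])
    show "((\<lambda>y. - D y) \<longlongrightarrow> 0) at_top" using tendsto_minus[OF t] by simp
    show "((\<lambda>y. - D y) has_real_derivative 0) (at x)" if "y < x" for x
      using DERIV_minus[OF D[of x]] that assms by simp
  qed simp
  ultimately have "K y = exp (- y) * (y\<^sup>2 + 2 * y + 2)" by (simp add: D_def)
  then show ?thesis by (simp add: M_def exp_minus)
qed

end

section \<open>The candidate for powers\<close>

text \<open>A rearrangement of the Pade bound that e^x is at most (2 + x) / (2 - x).\<close>

lemma exp_minus_linear_le: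
  fixes x :: real
  assumes "0 \<le> x" "x < 2" shows "exp x - 1 - x \<le> x\<^sup>2 / (2 - x)"
proof -
  define f where "f x = (2 + x) * exp (- x) - (2 - x)" for x :: real
  have "f 0 \<le> f x"
  proof (rule DERIV_nonneg_imp_nondecreasing[OF assms(1)])
    fix t :: real assume "0 \<le> t"
    have "(f has_real_derivative (1 - (1 + t) * exp (- t))) (at t)"
      unfolding f_def[abs_def] by (auto intro!: derivative_eq_intros simp: algebra_simps)
    moreover have "0 \<le> 1 - (1 + t) * exp (- t)"
      using exp_ge_add_one_self[of t] by (simp add: exp_minus field_simps)
    ultimately show "\<exists>y. (f has_real_derivative y) (at t) \<and> 0 \<le> y" by blast
  qed
  then have "2 - x \<le> (2 + x) * exp (- x)" by (simp add: f_def)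
  then have "(2 - x) * exp x \<le> 2 + x" by (simp add: exp_minus field_simps)
  then have "(exp x - 1 - x) * (2 - x) \<le> x\<^sup>2" by (simp add: algebra_simps power2_eq_square)
  then show ?thesis using assms by (simp add: pos_le_divide_eq)
qed

text \<open>For positive \<open>c\<close> the function \<open>s powr (- c) * exp s\<close> is least
  at \<open>s = c\<close>, and there \<open>\<xi> powr (- c) \<le> c powr (- c)\<close>.\<close>

lemma powr_exp_lower:
  fixes c \<xi> s :: real
  assumes "0 \<le> c" "c \<le> \<xi>" "0 < \<xi>" "0 < s"
  shows "\<xi> powr (- c) * exp c \<le> s powr (- c) * exp s"
proof (cases "c = 0")
  case False
  then have c: "0 < c" using assms by simp
  have "c * ln (s / \<xi>) \<le> c * ln (s / c)"
    using c assms by (intro mult_left_mono) (auto simp: field_simps)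
  also have "\<dots> \<le> c * (s / c - 1)" using c assms by (intro mult_left_mono ln_le_minus_one) auto
  also have "\<dots> = s - c" using c by (simp add: field_simps)
  finally have "- c * ln \<xi> + c \<le> - c * ln s + s" using assms by (simp add: ln_div algebra_simps)
  then show ?thesis using assms by (simp add: powr_def flip: exp_add)
qed (use assms in simp)

section \<open>The coefficient of the exponential\<close>

locale exponent_xi = exponent +
  fixes \<xi> :: real
  assumes xi: "0 < \<xi>" "\<xi> < 1" "2 - p \<le> \<xi>"
begin

text \<open>The coefficient of the exponential in the supporting plane at \<open>v\<close>. For the
  planes to form an envelope along the tangent segments, it has to satisfy \<xi> kap' = kap - (1 -
  \<xi>) h'' with h the p-th power of the absolute value. The solutions differ by multiples of
  e^(v/\<xi>), and the rescaled \<open>N\<close> is the one without exponential growth.\<close>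

definition kap :: "real \<Rightarrow> real" where "kap v = (1 - \<xi>) * \<xi> powr (p - 2) * N (v / \<xi>)"

lemma N_scaled_nonneg: "- \<xi> \<le> v \<Longrightarrow> 0 \<le> N (v / \<xi>)"
  using xi by (intro N_nonneg) (simp add: less_divide_eq)

lemma kap_nonneg: "- \<xi> \<le> v \<Longrightarrow> 0 \<le> kap v"
  unfolding kap_def using xi N_scaled_nonneg[of v] by (intro mult_nonneg_nonneg) auto

lemma apow''_scale: "\<xi> powr (p - 2) * apow'' p (v / \<xi>) = apow'' p v"
proof -
  have "\<bar>v / \<xi>\<bar> powr (p - 2) = \<bar>v\<bar> powr (p - 2) / \<xi> powr (p - 2)"
    using xi by (simp add: abs_divide powr_divide)
  then show ?thesis using xi by (simp add: apow''_def)
qed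

lemma one_minus_xi_le: "1 - \<xi> \<le> (p - 1) * exp (- (\<xi> - (2 - p)))"
proof -
  have "1 - \<xi> \<le> (p - 1) * (1 - (\<xi> - (2 - p)))"
  proof -
    have "(p - 1) * (1 - (\<xi> - (2 - p))) - (1 - \<xi>) = (2 - p) * (\<xi> - (2 - p))" by (simp add: algebra_simps)
    moreover have "0 \<le> (2 - p) * (\<xi> - (2 - p))" using p xi by (intro mult_nonneg_nonneg) auto
    ultimately show ?thesis by linarith
  qed
  also have "1 - (\<xi> - (2 - p)) \<le> exp (- (\<xi> - (2 - p)))"
    using exp_ge_add_one_self[of "- (\<xi> - (2 - p))"] by linarith
  finally show ?thesis using p by simp
qed

text \<open>The right side is \<open>p * (p - 1)\<close> times the lower bound that
  \<open>powr_exp_lower\<close> gives with \<open>c = 2 - p\<close>; so it is exactly what a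
  comparison with \<open>apow''\<close> at negative arguments can afford. For
  \<open>v \<le> 0\<close> the estimates of \<open>1 - \<xi>\<close> and \<open>N\<close> are turned
  into exponentials, whose exponents add up to at most \<open>2 - p\<close> because
  \<open>2 - p \<le> \<xi>\<close>.\<close>

lemma kap_exp_le: assumes "- \<xi> \<le> v" shows "kap v * exp (- v) \<le> p * (p - 1) * (\<xi> powr (p - 2) * exp (2 - p))"
proof (cases "v \<le> 0")
  case True
  define b where "b = - v / \<xi>"
  have b: "0 \<le> b" "b \<le> 1" using True assms xi by (auto simp: b_def field_simps)
  have v: "v / \<xi> = - b" "- v = \<xi> * b" using xi by (auto simp: b_def)
  have "b powr (p - 1) \<le> 1 + (p - 1) * (b - 1)" by (rule powr_le_tangent) (use b p in auto)
  then have "1 - b + b powr (p - 1) \<le> 1 + (2 - p) * (1 - b)" by (simp add: algebra_simps)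
  also have "\<dots> \<le> exp ((2 - p) * (1 - b))" by (rule exp_ge_add_one_self)
  finally have N: "N (- b) \<le> p * exp ((2 - p) * (1 - b))"
    using N_neg_le[OF b] p by (meson mult_left_mono order_trans less_imp_le zero_less_one less_trans)
  have "kap v * exp (- v) = (1 - \<xi>) * (\<xi> powr (p - 2) * N (- b) * exp (\<xi> * b))"
    unfolding kap_def v by simp
  also have "\<dots> \<le> ((p - 1) * exp (- (\<xi> - (2 - p)))) * (\<xi> powr (p - 2) * (p * exp ((2 - p) * (1 - b))) * exp (\<xi> * b))"
    using one_minus_xi_le N N_nonneg[of "- b"] b p xi by (intro mult_mono mult_nonneg_nonneg) auto
  also have "\<dots> = p * (p - 1) * \<xi> powr (p - 2) * exp (- (\<xi> - (2 - p)) + (2 - p) * (1 - b) + \<xi> * b)"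
    by (simp add: exp_add)
  also have "\<dots> \<le> p * (p - 1) * \<xi> powr (p - 2) * exp (2 - p)"
  proof (intro mult_left_mono exp_le_cancel_iff[THEN iffD2])
    have "(2 - p) - (- (\<xi> - (2 - p)) + (2 - p) * (1 - b) + \<xi> * b) = (\<xi> - (2 - p)) * (1 - b)" by (simp add: algebra_simps)
    moreover have "0 \<le> (\<xi> - (2 - p)) * (1 - b)" using xi b by simp
    ultimately show "- (\<xi> - (2 - p)) + (2 - p) * (1 - b) + \<xi> * b \<le> 2 - p" by linarith
  qed (use p in auto)
  finally show ?thesis by simp
next
  case False
  then have "N (v / \<xi>) \<le> p" using xi by (intro N_pos_le(2)) auto
  have "exp (- (\<xi> - (2 - p))) \<le> 1" using xi by simp
  have "kap v * exp (- v) \<le> kap v * 1" using kap_nonneg[OF assms] False by (intro mult_left_mono) auto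
  also have "kap v * 1 = (1 - \<xi>) * (\<xi> powr (p - 2) * N (v / \<xi>))" by (simp add: kap_def)
  also have "\<dots> \<le> ((p - 1) * exp (2 - p)) * (\<xi> powr (p - 2) * p)"
  proof (intro mult_mono)
    have "1 - \<xi> \<le> (p - 1) * exp (- (\<xi> - (2 - p)))" by (rule one_minus_xi_le)
    also have "\<dots> \<le> (p - 1) * exp (2 - p)" using p xi by (intro mult_left_mono) auto
    finally show "1 - \<xi> \<le> (p - 1) * exp (2 - p)" .
  qed (use \<open>N (v / \<xi>) \<le> p\<close> p N_scaled_nonneg[OF assms] in auto)
  finally show ?thesis by (simp add: mult_ac)
qed

text \<open>This is nonnegativity of the second derivative of the gap defined next. At negative
  \<open>s\<close> the bound of \<open>kap_exp_le\<close> separates the two sides; at positive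
  \<open>s\<close> it is enough that \<open>N\<close> lies below \<open>apow''\<close> and that
  \<open>apow''\<close> decreases.\<close>

lemma kap_exp_le_apow'':
  assumes "- \<xi> \<le> v" "s \<le> max v 0" "s \<noteq> 0"
  shows "kap v * exp (s - v) \<le> apow'' p s"
proof (cases "s < 0")
  case True
  have "kap v * exp (s - v) = (kap v * exp (- v)) * exp s" by (simp add: exp_add[symmetric])
  also have "\<dots> \<le> p * (p - 1) * (\<xi> powr (p - 2) * exp (2 - p)) * exp s"
    using kap_exp_le[OF assms(1)] by (intro mult_right_mono) auto
  also have "\<dots> \<le> p * (p - 1) * ((- s) powr (p - 2) * exp (- s)) * exp s"
    using powr_exp_lower[of "2 - p" \<xi> "- s"] p xi True by (intro mult_right_mono mult_left_mono) auto
  also have "\<dots> = apow'' p s" using True by (simp add: apow''_def exp_minus)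
  finally show ?thesis .
next
  case False
  then have s: "0 < s" "s \<le> v" "0 < v" using assms by auto
  have "kap v * exp (s - v) \<le> kap v * 1" using kap_nonneg[OF assms(1)] s by (intro mult_left_mono) auto
  also have "\<dots> \<le> 1 * \<xi> powr (p - 2) * apow'' p (v / \<xi>)"
    unfolding kap_def mult_1_right using N_le_apow''[of "v / \<xi>"] N_scaled_nonneg[OF assms(1)] s xi
    by (intro mult_mono mult_nonneg_nonneg) auto
  also have "\<dots> = apow'' p v" using apow''_scale by simp
  also have "\<dots> \<le> apow'' p s" unfolding apow''_def using s p by (intro mult_left_mono powr_mono2') auto
  finally show ?thesis .
qed

section \<open>The gap between the power and its supporting planes\<close>

text \<open>The power minus the supporting plane at \<open>v\<close>, evaluated at the boundary
  point \<open>(u, exp u)\<close>. It has a double zero at \<open>u = v\<close>.\<close>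

definition gap :: "real \<Rightarrow> real \<Rightarrow> real" where
  "gap v u = \<bar>u\<bar> powr p - \<bar>v\<bar> powr p - apow' p v * (u - v) - kap v * (exp (u - v) - 1 - (u - v))"
definition gap' :: "real \<Rightarrow> real \<Rightarrow> real" where
  "gap' v u = apow' p u - apow' p v - kap v * (exp (u - v) - 1)"

lemma gap_deriv: "(gap v has_real_derivative gap' v u) (at u)"
proof -
  have "((\<lambda>u. \<bar>u\<bar> powr p - (\<bar>v\<bar> powr p + apow' p v * (u - v) + kap v * (exp (u - v) - 1 - (u - v))))
     has_real_derivative (apow' p u - (apow' p v + kap v * (exp (u - v) - 1)))) (at u)"
    by (rule DERIV_diff[OF apow_deriv[OF p(1)]]) (auto intro!: derivative_eq_intros)
  then show ?thesis by (simp add: gap_def[abs_def] gap'_def algebra_simps)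
qed

lemma gap'_deriv: assumes "u \<noteq> 0" shows "(gap' v has_real_derivative apow'' p u - kap v * exp (u - v)) (at u)"
proof -
  have "((\<lambda>u. apow' p u - (apow' p v + kap v * (exp (u - v) - 1)))
     has_real_derivative (apow'' p u - kap v * exp (u - v))) (at u)"
    by (rule DERIV_diff[OF apow'_deriv[OF assms]]) (auto intro!: derivative_eq_intros)
  then show ?thesis by (simp add: gap'_def[abs_def] algebra_simps)
qed

lemma gap'_cont: "continuous_on S (gap' v)"
  unfolding gap'_def[abs_def] by (intro continuous_intros continuous_on_subset[OF apow'_cont[OF p(1)]]) auto

lemma gap'_mono: assumes "- \<xi> \<le> v" "s \<le> t" "t \<le> max v 0" shows "gap' v s \<le> gap' v t"
proof (rule deriv_nonneg_imp_le_except_zero[where f = "gap' v" and f' = "\<lambda>u. apow'' p u - kap v * exp (u - v)"])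
  fix x assume "s < x" "x < t" "x \<noteq> 0"
  then show "(gap' v has_real_derivative apow'' p x - kap v * exp (x - v)) (at x)"
    "0 \<le> apow'' p x - kap v * exp (x - v)"
    using gap'_deriv kap_exp_le_apow''[OF assms(1), of x] assms by auto
qed (use assms gap'_cont in auto)

lemma gap_self: "gap v v = 0" "gap' v v = 0" by (simp_all add: gap_def gap'_def)

text \<open>The slope \<open>gap' v\<close> is nondecreasing up to \<open>max v 0\<close> and
  vanishes at \<open>v\<close>, so on this range the gap is least at \<open>v\<close>, where it is
  0.\<close>

lemma gap_left: assumes "- \<xi> \<le> v" "u \<le> max v 0" shows "0 \<le> gap v u"
proof (cases "u \<le> v")
  case True
  have "- gap v u \<le> - gap v v"
  proof (rule DERIV_nonneg_imp_nondecreasing[OF True, where f = "\<lambda>u. - gap v u"])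
    fix x assume "u \<le> x" "x \<le> v"
    then have "gap' v x \<le> gap' v v" using assms by (intro gap'_mono) auto
    then show "\<exists>y. ((\<lambda>u. - gap v u) has_real_derivative y) (at x) \<and> 0 \<le> y"
      using DERIV_minus[OF gap_deriv] gap_self by (intro exI[of _ "- gap' v x"]) auto
  qed
  then show ?thesis using gap_self by simp
next
  case False
  then have "v \<le> u" by simp
  have "gap v v \<le> gap v u"
  proof (rule DERIV_nonneg_imp_nondecreasing[OF \<open>v \<le> u\<close>])
    fix x assume "v \<le> x" "x \<le> u"
    then have "gap' v v \<le> gap' v x" using assms by (intro gap'_mono) auto
    then show "\<exists>y. (gap v has_real_derivative y) (at x) \<and> 0 \<le> y"
      using gap_deriv gap_self by (intro exI[of _ "gap' v x"]) auto
  qed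
  then show ?thesis using gap_self by simp
qed

text \<open>After the Pade bound the factor \<open>(1 - \<xi>) / (2 - \<xi>)\<close> appears, and it
  is at most \<open>(p - 1) / p\<close> precisely when \<open>2 - p \<le> \<xi>\<close>.\<close>

lemma kap_theta_le: assumes "- \<xi> \<le> v" shows "kap v * (exp \<xi> - 1 - \<xi>) \<le> \<xi> powr p * ((p - 1) / p * N (v / \<xi>))"
proof -
  have N0: "0 \<le> N (v / \<xi>)" using N_nonneg[of "v / \<xi>"] assms xi by (simp add: field_simps)
  have "kap v * (exp \<xi> - 1 - \<xi>) \<le> kap v * (\<xi>\<^sup>2 / (2 - \<xi>))"
    using exp_minus_linear_le[of \<xi>] xi kap_nonneg[OF assms] by (intro mult_left_mono) auto
  also have "\<dots> = (\<xi> powr (p - 2) * \<xi>\<^sup>2) * ((1 - \<xi>) / (2 - \<xi>) * N (v / \<xi>))" by (simp add: kap_def)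
  also have "\<xi> powr (p - 2) * \<xi>\<^sup>2 = \<xi> powr p"
  proof -
    have "\<xi> powr (p - 2) * \<xi> powr 2 = \<xi> powr p" by (simp flip: powr_add)
    then show ?thesis using xi by (simp add: powr_numeral)
  qed
  also have "\<xi> powr p * ((1 - \<xi>) / (2 - \<xi>) * N (v / \<xi>)) \<le> \<xi> powr p * ((p - 1) / p * N (v / \<xi>))"
    using N0 p xi by (intro mult_left_mono mult_right_mono) (auto simp: field_simps)
  finally show ?thesis .
qed

text \<open>\<open>v + \<xi>\<close> is the abscissa of the point of tangency, the last argument at
  which the plane has to stay below the power. Every term is \<open>\<xi> powr p\<close> times a
  function of \<open>v / \<xi>\<close>, so after division the bounds for \<open>N\<close> leave an
  inequality between powers in one variable.\<close>

lemma gap_end: assumes "- \<xi> \<le> v" shows "0 \<le> gap v (v + \<xi>)"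
proof -
  have "kap v * (exp \<xi> - 1 - \<xi>) \<le> \<bar>v + \<xi>\<bar> powr p - \<bar>v\<bar> powr p - apow' p v * \<xi>"
  proof (cases "v < 0")
    case True
    define b where "b = - v / \<xi>"
    have b: "0 < b" "b \<le> 1" using True assms xi by (auto simp: b_def field_simps)
    have v: "v / \<xi> = - b" "v = - (\<xi> * b)" using xi by (auto simp: b_def)
    have 1: "\<bar>v + \<xi>\<bar> powr p = \<xi> powr p * ((1 - b) * (1 - b) powr (p - 1))"
    proof -
      have "v + \<xi> = \<xi> * (1 - b)" by (simp add: v algebra_simps)
      then show ?thesis using b xi powr_mult_base[of "1 - b" "p - 1"] by (simp add: abs_mult powr_mult)
    qed
    have 2: "\<bar>v\<bar> powr p = \<xi> powr p * (b * b powr (p - 1))"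
      using b xi v powr_mult_base[of b "p - 1"] by (simp add: abs_mult powr_mult)
    have 3: "apow' p v * \<xi> = - (\<xi> powr p * (p * b powr (p - 1)))"
    proof -
      have "apow' p v = - (p * (\<xi> * b) powr (p - 1))" unfolding v(2) using b xi by (intro apow'_neg) auto
      then have "apow' p v * \<xi> = - (p * b powr (p - 1) * (\<xi> * \<xi> powr (p - 1)))" using b xi by (simp add: powr_mult)
      then show ?thesis using powr_mult_base[of \<xi> "p - 1"] xi by simp
    qed
    have "kap v * (exp \<xi> - 1 - \<xi>) \<le> \<xi> powr p * ((p - 1) / p * N (- b))"
      using kap_theta_le[OF assms] by (simp add: v(1))
    also have "\<dots> \<le> \<xi> powr p * ((p - 1) / p * (p * (1 - b + b powr (p - 1))))"
      using N_neg_le[of b] b p by (intro mult_left_mono) auto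
    also have "\<dots> = \<xi> powr p * ((p - 1) * (1 - b + b powr (p - 1)))" using p by simp
    also have "\<dots> \<le> \<xi> powr p * ((1 - b) * (1 - b) powr (p - 1) - b * b powr (p - 1) + p * b powr (p - 1))"
    proof (intro mult_left_mono)
      have q: "z \<le> z powr (p - 1)" if "0 \<le> z" "z \<le> 1" for z
      proof (cases "z = 0")
        case False
        then have "z powr 1 \<le> z powr (p - 1)" using that p by (intro powr_mono') auto
        then show ?thesis using that by simp
      qed simp
      \<comment> \<open>On the unit interval each power is at least its base, so the two powers add
        up to at least 1, which is at least \<open>p - 1\<close>.\<close>
      have "0 \<le> (1 - b) * ((1 - b) powr (p - 1) + b powr (p - 1) - (p - 1))"
        using q[of "1 - b"] q[of b] b p by (intro mult_nonneg_nonneg) auto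
      then show "(p - 1) * (1 - b + b powr (p - 1)) \<le> (1 - b) * (1 - b) powr (p - 1) - b * b powr (p - 1) + p * b powr (p - 1)"
        by (simp add: algebra_simps)
    qed simp
    finally show ?thesis unfolding 1 2 3 by (simp add: algebra_simps)
  next
    case False
    define y where "y = v / \<xi>"
    have y: "0 \<le> y" "v = \<xi> * y" using False xi by (auto simp: y_def)
    have 1: "\<bar>v + \<xi>\<bar> powr p = \<xi> powr p * ((y + 1) * (y + 1) powr (p - 1))"
    proof -
      have "v + \<xi> = \<xi> * (y + 1)" by (simp add: y algebra_simps)
      then show ?thesis using y(1) xi powr_mult_base[of "y + 1" "p - 1"] by (simp add: abs_mult powr_mult)
    qed
    have 2: "\<bar>v\<bar> powr p = \<xi> powr p * (y * y powr (p - 1))"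
      using y xi powr_mult_base[of y "p - 1"] by (simp add: abs_mult powr_mult)
    have 3: "apow' p v * \<xi> = \<xi> powr p * (p * y powr (p - 1))"
    proof -
      have "apow' p v = p * (\<xi> * y) powr (p - 1)" using y xi by (cases "y = 0") (auto simp: apow'_def)
      then have "apow' p v * \<xi> = p * y powr (p - 1) * (\<xi> * \<xi> powr (p - 1))" using y(1) xi by (simp add: powr_mult)
      then show ?thesis using powr_mult_base[of \<xi> "p - 1"] xi by simp
    qed
    have "kap v * (exp \<xi> - 1 - \<xi>) \<le> \<xi> powr p * ((p - 1) / p * N y)"
      using kap_theta_le[OF assms] by (simp add: y_def)
    also have "\<dots> \<le> \<xi> powr p * ((p - 1) / p * (p * ((y + 1) powr (p - 1) - y powr (p - 1))))"
      using N_pos_le(1)[OF y(1)] p by (intro mult_left_mono) auto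
    also have "\<dots> = \<xi> powr p * ((p - 1) * ((y + 1) powr (p - 1) - y powr (p - 1)))" using p by simp
    also have "\<dots> \<le> \<xi> powr p * ((y + 1) * (y + 1) powr (p - 1) - y * y powr (p - 1) - p * y powr (p - 1))"
    proof (intro mult_left_mono)
      show "(p - 1) * ((y + 1) powr (p - 1) - y powr (p - 1)) \<le> (y + 1) * (y + 1) powr (p - 1) - y * y powr (p - 1) - p * y powr (p - 1)"
        using powr_Suc_le_tangent[OF y(1), of "p - 1"] p by (simp add: algebra_simps)
    qed simp
    finally show ?thesis unfolding 1 2 3 by (simp add: algebra_simps)
  qed
  then show ?thesis by (simp add: gap_def)
qed

text \<open>Right of \<open>max v 0\<close> the second derivative of the gap is decreasing, so the gap cannot dip
  below zero between two points where it is nonnegative once its slope is nonnegative at the first.\<close>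

lemma gap_nonneg: assumes v: "- \<xi> \<le> v" and u: "u \<le> v + \<xi>" shows "0 \<le> gap v u"
proof (rule ccontr)
  assume neg: "\<not> 0 \<le> gap v u"
  define w where "w = max v 0"
  have w: "v \<le> w" "0 \<le> w" by (auto simp: w_def)
  have gw: "0 \<le> gap v w" "0 \<le> gap' v w"
    using gap_left[OF v, of w] gap'_mono[OF v, of v w] gap_self by (auto simp: w_def)
  have "w < u" using gap_left[OF v, of u] neg by (force simp: w_def)
  have "u \<noteq> v + \<xi>" using gap_end[OF v] neg by auto
  with u have "u < v + \<xi>" by simp
  obtain r where r: "w < r" "r < u" "gap v u - gap v w = (u - w) * gap' v r"
    using MVT2[OF \<open>w < u\<close>, of "gap v" "gap' v"] gap_deriv by metis
  have "(u - w) * gap' v r < 0" using r neg gw by linarith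
  then have r': "gap' v r < 0" using \<open>w < u\<close> by (simp add: mult_less_0_iff)
  obtain t where t: "u < t" "t < v + \<xi>" "gap v (v + \<xi>) - gap v u = (v + \<xi> - u) * gap' v t"
    using MVT2[OF \<open>u < v + \<xi>\<close>, of "gap v" "gap' v"] gap_deriv by metis
  have "0 < (v + \<xi> - u) * gap' v t" using t neg gap_end[OF v] by linarith
  then have t': "0 < gap' v t" using \<open>u < v + \<xi>\<close> by (simp add: zero_less_mult_iff)
  have d: "(gap' v has_real_derivative apow'' p x - kap v * exp (x - v)) (at x)" if "w < x" for x
    using gap'_deriv that w by simp
  have "\<exists>s1. w < s1 \<and> s1 < r \<and> apow'' p s1 - kap v * exp (s1 - v) < 0"
  proof (rule ccontr)
    assume c: "\<not> ?thesis"
    have "gap' v w \<le> gap' v r"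
    proof (rule deriv_nonneg_imp_le_except_zero[where f = "gap' v" and f' = "\<lambda>u. apow'' p u - kap v * exp (u - v)"])
      show "0 \<le> apow'' p x - kap v * exp (x - v)" if "w < x" "x < r" for x
        using c that by (metis not_less)
    qed (use r d gap'_cont in auto)
    then show False using r' gw by simp
  qed
  then obtain s1 where s1: "w < s1" "s1 < r" "apow'' p s1 - kap v * exp (s1 - v) < 0" by blast
  have "r < t" using r t by simp
  obtain s2 where s2: "r < s2" "s2 < t" "gap' v t - gap' v r = (t - r) * (apow'' p s2 - kap v * exp (s2 - v))"
    using MVT2[OF \<open>r < t\<close>, of "gap' v" "\<lambda>x. apow'' p x - kap v * exp (x - v)"] d r by force
  have "0 < (t - r) * (apow'' p s2 - kap v * exp (s2 - v))" using s2 r' t' by linarith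
  then have "0 < apow'' p s2 - kap v * exp (s2 - v)" using \<open>r < t\<close> by (simp add: zero_less_mult_iff)
  moreover have "apow'' p s2 \<le> apow'' p s1"
    unfolding apow''_def using s1 s2 w p by (intro mult_left_mono powr_mono2') auto
  moreover have "kap v * exp (s1 - v) \<le> kap v * exp (s2 - v)"
    using kap_nonneg[OF v] s1 s2 by (intro mult_left_mono) auto
  ultimately show False using s1 by linarith
qed

text \<open>\<open>Lfun x y w\<close> is the value at \<open>(x, y)\<close> of the affine function that touches \<open>\<bar>u\<bar>\<^sup>p\<close> along
  \<open>(u, e\<^sup>u)\<close> at \<open>u = w\<close> and is adapted to the tangent of \<open>y = C e\<^sup>x\<close> through \<open>(w, e\<^sup>w)\<close>.\<close>

definition Lfun :: "real \<Rightarrow> real \<Rightarrow> real \<Rightarrow> real" where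
  "Lfun x y w = \<bar>w\<bar> powr p + apow' p w * (x - w) + kap w * (y * exp (- w) - 1 - (x - w))"

section \<open>The best supporting plane at a point\<close>

lemma kap_cont: "continuous_on {- \<xi>..} kap"
  unfolding kap_def[abs_def] using xi
  by (intro continuous_intros continuous_on_compose2[OF N_cont]) (auto simp: field_simps)

lemma kap_deriv: assumes "- \<xi> \<le> v" "v \<noteq> 0"
  shows "(kap has_real_derivative (kap v - (1 - \<xi>) * apow'' p v) / \<xi>) (at v)"
proof -
  have "((\<lambda>v. N (v / \<xi>)) has_real_derivative (N (v / \<xi>) - apow'' p (v / \<xi>)) * (1 / \<xi>)) (at v)"
    by (rule DERIV_chain2[OF N_deriv]) (use assms xi in \<open>auto intro!: derivative_eq_intros simp: field_simps\<close>)
  then have "(kap has_real_derivative (1 - \<xi>) * \<xi> powr (p - 2) * ((N (v / \<xi>) - apow'' p (v / \<xi>)) * (1 / \<xi>))) (at v)"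
    unfolding kap_def[abs_def] by (rule DERIV_cmult)
  also have "(1 - \<xi>) * \<xi> powr (p - 2) * ((N (v / \<xi>) - apow'' p (v / \<xi>)) * (1 / \<xi>))
     = (kap v - (1 - \<xi>) * (\<xi> powr (p - 2) * apow'' p (v / \<xi>))) / \<xi>"
    by (simp add: kap_def right_diff_distrib diff_divide_distrib)
  finally show ?thesis by (simp add: apow''_scale)
qed

text \<open>The differential equation for \<open>kap\<close> collapses all terms into one product.
  Its last factor vanishes along the line through \<open>(w, exp w)\<close> that is tangent to the
  upper boundary curve with constant \<open>exp (- \<xi>) / (1 - \<xi>)\<close>; this is the
  envelope property for which \<open>kap\<close> was chosen.\<close>

lemma Lfun_deriv: assumes "- \<xi> \<le> w" "w \<noteq> 0"
  shows "(Lfun x y has_real_derivative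
    (apow'' p w - kap w) / \<xi> * ((x - w) - (1 - \<xi>) * (y * exp (- w) - 1))) (at w)"
proof -
  define z where "z = y * exp (- w) - 1"
  have d1: "((\<lambda>w. apow' p w * (x - w)) has_real_derivative (apow'' p w * (x - w) - apow' p w)) (at w)"
    by (rule DERIV_cong[OF DERIV_mult[OF apow'_deriv[OF assms(2)]]]) (auto intro!: derivative_eq_intros)
  have d2: "((\<lambda>w. kap w * (y * exp (- w) - 1 - (x - w))) has_real_derivative
      ((kap w - (1 - \<xi>) * apow'' p w) / \<xi> * (z - (x - w)) + kap w * (- z))) (at w)"
    by (rule DERIV_cong[OF DERIV_mult[OF kap_deriv[OF assms]]]) (auto intro!: derivative_eq_intros simp: z_def)
  have "(Lfun x y has_real_derivative (apow' p w + (apow'' p w * (x - w) - apow' p w)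
      + ((kap w - (1 - \<xi>) * apow'' p w) / \<xi> * (z - (x - w)) + kap w * (- z)))) (at w)"
    unfolding Lfun_def[abs_def] by (intro DERIV_add apow_deriv[OF p(1)] d1 d2)
  moreover have "(apow' p w + (apow'' p w * (x - w) - apow' p w)
      + ((kap w - (1 - \<xi>) * apow'' p w) / \<xi> * (z - (x - w)) + kap w * (- z)))
      = (apow'' p w - kap w) / \<xi> * ((x - w) - (1 - \<xi>) * z)"
    using xi by (simp add: field_simps)
  ultimately show ?thesis by (simp add: z_def)
qed

lemma Lfun_cont: "continuous_on {- \<xi>..} (Lfun x y)"
  unfolding Lfun_def[abs_def]
  by (intro continuous_intros kap_cont continuous_on_subset[OF apow'_cont[OF p(1)]] continuous_on_powr')
    (use p in auto)

text \<open>The best \<open>v\<close> is the one whose tangent passes through \<open>(x, y)\<close>.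
  With \<open>d = x - v\<close> this reads \<open>D d = y * exp (- x)\<close>, and the intermediate
  value theorem finds \<open>d\<close> in \<open>{0..\<xi>0}\<close>: the tangents belong to the
  higher curve for \<open>\<xi>\<close>, so at distance \<open>\<xi>0\<close> they are already above
  every admissible \<open>y\<close>. The derivative in \<open>w\<close> has the sign of
  \<open>Z\<close>, up to a nonnegative factor, and \<open>Z\<close> decreases through 0 at
  \<open>v\<close>.\<close>

lemma Lfun_select:
  assumes \<xi>0: "0 \<le> \<xi>0" "\<xi>0 < \<xi>" and x: "0 \<le> x" and y: "exp x \<le> y" "y \<le> exp (- \<xi>0) / (1 - \<xi>0) * exp x"
  shows "\<exists>v\<in>{x - \<xi>0..x}. \<forall>w\<in>{x - \<xi>..x}. Lfun x y w \<le> Lfun x y v"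
proof -
  define D where "D d = exp (- d) * (1 + d / (1 - \<xi>))" for d
  define \<rho> where "\<rho> = y * exp (- x)"
  have \<rho>: "1 \<le> \<rho>" "\<rho> \<le> exp (- \<xi>0) / (1 - \<xi>0)"
    using y by (auto simp: \<rho>_def exp_minus field_simps)
  have "exp (- \<xi>0) / (1 - \<xi>0) \<le> D \<xi>0"
  proof -
    have "\<xi>0 / (1 - \<xi>0) \<le> \<xi>0 / (1 - \<xi>)" using \<xi>0 xi by (intro divide_left_mono) auto
    moreover have "1 / (1 - \<xi>0) = 1 + \<xi>0 / (1 - \<xi>0)" using \<xi>0 xi by (simp add: field_simps)
    ultimately have "exp (- \<xi>0) * (1 / (1 - \<xi>0)) \<le> D \<xi>0" unfolding D_def by (intro mult_left_mono) auto
    then show ?thesis by simp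
  qed
  moreover have "D 0 \<le> \<rho>" using \<rho> by (simp add: D_def)
  moreover have "continuous_on {0..\<xi>0} D" unfolding D_def[abs_def] using xi by (intro continuous_intros) auto
  ultimately obtain d where d: "0 \<le> d" "d \<le> \<xi>0" "D d = \<rho>" using IVT'[of D 0 \<rho> \<xi>0] \<rho> \<xi>0 by auto
  define v where "v = x - d"
  define Z where "Z w = exp w * (x - w + 1 - \<xi>) - (1 - \<xi>) * y" for w
  have Zv: "Z v = 0"
  proof -
    have "exp v * (1 + d / (1 - \<xi>)) = y"
      using d(3) by (simp add: D_def \<rho>_def v_def exp_diff exp_minus field_simps)
    then have "exp v * (1 - \<xi> + d) = (1 - \<xi>) * y" using xi by (simp add: field_simps)
    then show ?thesis by (simp add: Z_def v_def algebra_simps)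
  qed
  have Zmono: "Z t \<le> Z s" if "x - \<xi> \<le> s" "s \<le> t" for s t
  proof -
    have "- Z s \<le> - Z t"
    proof (rule DERIV_nonneg_imp_nondecreasing[OF that(2), where f = "\<lambda>w. - Z w"])
      fix w assume "s \<le> w" "w \<le> t"
      then have "0 \<le> exp w * (w + \<xi> - x)" using that by simp
      moreover have "((\<lambda>w. - Z w) has_real_derivative exp w * (w + \<xi> - x)) (at w)"
        unfolding Z_def by (auto intro!: derivative_eq_intros simp: algebra_simps)
      ultimately show "\<exists>y. ((\<lambda>w. - Z w) has_real_derivative y) (at w) \<and> 0 \<le> y" by blast
    qed
    then show ?thesis by simp
  qed
  have ZN: "(x - w) - (1 - \<xi>) * (y * exp (- w) - 1) = exp (- w) * Z w" for w
  proof -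
    have "exp (- w) * Z w = (exp (- w) * exp w) * (x - w + 1 - \<xi>) - (1 - \<xi>) * (y * exp (- w))"
      by (simp add: Z_def right_diff_distrib)
    also have "exp (- w) * exp w = 1" by (simp flip: exp_add)
    finally show ?thesis by (simp add: algebra_simps)
  qed
  have k: "0 \<le> (apow'' p w - kap w) / \<xi>" if "- \<xi> \<le> w" "w \<noteq> 0" for w
    using kap_exp_le_apow''[of w w] that xi by auto
  have "Lfun x y w \<le> Lfun x y v" if w: "w \<in> {x - \<xi>..x}" for w
  proof (cases "w \<le> v")
    case True
    show ?thesis
    proof (rule deriv_nonneg_imp_le_except_zero[OF True, where f' = "\<lambda>w. (apow'' p w - kap w) / \<xi> * (exp (- w) * Z w)"])
      show "continuous_on {w..v} (Lfun x y)" by (rule continuous_on_subset[OF Lfun_cont]) (use w x in auto)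
      fix s assume s: "w < s" "s < v" "s \<noteq> 0"
      then have s': "- \<xi> \<le> s" using w x by auto
      show "(Lfun x y has_real_derivative (apow'' p s - kap s) / \<xi> * (exp (- s) * Z s)) (at s)"
        using Lfun_deriv[OF s' s(3), of x y] unfolding ZN .
      have "0 \<le> Z s" using Zmono[of s v] Zv s w by auto
      then show "0 \<le> (apow'' p s - kap s) / \<xi> * (exp (- s) * Z s)"
        by (intro mult_nonneg_nonneg k[OF s' s(3)]) auto
    qed
  next
    case False
    then have "v \<le> w" by simp
    have v': "x - \<xi> \<le> v" using d \<xi>0 by (simp add: v_def)
    have "- Lfun x y v \<le> - Lfun x y w"
    proof (rule deriv_nonneg_imp_le_except_zero[OF \<open>v \<le> w\<close>, where f = "\<lambda>w. - Lfun x y w" and f' = "\<lambda>w. - ((apow'' p w - kap w) / \<xi> * (exp (- w) * Z w))"])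
      show "continuous_on {v..w} (\<lambda>w. - Lfun x y w)"
        by (intro continuous_on_minus continuous_on_subset[OF Lfun_cont]) (use v' x in auto)
      fix s assume s: "v < s" "s < w" "s \<noteq> 0"
      then have s': "- \<xi> \<le> s" using v' x by auto
      show "((\<lambda>w. - Lfun x y w) has_real_derivative - ((apow'' p s - kap s) / \<xi> * (exp (- s) * Z s))) (at s)"
        using DERIV_minus[OF Lfun_deriv[OF s' s(3), of x y]] unfolding ZN .
      have "Z s \<le> 0" using Zmono[of v s] Zv s v' by auto
      then have "(apow'' p s - kap s) / \<xi> * (exp (- s) * Z s) \<le> 0"
        using k[OF s' s(3)] by (intro mult_nonneg_nonpos) auto
      then show "0 \<le> - ((apow'' p s - kap s) / \<xi> * (exp (- s) * Z s))" by simp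
    qed
    then show ?thesis by simp
  qed
  moreover have "v \<in> {x - \<xi>0..x}" using d by (simp add: v_def)
  ultimately show ?thesis by blast
qed

text \<open>The tangent from the boundary point over \<open>- \<xi>\<close> touches the upper curve
  over 0. At the point of tangency the value is the p-th central moment of \<xi> log (1/t); below
  that point it decreases linearly with the defect in \<open>y\<close>, with slope
  \<open>kap (- \<xi>) * exp \<xi>\<close>.\<close>

lemma Lfun_start: "Lfun 0 y (- \<xi>) = \<xi> powr p * M (- 1) - kap (- \<xi>) * exp \<xi> * (exp (- \<xi>) / (1 - \<xi>) - y)"
proof -
  have a: "apow' p (- \<xi>) * \<xi> = - (p * \<xi> powr p)"
    using xi powr_mult_base[of \<xi> "p - 1"] by (simp add: apow'_neg mult_ac)
  have N1: "N (- 1) = M (- 1) - 1 + p" using p by (simp add: N_def m_def apow'_def)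
  have k: "kap (- \<xi>) * (\<xi>\<^sup>2 / (1 - \<xi>)) = \<xi> powr p * N (- 1)"
  proof -
    have "\<xi> powr (p - 2) * \<xi> powr 2 = \<xi> powr p" by (simp flip: powr_add)
    then have "\<xi> powr (p - 2) * \<xi>\<^sup>2 = \<xi> powr p" using xi by (simp add: powr_numeral)
    moreover have "kap (- \<xi>) * (\<xi>\<^sup>2 / (1 - \<xi>)) = (\<xi> powr (p - 2) * \<xi>\<^sup>2) * N (- 1)"
      using xi by (simp add: kap_def)
    ultimately show ?thesis by simp
  qed
  have "y * exp \<xi> - 1 - \<xi> = \<xi>\<^sup>2 / (1 - \<xi>) - exp \<xi> * (exp (- \<xi>) / (1 - \<xi>) - y)"
  proof -
    have "exp \<xi> * (exp (- \<xi>) / (1 - \<xi>) - y) = 1 / (1 - \<xi>) - y * exp \<xi>"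
      by (simp add: right_diff_distrib exp_minus)
    moreover have "\<xi>\<^sup>2 / (1 - \<xi>) - 1 / (1 - \<xi>) = - 1 - \<xi>"
    proof -
      have "\<xi>\<^sup>2 - 1 = (- 1 - \<xi>) * (1 - \<xi>)" by (simp add: algebra_simps power2_eq_square)
      then show ?thesis using xi by (simp flip: diff_divide_distrib)
    qed
    ultimately show ?thesis by linarith
  qed
  then have "kap (- \<xi>) * (y * exp \<xi> - 1 - \<xi>) = \<xi> powr p * N (- 1) - kap (- \<xi>) * exp \<xi> * (exp (- \<xi>) / (1 - \<xi>) - y)"
    using k by (simp only: right_diff_distrib mult.assoc)
  then show ?thesis using a xi N1 by (simp add: Lfun_def algebra_simps)
qed

lemma kap_le: assumes "- \<xi> \<le> v" shows "kap v \<le> 2 * p * \<xi> powr (p - 2)"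
proof -
  have "N (v / \<xi>) \<le> 2 * p"
  proof (cases "v \<le> 0")
    case True
    have b: "0 \<le> - v / \<xi>" "- v / \<xi> \<le> 1" using True assms xi by (auto simp: field_simps)
    have "(- v / \<xi>) powr (p - 1) \<le> 1" using b p by (intro powr_le1) auto
    then have "p * (1 - (- v / \<xi>) + (- v / \<xi>) powr (p - 1)) \<le> p * 2" using b p by (intro mult_left_mono) auto
    then show ?thesis using N_neg_le[OF b] by simp
  next
    case False
    then have "N (v / \<xi>) \<le> p" using xi by (intro N_pos_le(2)) auto
    then show ?thesis using p by simp
  qed
  moreover have "0 \<le> N (v / \<xi>)" using N_nonneg[of "v / \<xi>"] assms xi by (simp add: field_simps)
  ultimately have "((1 - \<xi>) * \<xi> powr (p - 2)) * N (v / \<xi>) \<le> (1 * \<xi> powr (p - 2)) * (2 * p)"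
    using xi by (intro mult_mono) auto
  then show ?thesis by (simp add: kap_def mult_ac)
qed

text \<open>Serves only to make the contribution of a short initial interval vanish, so both powers
  are simply replaced by the square.\<close>

lemma Lfun_growth:
  assumes "0 \<le> x" "v \<in> {x - \<xi>..x}" "0 \<le> y" "y \<le> B * exp x"
  shows "Lfun x y v \<le> (6 + 2 * p * \<xi> powr (p - 2) * B * exp 1) * exp x"
proof -
  have B: "0 \<le> B" using assms(3,4) by (metis order_trans zero_le_mult_iff exp_gt_zero not_le)
  have av: "\<bar>v\<bar> \<le> x + 1" "- \<xi> \<le> v" using assms xi by auto
  have "(1 + x) * (1 + x) \<le> 2 * exp x"
    using exp_lower_Taylor_quadratic[OF assms(1)] by (simp add: algebra_simps power2_eq_square)
  then have sq: "(1 + x) powr 2 \<le> 2 * exp x" using assms(1) by (simp add: powr_numeral power2_eq_square)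
  have "\<bar>v\<bar> powr p \<le> (1 + x) powr p" using av p by (intro powr_mono2) auto
  also have "\<dots> \<le> (1 + x) powr 2" using assms p by (intro powr_mono) auto
  finally have 1: "\<bar>v\<bar> powr p \<le> 2 * exp x" using sq by simp
  have "\<bar>apow' p v * (x - v)\<bar> = p * \<bar>sgn v\<bar> * \<bar>v\<bar> powr (p - 1) * (x - v)"
    using assms p by (simp add: apow'_def abs_mult)
  also have "\<dots> \<le> (2 * 1 * (1 + x) powr 2) * 1"
  proof (intro mult_mono)
    have "\<bar>v\<bar> powr (p - 1) \<le> (1 + x) powr (p - 1)" using av p by (intro powr_mono2) auto
    also have "\<dots> \<le> (1 + x) powr 2" using assms p by (intro powr_mono) auto
    finally show "\<bar>v\<bar> powr (p - 1) \<le> (1 + x) powr 2" .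
    show "\<bar>sgn v\<bar> \<le> 1" by (simp add: sgn_if)
  qed (use p xi assms in auto)
  finally have 2: "apow' p v * (x - v) \<le> 4 * exp x" using sq by simp
  have "y * exp (- v) - 1 - (x - v) \<le> y * exp (- v)" using assms by simp
  also have "\<dots> \<le> B * exp x * exp (- v)" using assms by (intro mult_right_mono) auto
  also have "\<dots> = B * exp (x - v)" by (simp add: exp_diff exp_minus field_simps)
  also have "\<dots> \<le> B * exp 1" using B assms xi by (intro mult_left_mono) auto
  finally have "kap v * (y * exp (- v) - 1 - (x - v)) \<le> kap v * (B * exp 1)"
    using kap_nonneg[OF av(2)] by (intro mult_left_mono) auto
  also have "\<dots> \<le> 2 * p * \<xi> powr (p - 2) * (B * exp 1)" using kap_le[OF av(2)] B by (intro mult_right_mono) auto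
  also have "\<dots> \<le> 2 * p * \<xi> powr (p - 2) * (B * exp 1) * exp x"
    using B p assms(1) mult_left_mono[of 1 "exp x" "2 * p * \<xi> powr (p - 2) * (B * exp 1)"] by simp
  finally show ?thesis using 1 2 by (simp add: Lfun_def algebra_simps)
qed

end

section \<open>Estimates on a single interval\<close>

lemma exp_subgradient: "\<exists>m. \<forall>u. exp (x::real) + m * (u - x) \<le> exp u"
proof (intro exI allI)
  fix u
  have "exp x * (1 + (u - x)) \<le> exp x * exp (u - x)"
    by (intro mult_left_mono exp_ge_add_one_self) simp
  then show "exp x + exp x * (u - x) \<le> exp u" by (simp add: algebra_simps flip: exp_add)
qed

lemma (in exponent_xi) bellman_candidate_lower:
  assumes "0 \<le> \<xi>0" "\<xi>0 < \<xi>"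
  shows "bellman_candidate exp (\<lambda>u. \<bar>u\<bar> powr p) (\<lambda>w. \<bar>w\<bar> powr p - apow' p w * w + kap w * (w - 1))
    (\<lambda>w. apow' p w - kap w) (\<lambda>w. kap w * exp (- w)) (exp (- \<xi>0) / (1 - \<xi>0)) \<xi>0 \<xi>"
proof
  have L: "\<bar>w\<bar> powr p - apow' p w * w + kap w * (w - 1) + (apow' p w - kap w) * x + kap w * exp (- w) * y = Lfun x y w" for w x y
    by (simp add: Lfun_def algebra_simps)
  show "\<exists>m. \<forall>u. exp x + m * (u - x) \<le> exp u" for x :: real by (rule exp_subgradient)
  show "\<bar>v\<bar> powr p - apow' p v * v + kap v * (v - 1) + (apow' p v - kap v) * u + kap v * exp (- v) * exp u \<le> \<bar>u\<bar> powr p"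
    if "- \<xi> \<le> v" "u \<le> v + \<xi>" for v u
  proof -
    have "exp u * exp (- v) = exp (u - v)" by (simp add: exp_diff exp_minus field_simps)
    then show ?thesis unfolding L Lfun_def using gap_nonneg[OF that] by (simp add: gap_def)
  qed
  show "\<exists>v\<in>{x - \<xi>0..x}. \<forall>w\<in>{x - \<xi>..x}.
          \<bar>w\<bar> powr p - apow' p w * w + kap w * (w - 1) + (apow' p w - kap w) * x + kap w * exp (- w) * y
          \<le> \<bar>v\<bar> powr p - apow' p v * v + kap v * (v - 1) + (apow' p v - kap v) * x + kap v * exp (- v) * y"
    if "0 \<le> x" "exp x \<le> y" "y \<le> exp (- \<xi>0) / (1 - \<xi>0) * exp x" for x y
    unfolding L by (rule Lfun_select[OF assms that])
qed (use assms in auto)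

text \<open>Compare the trajectory at \<open>w = - \<xi>\<close> and let \<open>\<tau>\<close> tend
  to 0. By \<open>Lfun_growth\<close> and Jensen's inequality the term at \<open>\<tau>\<close> is
  at most a multiple of the integral of \<open>exp (f s)\<close> over \<open>{0..\<tau>}\<close>.
  The mean of the exponential is kept instead of being replaced by its largest possible value,
  because the later choice of intervals makes it only nearly extremal.\<close>

lemma reverse_jensen_lower:
  assumes rj: "reverse_jensen \<psi> exp a b (exp (- \<xi>0) / (1 - \<xi>0))"
    and ex: "exponent_xi p \<xi>" and \<xi>0: "0 \<le> \<xi>0" "\<xi>0 < \<xi>"
    and mean: "integral {a..b} \<psi> = 0"
    and ip: "(\<lambda>x. \<bar>\<psi> x\<bar> powr p) absolutely_integrable_on {a..b}"
  shows "\<xi> powr p * exponent.M p (- 1)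
     - exponent_xi.kap p \<xi> (- \<xi>) * exp \<xi> * (exp (- \<xi>) / (1 - \<xi>) - integral {a..b} (\<lambda>x. exp (\<psi> x)) / (b - a))
     \<le> integral {a..b} (\<lambda>x. \<bar>\<psi> x\<bar> powr p) / (b - a)"
proof -
  interpret exponent_xi p \<xi> by (rule ex)
  define C where "C = exp (- \<xi>0) / (1 - \<xi>0)"
  interpret reverse_jensen \<psi> exp a b C using rj by (simp add: C_def)
  obtain f where "rearranged \<psi> exp a b C f" using rearranged_exists by blast
  then interpret rearranged \<psi> exp a b C f .
  define \<rho> where "\<rho> = integral {0..1} (\<lambda>s. exp (f s))"
  have \<rho>: "\<rho> = integral {a..b} (\<lambda>x. exp (\<psi> x)) / (b - a)"
    unfolding \<rho>_def by (rule equi_closed[OF _ Pf_int]) simp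
  have m0: "integral {0..1} f = 0" using equi_closed[of "\<lambda>x. x"] f_int mean by simp
  have hm: "(\<lambda>u::real. \<bar>u\<bar> powr p) \<in> borel_measurable borel" by measurable
  have hf: "(\<lambda>s. \<bar>f s\<bar> powr p) absolutely_integrable_on {0..1}" using equi_int_closed[OF hm] ip by simp
  have hI: "integral {0..1} (\<lambda>s. \<bar>f s\<bar> powr p) = integral {a..b} (\<lambda>x. \<bar>\<psi> x\<bar> powr p) / (b - a)"
    by (rule equi_closed[OF hm hf])
  define K where "K = 6 + 2 * p * \<xi> powr (p - 2) * C * exp 1"
  have K0: "0 \<le> K" using C1 p by (simp add: K_def)
  have step: "Lfun 0 \<rho> (- \<xi>) \<le> K * integral {0..\<tau>} (\<lambda>s. exp (f s)) + integral {0..1} (\<lambda>s. \<bar>f s\<bar> powr p)"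
    if \<tau>: "0 < \<tau>" "\<tau> < 1" for \<tau>
  proof -
    have "(\<lambda>s. \<bar>f s\<bar> powr p) integrable_on {\<tau>..1}" using integrable_on_sub[OF hf] \<tau> by simp
    from trajectory[OF bellman_candidate_lower[OF \<xi>0, folded C_def] m0 \<tau> this]
    obtain v where v: "v \<in> {mean_f \<tau> - \<xi>0..mean_f \<tau>}" and
      le: "\<forall>w\<in>{-\<xi>..0}. \<bar>w\<bar> powr p - apow' p w * w + kap w * (w - 1) + kap w * exp (- w) * \<rho>
         \<le> \<tau> * (\<bar>v\<bar> powr p - apow' p v * v + kap v * (v - 1) + (apow' p v - kap v) * mean_f \<tau> + kap v * exp (- v) * mean_P \<tau>)
            + integral {\<tau>..1} (\<lambda>s. \<bar>f s\<bar> powr p)" unfolding \<rho>_def by blast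
    have "- \<xi> \<in> {-\<xi>..0}" using xi by simp
    from le[rule_format, OF this] have "Lfun 0 \<rho> (- \<xi>) \<le> \<tau> * Lfun (mean_f \<tau>) (mean_P \<tau>) v + integral {\<tau>..1} (\<lambda>s. \<bar>f s\<bar> powr p)"
      by (simp add: Lfun_def algebra_simps)
    also have "\<tau> * Lfun (mean_f \<tau>) (mean_P \<tau>) v \<le> \<tau> * (K * mean_P \<tau>)"
    proof (intro mult_left_mono)
      have F0: "0 \<le> mean_f \<tau>" using mean_f_antimono[of \<tau> 1] \<tau> m0 by (simp add: mean_f_def)
      obtain k where "\<And>u. exp (mean_f \<tau>) + k * (u - mean_f \<tau>) \<le> exp u" using exp_subgradient by blast
      then have FW: "exp (mean_f \<tau>) \<le> mean_P \<tau>" by (rule mean_P_ge) (use \<tau> in auto)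
      have "Lfun (mean_f \<tau>) (mean_P \<tau>) v \<le> K * exp (mean_f \<tau>)"
        unfolding K_def
      proof (rule Lfun_growth[OF F0])
        show "v \<in> {mean_f \<tau> - \<xi>..mean_f \<tau>}" using v \<xi>0 by auto
        show "0 \<le> mean_P \<tau>" using FW exp_ge_zero order_trans by blast
        show "mean_P \<tau> \<le> C * exp (mean_f \<tau>)" using mean_P_le \<tau> by simp
      qed
      also have "\<dots> \<le> K * mean_P \<tau>" using FW K0 by (rule mult_left_mono)
      finally show "Lfun (mean_f \<tau>) (mean_P \<tau>) v \<le> K * mean_P \<tau>" .
    qed (use \<tau> in simp)
    also have "\<tau> * (K * mean_P \<tau>) = K * integral {0..\<tau>} (\<lambda>s. exp (f s))" using \<tau> by (simp add: mean_P_def)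
    also have "integral {\<tau>..1} (\<lambda>s. \<bar>f s\<bar> powr p) \<le> integral {0..1} (\<lambda>s. \<bar>f s\<bar> powr p)"
    proof -
      have "0 \<le> integral {0..\<tau>} (\<lambda>s. \<bar>f s\<bar> powr p)"
        using integrable_on_sub[OF hf, of 0 \<tau>] \<tau> by (intro Henstock_Kurzweil_Integration.integral_nonneg) auto
      then show ?thesis using integral_split[OF hf, of \<tau> 1] \<tau> by simp
    qed
    finally show ?thesis by simp
  qed
  have "((\<lambda>\<tau>. K * integral {0..\<tau>} (\<lambda>s. exp (f s)) + integral {0..1} (\<lambda>s. \<bar>f s\<bar> powr p)) \<longlongrightarrow>
      K * 0 + integral {0..1} (\<lambda>s. \<bar>f s\<bar> powr p)) (at_right 0)"
  proof (intro tendsto_intros)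
    have "continuous_on {0..1} (\<lambda>\<tau>. integral {0..\<tau>} (\<lambda>s. exp (f s)))"
      by (rule indefinite_integral_continuous_1) (use integrable_on_sub[OF Pf_int, of 0 1] in auto)
    then have "((\<lambda>\<tau>. integral {0..\<tau>} (\<lambda>s. exp (f s))) \<longlongrightarrow> integral {0..0} (\<lambda>s. exp (f s))) (at_right 0)"
      by (rule continuous_on_Icc_at_rightD) simp
    then show "((\<lambda>\<tau>. integral {0..\<tau>} (\<lambda>s. exp (f s))) \<longlongrightarrow> 0) (at_right 0)" by simp
  qed
  moreover have "eventually (\<lambda>\<tau>. Lfun 0 \<rho> (- \<xi>) \<le> K * integral {0..\<tau>} (\<lambda>s. exp (f s)) + integral {0..1} (\<lambda>s. \<bar>f s\<bar> powr p)) (at_right 0)"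
    unfolding eventually_at_right_field using step by (intro exI[of _ 1]) auto
  ultimately have "Lfun 0 \<rho> (- \<xi>) \<le> K * 0 + integral {0..1} (\<lambda>s. \<bar>f s\<bar> powr p)"
    by (rule tendsto_lowerbound) simp
  then show ?thesis unfolding Lfun_start hI[symmetric] \<rho>[symmetric] by simp
qed

section \<open>The upper bound for the variance\<close>

lemma square_le_exp_gap:
  fixes d \<eta> :: real
  assumes "0 \<le> \<eta>" "d \<le> \<eta>"
  shows "d\<^sup>2 \<le> 2 * (1 + \<eta>) * (exp (- d) - 1 + d)"
proof -
  have nn: "0 \<le> exp (- d) - 1 + d" using exp_ge_add_one_self[of "- d"] by simp
  show ?thesis
  proof (cases "0 \<le> d")
    case True
    define g where "g x = 2 * (1 + x) * exp (- x) - 2 + x\<^sup>2" for x :: real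
    have "g 0 \<le> g d"
    proof (rule DERIV_nonneg_imp_nondecreasing[OF True])
      fix t :: real assume "0 \<le> t"
      have "(g has_real_derivative 2 * t * (1 - exp (- t))) (at t)"
        unfolding g_def[abs_def] by (auto intro!: derivative_eq_intros simp: algebra_simps)
      moreover have "0 \<le> 2 * t * (1 - exp (- t))" using \<open>0 \<le> t\<close> by simp
      ultimately show "\<exists>y. (g has_real_derivative y) (at t) \<and> 0 \<le> y" by blast
    qed
    then have "d\<^sup>2 \<le> 2 * (1 + d) * (exp (- d) - 1 + d)" by (simp add: g_def algebra_simps power2_eq_square)
    also have "\<dots> \<le> 2 * (1 + \<eta>) * (exp (- d) - 1 + d)" using assms nn by (intro mult_right_mono) auto
    finally show ?thesis .
  next
    case False
    then have "1 + (- d) + (- d)\<^sup>2 / 2 \<le> exp (- d)" by (intro exp_lower_Taylor_quadratic) simp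
    then have "d\<^sup>2 \<le> 2 * 1 * (exp (- d) - 1 + d)" by simp
    also have "\<dots> \<le> 2 * (1 + \<eta>) * (exp (- d) - 1 + d)" using assms nn by (intro mult_right_mono) auto
    finally show ?thesis .
  qed
qed

text \<open>The counterpart of \<open>Lfun\<close> for the square and the boundary curve
  \<open>y = exp (- x)\<close>. The tangent through \<open>(w, exp (- w))\<close> to the upper curve
  with constant \<open>exp \<eta> / (1 + \<eta>)\<close> touches at \<open>w + \<eta>\<close>, and
  for the square the coefficient of the exponential is explicit. These planes lie above the square,
  so they enter the candidate with a minus sign.\<close>

definition Qfun :: "real \<Rightarrow> real \<Rightarrow> real \<Rightarrow> real \<Rightarrow> real" where
  "Qfun \<eta> x y w = w\<^sup>2 + 2 * w * (x - w) + 2 * (1 + \<eta>) * (y * exp w - 1 + (x - w))"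

lemma Qfun_ge:
  assumes "0 \<le> \<eta>" "x \<le> v + \<eta>" "exp (- x) \<le> y" shows "x\<^sup>2 \<le> Qfun \<eta> x y v"
proof -
  have "(x - v)\<^sup>2 \<le> 2 * (1 + \<eta>) * (exp (- (x - v)) - 1 + (x - v))"
    by (rule square_le_exp_gap) (use assms in auto)
  also have "exp (- (x - v)) = exp (- x) * exp v" by (simp flip: exp_add)
  also have "2 * (1 + \<eta>) * (exp (- x) * exp v - 1 + (x - v)) \<le> 2 * (1 + \<eta>) * (y * exp v - 1 + (x - v))"
    using assms by (intro mult_left_mono add_mono diff_mono mult_right_mono) auto
  finally show ?thesis by (simp add: Qfun_def algebra_simps power2_eq_square)
qed

text \<open>As for \<open>Lfun_select\<close>, \<open>v\<close> is found from the tangent through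
  the point by the intermediate value theorem. Now \<open>Z\<close> increases through 0 at
  \<open>v\<close>, so \<open>v\<close> is a minimum.\<close>

lemma Qfun_select:
  assumes \<eta>: "0 \<le> \<eta>0" "\<eta>0 < \<eta>" and y: "exp (- x) \<le> y" "y \<le> exp \<eta>0 / (1 + \<eta>0) * exp (- x)"
  shows "\<exists>v\<in>{x - \<eta>0..x}. \<forall>w\<in>{x - \<eta>..x}. Qfun \<eta> x y v \<le> Qfun \<eta> x y w"
proof -
  define D where "D d = exp d * (1 - d / (1 + \<eta>))" for d
  define \<rho> where "\<rho> = y * exp x"
  have \<rho>: "1 \<le> \<rho>" "\<rho> \<le> exp \<eta>0 / (1 + \<eta>0)"
  proof -
    have "exp (- x) * exp x \<le> y * exp x" using y by (intro mult_right_mono) auto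
    then show "1 \<le> \<rho>" by (simp add: \<rho>_def flip: exp_add)
    have "y * exp x \<le> exp \<eta>0 / (1 + \<eta>0) * exp (- x) * exp x" using y by (intro mult_right_mono) auto
    then show "\<rho> \<le> exp \<eta>0 / (1 + \<eta>0)" by (simp add: \<rho>_def mult.assoc flip: exp_add)
  qed
  have "exp \<eta>0 / (1 + \<eta>0) \<le> D \<eta>0"
  proof -
    have "\<eta>0 / (1 + \<eta>) \<le> \<eta>0 / (1 + \<eta>0)" using \<eta> by (intro divide_left_mono) auto
    moreover have "1 / (1 + \<eta>0) = 1 - \<eta>0 / (1 + \<eta>0)" using \<eta> by (simp add: field_simps)
    ultimately have "exp \<eta>0 * (1 / (1 + \<eta>0)) \<le> D \<eta>0" unfolding D_def by (intro mult_left_mono) auto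
    then show ?thesis by simp
  qed
  moreover have "D 0 \<le> \<rho>" using \<rho> by (simp add: D_def)
  moreover have "continuous_on {0..\<eta>0} D" unfolding D_def[abs_def] using \<eta> by (intro continuous_intros) auto
  ultimately obtain d where d: "0 \<le> d" "d \<le> \<eta>0" "D d = \<rho>" using IVT'[of D 0 \<rho> \<eta>0] \<rho> \<eta> by auto
  define v where "v = x - d"
  define Z where "Z w = exp (- w) * (x - w - 1 - \<eta>) + (1 + \<eta>) * y" for w
  have Zv: "Z v = 0"
  proof -
    have "exp (- v) * (1 - d / (1 + \<eta>)) = exp (- x) * D d" by (simp add: D_def v_def exp_diff exp_minus field_simps)
    also have "\<dots> = y" unfolding d(3) \<rho>_def by (simp add: exp_minus)
    finally have "exp (- v) * (1 + \<eta> - d) = (1 + \<eta>) * y" using \<eta> by (simp add: field_simps)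
    then show ?thesis by (simp add: Z_def v_def algebra_simps)
  qed
  have Zmono: "Z s \<le> Z t" if "x - \<eta> \<le> s" "s \<le> t" for s t
  proof (rule DERIV_nonneg_imp_nondecreasing[OF that(2)])
    fix w assume "s \<le> w" "w \<le> t"
    then have "0 \<le> exp (- w) * (\<eta> - (x - w))" using that by simp
    moreover have "(Z has_real_derivative exp (- w) * (\<eta> - (x - w))) (at w)"
      unfolding Z_def[abs_def] by (auto intro!: derivative_eq_intros simp: algebra_simps)
    ultimately show "\<exists>y. (Z has_real_derivative y) (at w) \<and> 0 \<le> y" by blast
  qed
  have dQ: "(Qfun \<eta> x y has_real_derivative 2 * exp w * Z w) (at w)" for w
  proof -
    have "(Qfun \<eta> x y has_real_derivative 2 * (x - w) + 2 * (1 + \<eta>) * (y * exp w - 1)) (at w)"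
      unfolding Qfun_def[abs_def] by (auto intro!: derivative_eq_intros simp: algebra_simps)
    moreover have "2 * exp w * Z w = 2 * (x - w) + 2 * (1 + \<eta>) * (y * exp w - 1)"
    proof -
      have "exp w * Z w = (exp w * exp (- w)) * (x - w - 1 - \<eta>) + (1 + \<eta>) * (y * exp w)"
        by (simp add: Z_def distrib_left)
      also have "exp w * exp (- w) = 1" by (simp flip: exp_add)
      finally show ?thesis by (simp add: algebra_simps)
    qed
    ultimately show ?thesis by simp
  qed
  have v': "x - \<eta> \<le> v" using d \<eta> by (simp add: v_def)
  have "Qfun \<eta> x y v \<le> Qfun \<eta> x y w" if w: "w \<in> {x - \<eta>..x}" for w
  proof (cases "w \<le> v")
    case True
    have "- Qfun \<eta> x y w \<le> - Qfun \<eta> x y v"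
    proof (rule DERIV_nonneg_imp_nondecreasing[OF True, where f = "\<lambda>w. - Qfun \<eta> x y w"])
      fix s assume s: "w \<le> s" "s \<le> v"
      have "Z s \<le> 0" using Zmono[of s v] Zv s w by auto
      then have "2 * exp s * Z s \<le> 0" by (intro mult_nonneg_nonpos) auto
      then show "\<exists>y'. ((\<lambda>w. - Qfun \<eta> x y w) has_real_derivative y') (at s) \<and> 0 \<le> y'"
        using DERIV_minus[OF dQ[of s]] by (intro exI[of _ "- (2 * exp s * Z s)"]) auto
    qed
    then show ?thesis by simp
  next
    case False
    then have "v \<le> w" by simp
    then show ?thesis
    proof (rule DERIV_nonneg_imp_nondecreasing)
      fix s assume s: "v \<le> s" "s \<le> w"
      have "0 \<le> Z s" using Zmono[of v s] Zv s v' by auto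
      then show "\<exists>y'. (Qfun \<eta> x y has_real_derivative y') (at s) \<and> 0 \<le> y'"
        using dQ[of s] by (intro exI[of _ "2 * exp s * Z s"]) auto
    qed
  qed
  moreover have "v \<in> {x - \<eta>0..x}" using d by (simp add: v_def)
  ultimately show ?thesis by blast
qed

lemma bellman_candidate_upper:
  assumes "0 \<le> \<eta>0" "\<eta>0 < \<eta>"
  shows "bellman_candidate (\<lambda>u. exp (- u)) (\<lambda>u. - (u\<^sup>2)) (\<lambda>w. w\<^sup>2 + 2 * (1 + \<eta>) * (1 + w))
    (\<lambda>w. - (2 * w + 2 * (1 + \<eta>))) (\<lambda>w. - (2 * (1 + \<eta>) * exp w)) (exp \<eta>0 / (1 + \<eta>0)) \<eta>0 \<eta>"
proof
  have L: "w\<^sup>2 + 2 * (1 + \<eta>) * (1 + w) + - (2 * w + 2 * (1 + \<eta>)) * x + - (2 * (1 + \<eta>) * exp w) * y = - Qfun \<eta> x y w" for w x y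
    by (simp add: Qfun_def algebra_simps power2_eq_square)
  show "\<exists>m. \<forall>u. exp (- x) + m * (u - x) \<le> exp (- u)" for x :: real
  proof -
    obtain m where "\<And>u. exp (- x) + m * (u - (- x)) \<le> exp u" using exp_subgradient[of "- x"] by blast
    then have "exp (- x) + (- m) * (u - x) \<le> exp (- u)" for u
      using \<open>\<And>u. exp (- x) + m * (u - (- x)) \<le> exp u\<close>[of "- u"] by (simp add: algebra_simps)
    then show ?thesis by blast
  qed
  show "v\<^sup>2 + 2 * (1 + \<eta>) * (1 + v) + - (2 * v + 2 * (1 + \<eta>)) * u + - (2 * (1 + \<eta>) * exp v) * exp (- u) \<le> - (u\<^sup>2)"
    if "- \<eta> \<le> v" "u \<le> v + \<eta>" for v u
    unfolding L using Qfun_ge[of \<eta> u v "exp (- u)"] assms that by simp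
  show "\<exists>v\<in>{x - \<eta>0..x}. \<forall>w\<in>{x - \<eta>..x}.
          w\<^sup>2 + 2 * (1 + \<eta>) * (1 + w) + - (2 * w + 2 * (1 + \<eta>)) * x + - (2 * (1 + \<eta>) * exp w) * y
          \<le> v\<^sup>2 + 2 * (1 + \<eta>) * (1 + v) + - (2 * v + 2 * (1 + \<eta>)) * x + - (2 * (1 + \<eta>) * exp v) * y"
    if "0 \<le> x" "exp (- x) \<le> y" "y \<le> exp \<eta>0 / (1 + \<eta>0) * exp (- x)" for x y
    unfolding L using Qfun_select[OF assms that(2,3)] by simp
qed (use assms in auto)

text \<open>Makes truncated squares integrable before the square itself is known to be.\<close>

lemma square_le_exp:
  fixes u B :: real assumes "u \<le> B" shows "u\<^sup>2 \<le> B\<^sup>2 + 2 * exp (- u)"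
proof (cases "0 \<le> u")
  case True
  then have "u\<^sup>2 \<le> B\<^sup>2" using assms by (intro power_mono) auto
  then show ?thesis by (simp add: add_increasing2)
next
  case False
  then have "1 + (- u) + (- u)\<^sup>2 / 2 \<le> exp (- u)" by (intro exp_lower_Taylor_quadratic) simp
  then have "u\<^sup>2 \<le> 2 * exp (- u)" using False by simp
  then show ?thesis by (simp add: add_increasing)
qed

text \<open>Integrability of the square is part of the claim. Away from 0 the rearrangement is
  bounded above, so its square is controlled by \<open>exp (- f s)\<close>; the trajectory bounds
  its integral over \<open>{\<tau>..1}\<close> uniformly in \<open>\<tau>\<close>. This bounds the
  truncated squares \<open>E B\<close>, and monotone convergence on the original interval removes
  the truncation.\<close>

lemma reverse_jensen_upper:
  assumes rj: "reverse_jensen \<psi> (\<lambda>u. exp (- u)) a b (exp \<eta>0 / (1 + \<eta>0))"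
    and \<eta>: "0 \<le> \<eta>0" "\<eta>0 < \<eta>" and mean: "integral {a..b} \<psi> = 0"
  shows "(\<lambda>x. (\<psi> x)\<^sup>2) absolutely_integrable_on {a..b}"
    "integral {a..b} (\<lambda>x. (\<psi> x)\<^sup>2) / (b - a) \<le> \<eta>\<^sup>2"
proof -
  define C where "C = exp \<eta>0 / (1 + \<eta>0)"
  let ?P = "\<lambda>u::real. exp (- u)"
  interpret reverse_jensen \<psi> ?P a b C using rj by (simp add: C_def)
  obtain f where "rearranged \<psi> ?P a b C f" using rearranged_exists by blast
  then interpret rearranged \<psi> ?P a b C f .
  have m0: "integral {0..1} f = 0" using equi_closed[of "\<lambda>x. x"] f_int mean by simp
  define \<rho> where "\<rho> = integral {0..1} (\<lambda>s. exp (- f s))"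
  have \<rho>: "\<rho> \<le> C" using full_ineq m0 by (simp add: \<rho>_def)
  define E where "E B u = (if u \<le> B then u\<^sup>2 else 0)" for B u :: real
  have Em: "E B \<in> borel_measurable borel" for B unfolding E_def[abs_def] by measurable
  have E\<psi>: "(\<lambda>x. E B (\<psi> x)) absolutely_integrable_on {a..b}" for B
  proof (rule set_integrable_compose_bound[where A = "B\<^sup>2" and B = 0 and D = 2 and P = ?P, OF int intP Em])
    show "\<bar>E B u\<bar> \<le> B\<^sup>2 + 0 * \<bar>u\<bar> + 2 * exp (- u)" for u
      using square_le_exp[of u B] by (auto simp: E_def)
  qed simp
  have Ef: "(\<lambda>x. E B (f x)) absolutely_integrable_on {0..1}" for B
    using equi_int_closed[OF Em] E\<psi> by simp
  have f2: "(\<lambda>s. (f s)\<^sup>2) integrable_on {\<tau>..1}" if \<tau>: "0 < \<tau>" "\<tau> < 1" for \<tau>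
  proof (rule integrable_spike_finite[where S = "{\<tau>, 1}" and f = "\<lambda>s. E (f \<tau>) (f s)"])
    show "(f s)\<^sup>2 = E (f \<tau>) (f s)" if "s \<in> {\<tau>..1} - {\<tau>, 1}" for s
      using f_ge[of \<tau> s] that \<tau> by (auto simp: E_def)
    show "(\<lambda>s. E (f \<tau>) (f s)) integrable_on {\<tau>..1}" using integrable_on_sub[OF Ef, of \<tau> 1] \<tau> by simp
  qed simp
  have step: "integral {\<tau>..1} (\<lambda>s. (f s)\<^sup>2) \<le> \<eta>\<^sup>2" if \<tau>: "0 < \<tau>" "\<tau> < 1" for \<tau>
  proof -
    have "(\<lambda>s. - (f s)\<^sup>2) integrable_on {\<tau>..1}" using f2[OF \<tau>] by (simp add: integrable_neg)
    from trajectory[OF bellman_candidate_upper[OF \<eta>, folded C_def] m0 \<tau> this]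
    obtain v where v: "v \<in> {mean_f \<tau> - \<eta>0..mean_f \<tau>}" and
      le: "\<forall>w\<in>{-\<eta>..0}. w\<^sup>2 + 2 * (1 + \<eta>) * (1 + w) + - (2 * (1 + \<eta>) * exp w) * \<rho>
         \<le> \<tau> * (v\<^sup>2 + 2 * (1 + \<eta>) * (1 + v) + - (2 * v + 2 * (1 + \<eta>)) * mean_f \<tau> + - (2 * (1 + \<eta>) * exp v) * mean_P \<tau>)
            + integral {\<tau>..1} (\<lambda>s. - (f s)\<^sup>2)" unfolding \<rho>_def by blast
    have "- \<eta> \<in> {-\<eta>..0}" using \<eta> by simp
    note 1 = le[rule_format, OF this]
    have 2: "v\<^sup>2 + 2 * (1 + \<eta>) * (1 + v) + - (2 * v + 2 * (1 + \<eta>)) * mean_f \<tau> + - (2 * (1 + \<eta>) * exp v) * mean_P \<tau>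
        = - Qfun \<eta> (mean_f \<tau>) (mean_P \<tau>) v" by (simp add: Qfun_def algebra_simps power2_eq_square)
    have "0 \<le> Qfun \<eta> (mean_f \<tau>) (mean_P \<tau>) v"
    proof -
      interpret bc: bellman_candidate ?P "\<lambda>u. - (u\<^sup>2)" "\<lambda>w. w\<^sup>2 + 2 * (1 + \<eta>) * (1 + w)"
        "\<lambda>w. - (2 * w + 2 * (1 + \<eta>))" "\<lambda>w. - (2 * (1 + \<eta>) * exp w)" "exp \<eta>0 / (1 + \<eta>0)" \<eta>0 \<eta>
        by (rule bellman_candidate_upper[OF \<eta>])
      obtain k where "\<And>u. exp (- mean_f \<tau>) + k * (u - mean_f \<tau>) \<le> exp (- u)" using bc.subgrad by blast
      then have "exp (- mean_f \<tau>) \<le> mean_P \<tau>" by (rule mean_P_ge) (use \<tau> in auto)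
      then have "(mean_f \<tau>)\<^sup>2 \<le> Qfun \<eta> (mean_f \<tau>) (mean_P \<tau>) v" using \<eta> v by (intro Qfun_ge) auto
      then show ?thesis using zero_le_power2 order_trans by blast
    qed
    then have 3: "\<tau> * - Qfun \<eta> (mean_f \<tau>) (mean_P \<tau>) v \<le> 0" using \<tau> by simp
    \<comment> \<open>With this bound the plane for \<open>w = - \<eta>\<close>, taken with the
      minus sign, has value at least \<open>- (\<eta>\<^sup>2)\<close> at the final point of the
      path.\<close>
    have "2 * (1 + \<eta>) * exp (- \<eta>) * \<rho> \<le> 2"
    proof -
      have "C \<le> exp \<eta> / (1 + \<eta>)"
      proof -
        have "(1 + \<eta>) \<le> (1 + \<eta>0) * exp (\<eta> - \<eta>0)"
        proof -
          have "1 + \<eta> \<le> (1 + \<eta>0) * (1 + (\<eta> - \<eta>0))" using \<eta> mult_nonneg_nonneg[of \<eta>0 "\<eta> - \<eta>0"] by (simp add: algebra_simps)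
          also have "\<dots> \<le> (1 + \<eta>0) * exp (\<eta> - \<eta>0)" using \<eta> by (intro mult_left_mono exp_ge_add_one_self) auto
          finally show ?thesis .
        qed
        then show ?thesis using \<eta> by (simp add: C_def exp_diff field_simps)
      qed
      then have "\<rho> \<le> exp \<eta> / (1 + \<eta>)" using \<rho> by simp
      then have "2 * (1 + \<eta>) * exp (- \<eta>) * \<rho> \<le> 2 * (1 + \<eta>) * exp (- \<eta>) * (exp \<eta> / (1 + \<eta>))"
        using \<eta> by (intro mult_left_mono) auto
      also have "\<dots> = 2 * (exp (- \<eta>) * exp \<eta>) * ((1 + \<eta>) / (1 + \<eta>))"
        by (simp only: times_divide_eq_right times_divide_eq_left mult_ac)
      also have "\<dots> = 2" using \<eta> by (simp flip: exp_add)
      finally show ?thesis .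
    qed
    then have "- (\<eta>\<^sup>2) \<le> (- \<eta>)\<^sup>2 + 2 * (1 + \<eta>) * (1 + - \<eta>) + - (2 * (1 + \<eta>) * exp (- \<eta>)) * \<rho>"
      by (simp add: algebra_simps power2_eq_square)
    then have "- (\<eta>\<^sup>2) \<le> integral {\<tau>..1} (\<lambda>s. - (f s)\<^sup>2)" using 1 3 unfolding 2 by linarith
    then show ?thesis by simp
  qed
  have E_le: "integral {0..1} (\<lambda>s. E B (f s)) \<le> \<eta>\<^sup>2" for B
  proof -
    have "continuous_on {0..1} (\<lambda>\<tau>. integral {\<tau>..1} (\<lambda>s. E B (f s)))"
      by (rule indefinite_integral_continuous_1') (use integrable_on_sub[OF Ef, of 0 1] in auto)
    then have "((\<lambda>\<tau>. integral {\<tau>..1} (\<lambda>s. E B (f s))) \<longlongrightarrow> integral {0..1} (\<lambda>s. E B (f s))) (at_right 0)"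
      by (rule continuous_on_Icc_at_rightD) simp
    moreover have "eventually (\<lambda>\<tau>. integral {\<tau>..1} (\<lambda>s. E B (f s)) \<le> \<eta>\<^sup>2) (at_right 0)"
      unfolding eventually_at_right_field
    proof (intro exI[of _ 1] conjI allI impI)
      fix \<tau> :: real assume \<tau>: "0 < \<tau>" "\<tau> < 1"
      have "integral {\<tau>..1} (\<lambda>s. E B (f s)) \<le> integral {\<tau>..1} (\<lambda>s. (f s)\<^sup>2)"
        by (rule integral_le) (use integrable_on_sub[OF Ef, of \<tau> 1] f2[OF \<tau>] \<tau> in \<open>auto simp: E_def\<close>)
      then show "integral {\<tau>..1} (\<lambda>s. E B (f s)) \<le> \<eta>\<^sup>2" using step[OF \<tau>] by simp
    qed simp
    ultimately show ?thesis by (rule tendsto_upperbound) simp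
  qed
  define g where "g n x = indicator {a..b} x *\<^sub>R E (real n) (\<psi> x)" for n :: nat and x
  define I where "I n = integral\<^sup>L lebesgue (g n)" for n
  have gi: "integrable lebesgue (g n)" for n using E\<psi>[of "real n"] by (simp add: set_integrable_def g_def[abs_def])
  have I_le: "I n \<le> (b - a) * \<eta>\<^sup>2" for n
  proof -
    have "I n = integral {a..b} (\<lambda>x. E (real n) (\<psi> x))"
      using set_lebesgue_integral_eq_integral(2)[OF E\<psi>[of "real n"]] by (simp add: I_def g_def[abs_def] set_lebesgue_integral_def)
    also have "\<dots> / (b - a) \<le> \<eta>\<^sup>2" using E_le[of "real n"] equi_closed[OF Em Ef, of "real n"] by simp
    finally show ?thesis using ab by (simp add: field_simps)
  qed
  have gm: "g n x \<le> g k x" if "n \<le> k" for n k x using that by (auto simp: g_def E_def indicator_def)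
  have "incseq I" unfolding I_def by (intro incseq_SucI integral_mono gi gm) simp
  then obtain l where l: "I \<longlonglongrightarrow> l" using incseq_convergent[of I "(b - a) * \<eta>\<^sup>2"] I_le by metis
  have l_le: "l \<le> (b - a) * \<eta>\<^sup>2" using l I_le by (intro LIMSEQ_le_const2[OF l]) auto
  let ?u = "\<lambda>x. indicator {a..b} x *\<^sub>R (\<psi> x)\<^sup>2"
  have conv: "(\<lambda>n. g n x) \<longlonglongrightarrow> ?u x" for x
  proof (rule tendsto_eventually)
    obtain N :: nat where "\<psi> x \<le> N" using real_arch_simple by blast
    then show "eventually (\<lambda>n. g n x = ?u x) sequentially"
      unfolding eventually_sequentially by (intro exI[of _ N]) (auto simp: g_def E_def)
  qed
  have um: "?u \<in> borel_measurable lebesgue"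
    using borel_measurable_indicator_compose[OF set_integrable_imp_set_borel_measurable[OF int], of "\<lambda>u. u\<^sup>2"]
    by (simp add: set_borel_measurable_def)
  have 1: "integrable lebesgue ?u"
    by (rule integrable_monotone_convergence[where f = g and x = l]) (use gi gm conv l[unfolded I_def[abs_def]] um in \<open>auto simp: mono_def\<close>)
  have 2: "integral\<^sup>L lebesgue ?u = l"
    by (rule integral_monotone_convergence[where f = g]) (use gi gm conv l[unfolded I_def[abs_def]] um in \<open>auto simp: mono_def\<close>)
  show 3: "(\<lambda>x. (\<psi> x)\<^sup>2) absolutely_integrable_on {a..b}" using 1 by (simp add: set_integrable_def)
  show "integral {a..b} (\<lambda>x. (\<psi> x)\<^sup>2) / (b - a) \<le> \<eta>\<^sup>2"
    using set_lebesgue_integral_eq_integral(2)[OF 3] 2 l_le ab by (simp add: set_lebesgue_integral_def field_simps)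
qed

section \<open>The two roots\<close>

lemma exp_div_strict_mono:
  fixes x y :: real assumes "0 \<le> x" "x < y" "y < 1" shows "exp (- x) / (1 - x) < exp (- y) / (1 - y)"
proof (rule DERIV_pos_imp_increasing_open[OF assms(2), where f = "\<lambda>x. exp (- x) / (1 - x)"])
  fix t assume t: "x < t" "t < y"
  have "((\<lambda>x. exp (- x) / (1 - x)) has_real_derivative exp (- t) * t / (1 - t)\<^sup>2) (at t)"
    using t assms by (auto intro!: derivative_eq_intros simp: field_simps power2_eq_square)
  moreover have "0 < exp (- t) * t / (1 - t)\<^sup>2" using t assms by simp
  ultimately show "\<exists>d. ((\<lambda>x. exp (- x) / (1 - x)) has_real_derivative d) (at t) \<and> 0 < d" by blast
qed (use assms in \<open>auto intro!: continuous_intros\<close>)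

lemma exp_div_strict_mono':
  fixes x y :: real assumes "0 \<le> x" "x < y" shows "exp x / (1 + x) < exp y / (1 + y)"
proof (rule DERIV_pos_imp_increasing_open[OF assms(2), where f = "\<lambda>x. exp x / (1 + x)"])
  fix t assume t: "x < t" "t < y"
  have "((\<lambda>x. exp x / (1 + x)) has_real_derivative exp t * t / (1 + t)\<^sup>2) (at t)"
    using t assms by (auto intro!: derivative_eq_intros simp: field_simps power2_eq_square)
  moreover have "0 < exp t * t / (1 + t)\<^sup>2" using t assms by simp
  ultimately show "\<exists>d. ((\<lambda>x. exp x / (1 + x)) has_real_derivative d) (at t) \<and> 0 < d" by blast
qed (use assms in \<open>auto intro!: continuous_intros\<close>)

lemma xi_plus_props:
  assumes "1 \<le> C" shows "0 \<le> xi_plus C" "xi_plus C < 1" "C = exp (- xi_plus C) / (1 - xi_plus C)"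
proof -
  have "\<exists>!\<xi>. 0 \<le> \<xi> \<and> \<xi> < 1 \<and> exp (- \<xi>) = C * (1 - \<xi>)"
  proof (rule ex_ex1I)
    define f where "f \<xi> = exp (- \<xi>) - C * (1 - \<xi>)" for \<xi>
    \<comment> \<open>Chosen so that \<open>C * (1 - z) = exp (- 1)\<close>, which is at most
      \<open>exp (- z)\<close>.\<close>
    define z where "z = 1 - exp (- 1) / C"
    have "exp (- 1) \<le> (1::real)" by simp
    then have "exp (- 1) \<le> C" using assms by linarith
    then have z: "0 \<le> z" "z < 1" using assms by (auto simp: z_def field_simps)
    have "f 0 \<le> 0" using assms by (simp add: f_def)
    moreover have "0 \<le> f z"
    proof -
      have "exp (- 1) \<le> exp (- z)" using z by simp
      then show ?thesis using assms by (simp add: f_def z_def)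
    qed
    moreover have "continuous_on {0..z} f" unfolding f_def[abs_def] by (intro continuous_intros)
    ultimately obtain \<xi> where "0 \<le> \<xi>" "\<xi> \<le> z" "f \<xi> = 0" using IVT'[of f 0 0 z] z by auto
    then show "\<exists>\<xi>. 0 \<le> \<xi> \<and> \<xi> < 1 \<and> exp (- \<xi>) = C * (1 - \<xi>)"
      using z by (intro exI[of _ \<xi>]) (auto simp: f_def)
    fix x y assume x: "0 \<le> x \<and> x < 1 \<and> exp (- x) = C * (1 - x)" and y: "0 \<le> y \<and> y < 1 \<and> exp (- y) = C * (1 - y)"
    then have "exp (- x) / (1 - x) = exp (- y) / (1 - y)" by simp
    then show "x = y" using exp_div_strict_mono[of x y] exp_div_strict_mono[of y x] x y
      by (metis less_irrefl not_less_iff_gr_or_eq)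
  qed
  from theI'[OF this] have "0 \<le> xi_plus C \<and> xi_plus C < 1 \<and> exp (- xi_plus C) = C * (1 - xi_plus C)"
    unfolding xi_plus_def .
  then show "0 \<le> xi_plus C" "xi_plus C < 1" "C = exp (- xi_plus C) / (1 - xi_plus C)"
    by (auto simp: field_simps)
qed

lemma xi_minus_props:
  assumes "1 \<le> C" shows "xi_minus C \<le> 0" "C = exp (- xi_minus C) / (1 - xi_minus C)"
proof -
  have "\<exists>!\<xi>. \<xi> \<le> 0 \<and> exp (- \<xi>) = C * (1 - \<xi>)"
  proof (rule ex_ex1I)
    define f where "f \<eta> = exp \<eta> - C * (1 + \<eta>)" for \<eta>
    \<comment> \<open>Large enough for the quadratic Taylor polynomial of the exponential to exceed
      \<open>C * (1 + z)\<close>.\<close>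
    define z where "z = 2 * C"
    have z: "0 \<le> z" using assms by (auto simp: z_def)
    have "f 0 \<le> 0" using assms by (simp add: f_def)
    moreover have "0 \<le> f z"
    proof -
      have "1 + z + z\<^sup>2 / 2 \<le> exp z" using z by (rule exp_lower_Taylor_quadratic)
      moreover have "C * (1 + z) \<le> 1 + z + z\<^sup>2 / 2" using assms by (simp add: z_def power2_eq_square algebra_simps)
      ultimately show ?thesis by (simp add: f_def)
    qed
    moreover have "continuous_on {0..z} f" unfolding f_def[abs_def] by (intro continuous_intros)
    ultimately obtain \<eta> where "0 \<le> \<eta>" "\<eta> \<le> z" "f \<eta> = 0" using IVT'[of f 0 0 z] z by auto
    then show "\<exists>\<xi>. \<xi> \<le> 0 \<and> exp (- \<xi>) = C * (1 - \<xi>)" by (intro exI[of _ "- \<eta>"]) (auto simp: f_def)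
    fix x y assume x: "x \<le> 0 \<and> exp (- x) = C * (1 - x)" and y: "y \<le> 0 \<and> exp (- y) = C * (1 - y)"
    then have "exp (- x) / (1 - x) = C" "exp (- y) / (1 - y) = C" by (auto simp: nonzero_divide_eq_eq)
    then have "exp (- x) / (1 - x) = exp (- y) / (1 - y)" by simp
    then show "x = y" using exp_div_strict_mono'[of "- x" "- y"] exp_div_strict_mono'[of "- y" "- x"] x y
      by (cases x y rule: linorder_cases) auto
  qed
  from theI'[OF this] have "xi_minus C \<le> 0 \<and> exp (- xi_minus C) = C * (1 - xi_minus C)"
    unfolding xi_minus_def .
  then show "xi_minus C \<le> 0" "C = exp (- xi_minus C) / (1 - xi_minus C)"
    by (auto simp: field_simps)
qed

lemma xi_plus_ge:
  assumes "1 \<le> C" "0 \<le> x" "x < 1" "exp (- x) / (1 - x) \<le> C" shows "x \<le> xi_plus C"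
proof (rule ccontr)
  assume "\<not> x \<le> xi_plus C"
  then have "exp (- xi_plus C) / (1 - xi_plus C) < exp (- x) / (1 - x)"
    using xi_plus_props[OF assms(1)] assms by (intro exp_div_strict_mono) auto
  then show False using xi_plus_props(3)[OF assms(1)] assms(4) by linarith
qed

lemma xi_plus_pos: assumes "1 < C" shows "0 < xi_plus C"
proof (rule ccontr)
  assume "\<not> 0 < xi_plus C"
  then have "xi_plus C = 0" using xi_plus_props(1)[of C] assms by simp
  then show False using xi_plus_props(3)[of C] assms by simp
qed

lemma xi_minus_neg: assumes "1 < C" shows "xi_minus C < 0"
proof (rule ccontr)
  assume "\<not> xi_minus C < 0"
  then have "xi_minus C = 0" using xi_minus_props(1)[of C] assms by simp
  then show False using xi_minus_props(2)[of C] assms by simp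
qed

section \<open>The lower bound for the mean absolute deviation\<close>

text \<open>With \<open>s = xi_plus C\<close> and \<open>r = - xi_minus C\<close>, the numbers
  \<open>al\<close> and \<open>k\<close> solve \<open>al + k / (1 - s) = 1\<close> and
  \<open>al + k / (1 + r) = - 1\<close>. Then \<open>LL u \<le> \<bar>u\<bar>\<close> between
  \<open>- r\<close> and \<open>s\<close>. Values above \<open>s\<close> are absorbed into an
  initial interval on which the mean is exactly \<open>s\<close>, values below \<open>- r\<close>
  into a final interval of mean exactly \<open>- r\<close>. There the inequality for the integrals
  follows from the inherited ones, because \<open>C * exp s = 1 / (1 - s)\<close> and
  \<open>C * exp (- r) = 1 / (1 + r)\<close>. As \<open>f\<close> has mean 0, the total integral of
  \<open>LL (f t)\<close> is \<open>k * (\<rho> - 1)\<close>.\<close>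

lemma reverse_jensen_lower_one:
  assumes rj: "reverse_jensen \<psi> exp a b C" and C: "1 < C"
    and mean: "integral {a..b} \<psi> = 0"
  shows "2 * ((1 - xi_minus C) * (1 - xi_plus C) / (xi_plus C - xi_minus C)) *
      (integral {a..b} (\<lambda>x. exp (\<psi> x)) / (b - a) - 1) \<le> integral {a..b} (\<lambda>x. \<bar>\<psi> x\<bar>) / (b - a)"
proof -
  interpret reverse_jensen \<psi> exp a b C by (rule rj)
  obtain f where "rearranged \<psi> exp a b C f" using rearranged_exists by blast
  then interpret rearranged \<psi> exp a b C f .
  define s where "s = xi_plus C"
  define r where "r = - xi_minus C"
  have s: "0 < s" "s < 1" "C * exp s = 1 / (1 - s)"
  proof -
    have "C = exp (- s) / (1 - s)" using xi_plus_props(3)[of C] C by (simp only: s_def less_imp_le)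
    from arg_cong[OF this, of "\<lambda>x. x * exp s"]
    have "C * exp s = exp (- s) * exp s / (1 - s)" by simp
    also have "exp (- s) * exp s = 1" by (simp flip: exp_add)
    finally show "C * exp s = 1 / (1 - s)" .
  qed (use xi_plus_props(2)[of C] xi_plus_pos C in \<open>auto simp: s_def\<close>)
  have r: "0 < r" "C * exp (- r) = 1 / (1 + r)"
  proof -
    have "C = exp r / (1 + r)" using xi_minus_props(2)[of C] C by (simp only: r_def less_imp_le diff_conv_add_uminus)
    from arg_cong[OF this, of "\<lambda>x. x * exp (- r)"]
    have "C * exp (- r) = exp r * exp (- r) / (1 + r)" by simp
    also have "exp r * exp (- r) = 1" by (simp flip: exp_add)
    finally show "C * exp (- r) = 1 / (1 + r)" .
  qed (use xi_minus_neg[OF C] in \<open>auto simp: r_def\<close>)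
  define k where "k = 2 * ((1 + r) * (1 - s) / (s + r))"
  define al where "al = 1 - k / (1 - s)"
  have k0: "0 < k" using r s by (simp add: k_def)
  have al2: "al + k / (1 + r) = - 1"
  proof -
    have "k / (1 - s) = 2 * (1 + r) / (s + r)" "k / (1 + r) = 2 * (1 - s) / (s + r)"
      using r s by (auto simp: k_def)
    then have "al + k / (1 + r) = 1 - (2 * (1 + r) / (s + r) - 2 * (1 - s) / (s + r))" unfolding al_def by linarith
    also have "\<dots> = 1 - (2 * (1 + r) - 2 * (1 - s)) / (s + r)" by (simp only: diff_divide_distrib)
    also have "(2 * (1 + r) - 2 * (1 - s)) / (s + r) = 2" using r s by (simp add: field_simps)
    finally show ?thesis by simp
  qed
  define LL where "LL u = al * u + k * (exp u - 1)" for u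
  have m0: "integral {0..1} f = 0" using equi_closed[of "\<lambda>x. x"] f_int mean by simp
  define \<rho> where "\<rho> = integral {0..1} (\<lambda>s. exp (f s))"
  have \<rho>: "\<rho> = integral {a..b} (\<lambda>x. exp (\<psi> x)) / (b - a)"
    unfolding \<rho>_def by (rule equi_closed[OF _ Pf_int]) simp
  have \<rho>C: "\<rho> \<le> C" using full_ineq m0 by (simp add: \<rho>_def)
  have fa: "(\<lambda>t. \<bar>f t\<bar>) absolutely_integrable_on {0..1}" using f_int by (rule set_integrable_abs)
  have aI: "integral {0..1} (\<lambda>t. \<bar>f t\<bar>) = integral {a..b} (\<lambda>x. \<bar>\<psi> x\<bar>) / (b - a)"
    using equi_closed[of "\<lambda>u. \<bar>u\<bar>"] fa by simp
  have LLi: "(\<lambda>t. LL (f t)) absolutely_integrable_on {0..1}"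
    unfolding LL_def by (intro set_integral_add set_integral_diff set_integrable_mult_right f_int Pf_int const_int)
  have LLI: "integral {x..y} (\<lambda>t. LL (f t)) = al * integral {x..y} f + k * (integral {x..y} (\<lambda>t. exp (f t)) - (y - x))"
    if "0 \<le> x" "x \<le> y" "y \<le> 1" for x y
  proof (rule integral_unique)
    have "((\<lambda>t. 1) has_integral (y - x)) {x..y}" using has_integral_const_real[of "1::real" x y] that by simp
    then show "((\<lambda>t. LL (f t)) has_integral al * integral {x..y} f + k * (integral {x..y} (\<lambda>t. exp (f t)) - (y - x))) {x..y}"
      unfolding LL_def using integrable_on_sub[OF f_int that(1,3)] integrable_on_sub[OF Pf_int that(1,3)]
      by (intro has_integral_add has_integral_mult_right has_integral_diff integrable_integral) auto
  qed
  have mid: "LL u \<le> \<bar>u\<bar>" if "- r \<le> u" "u \<le> s" for u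
  proof (cases "0 \<le> u")
    case True
    have "exp u \<le> 1 / (1 - u)"
      using exp_ge_add_one_self[of "- u"] that s by (simp add: exp_minus field_simps)
    also have "1 / (1 - u) = 1 + u / (1 - u)" using that s by (simp add: field_simps)
    also have "u / (1 - u) \<le> u / (1 - s)" using that s True by (intro divide_left_mono) auto
    finally have "k * (exp u - 1) \<le> k * (u / (1 - s))" using k0 by (intro mult_left_mono) auto
    then show ?thesis using True by (simp add: LL_def al_def algebra_simps)
  next
    case False
    define d where "d = - u"
    have d: "0 < d" "d \<le> r" using False that by (auto simp: d_def)
    have "exp (- d) \<le> 1 / (1 + d)"
      using exp_ge_add_one_self[of d] d by (simp add: exp_minus field_simps)
    also have "1 / (1 + d) = 1 - d / (1 + d)" using d by (simp add: field_simps)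
    also have "\<dots> \<le> 1 - d / (1 + r)" using d by (intro diff_mono divide_left_mono) auto
    finally have "k * (exp (- d) - 1) \<le> k * (- (d / (1 + r)))" using k0 by (intro mult_left_mono) auto
    then have "LL u \<le> - d * (al + k / (1 + r))" by (simp add: LL_def d_def algebra_simps)
    then show ?thesis using d unfolding al2 by (simp add: d_def)
  qed
  have abs_ge: "\<bar>integral {x..y} f\<bar> \<le> integral {x..y} (\<lambda>t. \<bar>f t\<bar>)" if "0 \<le> x" "y \<le> 1" for x y
    using integral_norm_bound_integral[OF integrable_on_sub[OF f_int that] integrable_on_sub[OF fa that]] by simp
  \<comment> \<open>\<open>t1\<close> is where the mean over the initial interval has come down to
    \<open>s\<close>; beyond it \<open>f\<close> is at most that mean. If \<open>f\<close> never
    exceeds \<open>s\<close>, the interval is empty and \<open>t1 = 0\<close>.\<close>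
  have "\<exists>t1. 0 \<le> t1 \<and> t1 < 1 \<and> integral {0..t1} f = t1 * s \<and> (\<forall>t. t1 < t \<and> t < 1 \<longrightarrow> f t \<le> s)"
  proof (cases "\<forall>t. 0 < t \<and> t < 1 \<longrightarrow> f t \<le> s")
    case True
    then show ?thesis by (intro exI[of _ 0]) auto
  next
    case False
    then obtain t where t: "0 < t" "t < 1" "s < f t" by (auto simp: not_le)
    have "s \<le> mean_f t" using f_le_mean[OF t(1,2)] t by simp
    moreover have "mean_f 1 \<le> s" using m0 s by (simp add: mean_f_def)
    moreover have "continuous_on {t..1} mean_f" by (rule mean_f_continuous[OF t(1)])
    ultimately obtain t1 where t1: "t \<le> t1" "t1 \<le> 1" "mean_f t1 = s" using IVT2'[of mean_f 1 s t] t by auto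
    have "t1 \<noteq> 1" using t1 m0 s by (auto simp: mean_f_def)
    then have t1': "0 < t1" "t1 < 1" using t t1 by auto
    have "f u \<le> s" if "t1 < u" "u < 1" for u
      using f_ge[of t1 u] f_le_mean[of t1] t1 t1' that by simp
    moreover have "integral {0..t1} f = t1 * s" using t1 t1' by (simp add: mean_f_def field_simps)
    ultimately show ?thesis using t1' by (intro exI[of _ t1]) auto
  qed
  then obtain t1 where t1: "0 \<le> t1" "t1 < 1" "integral {0..t1} f = t1 * s" "\<And>t. t1 < t \<Longrightarrow> t < 1 \<Longrightarrow> f t \<le> s" by blast
  have tail1: "integral {t1..1} f = - t1 * s" using integral_split[OF f_int, of t1 1] t1 m0 by simp
  have main: "k * (\<rho> - 1) \<le> integral {0..1} (\<lambda>t. \<bar>f t\<bar>)"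
  \<comment> \<open>In the first case there may be no room for the final interval. But then
    \<open>\<bar>f t\<bar>\<close> already has integral at least \<open>2 * t1 * s\<close>, and
    \<open>t1 \<ge> r / (s + r)\<close>. Writing 0 as a convex combination of \<open>s\<close> and
    \<open>- r\<close> shows that \<open>k * (C - 1)\<close> is at most
    \<open>2 * s * r / (s + r)\<close>.\<close>
  proof (cases "(1 - t1) * r \<le> t1 * s")
    case True
    have "\<bar>t1 * s\<bar> + \<bar>- t1 * s\<bar> \<le> integral {0..t1} (\<lambda>t. \<bar>f t\<bar>) + integral {t1..1} (\<lambda>t. \<bar>f t\<bar>)"
      using abs_ge[of 0 t1] abs_ge[of t1 1] t1 tail1 by (intro add_mono) auto
    then have ge: "2 * t1 * s \<le> integral {0..1} (\<lambda>t. \<bar>f t\<bar>)"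
      using integral_split[OF fa, of t1 1] t1 s by (simp add: abs_mult mult_ac)
    define th where "th = r / (s + r)"
    have th: "0 \<le> th" "th \<le> 1" "1 - th = s / (s + r)" using r s by (auto simp: th_def field_simps)
    have "C * exp (th * s + (1 - th) * (- r)) \<le> C * (th * exp s + (1 - th) * exp (- r))"
      using convex_onD[OF exp_convex, of "1 - th" s "- r"] th(1,2) C by (intro mult_left_mono) auto
    also have "th * s + (1 - th) * (- r) = 0" unfolding th(3) by (simp add: th_def)
    finally have "C \<le> th * (C * exp s) + (1 - th) * (C * exp (- r))" by (simp add: algebra_simps)
    also have "\<dots> = th * (1 / (1 - s)) + (1 - th) * (1 / (1 + r))" using s r by simp
    finally have "C - 1 \<le> th * (s / (1 - s)) - (1 - th) * (r / (1 + r))"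
    proof -
      have "s / (1 - s) = 1 / (1 - s) - 1" "r / (1 + r) = 1 - 1 / (1 + r)" using s r by (auto simp: field_simps)
      moreover assume "C \<le> th * (1 / (1 - s)) + (1 - th) * (1 / (1 + r))"
      ultimately show ?thesis by (simp only: right_diff_distrib) simp
    qed
    also have "\<dots> = s * r / (s + r) * (1 / (1 - s) - 1 / (1 + r))"
      unfolding th(3) unfolding th_def by (simp add: algebra_simps)
    also have "\<dots> = s * r / (s + r) * (2 / k)"
    proof -
      have "1 / (1 - s) - 1 / (1 + r) = (s + r) / ((1 + r) * (1 - s))" using s(1,2) r(1) by (simp add: field_simps)
      moreover have "2 / k = (s + r) / ((1 + r) * (1 - s))"
      proof -
        have "k * (s + r) = 2 * ((1 + r) * (1 - s))" using s(1,2) r(1) by (simp add: k_def)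
        then show ?thesis using k0 s(1,2) r(1) by (simp add: frac_eq_eq mult.commute)
      qed
      ultimately show ?thesis by simp
    qed
    finally have "k * (C - 1) \<le> k * (s * r / (s + r) * (2 / k))" using k0 by (intro mult_left_mono) auto
    also have "\<dots> = 2 * s * r / (s + r)" using k0 by simp
    also have "\<dots> \<le> 2 * t1 * s"
    proof -
      have "r \<le> t1 * (s + r)" using True by (simp add: algebra_simps)
      then have "r * (2 * s) \<le> t1 * (s + r) * (2 * s)" using s by (intro mult_right_mono) auto
      then show ?thesis using s r by (simp add: pos_divide_le_eq algebra_simps)
    qed
    finally have "k * (C - 1) \<le> integral {0..1} (\<lambda>t. \<bar>f t\<bar>)" using ge by simp
    moreover have "k * (\<rho> - 1) \<le> k * (C - 1)" using \<rho>C k0 by (intro mult_left_mono) auto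
    ultimately show ?thesis by simp
  next
    case False
    \<comment> \<open>The mirror image of the choice of \<open>t1\<close>, with
      \<open>t2 = 1\<close> if no value falls below \<open>- r\<close>. The excluded case says that
      the mean over \<open>{t1..1}\<close> is above \<open>- r\<close>; therefore \<open>t2\<close>
      is found to the right of \<open>t1\<close>.\<close>
    have "\<exists>t2. t1 \<le> t2 \<and> t2 \<le> 1 \<and> integral {t2..1} f = (1 - t2) * (- r) \<and> (\<forall>t. t1 < t \<and> t < t2 \<longrightarrow> - r \<le> f t) \<and> (t2 < 1 \<longrightarrow> 0 < t2)"
    proof (cases "\<forall>t. t1 < t \<and> t < 1 \<longrightarrow> - r \<le> f t")
      case True
      then show ?thesis using t1 by (intro exI[of _ 1]) auto
    next
      case nn: False
      then obtain t where t: "t1 < t" "t < 1" "f t < - r" by (auto simp: not_le)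
      define G where "G u = integral {u..1} f / (1 - u)" for u
      have Gle: "G u \<le> f u" if "0 < u" "u < 1" for u
      proof -
        have "integral {u..1} f \<le> integral {u..1} (\<lambda>_. f u)"
          by (rule integral_le_open) (use that integrable_on_sub[OF f_int, of u 1] f_ge in auto)
        then show ?thesis using that by (simp add: G_def field_simps)
      qed
      have "G t \<le> - r" using Gle[of t] t t1 by simp
      moreover have "- r \<le> G t1" using False t1 tail1 by (simp add: G_def field_simps)
      moreover have "continuous_on {t1..t} G"
      proof -
        have "continuous_on {0..1} (\<lambda>\<tau>. integral {\<tau>..1} f)"
          by (rule indefinite_integral_continuous_1') (use integrable_on_sub[OF f_int, of 0 1] in auto)
        then have "continuous_on {t1..t} (\<lambda>\<tau>. integral {\<tau>..1} f)"
          by (rule continuous_on_subset) (use t t1 in auto)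
        then show ?thesis unfolding G_def[abs_def] by (intro continuous_intros) (use t in auto)
      qed
      ultimately obtain t2 where t2: "t1 \<le> t2" "t2 \<le> t" "G t2 = - r" using IVT2'[of G t "- r" t1] t by auto
      have "t1 \<noteq> t2"
      proof
        assume "t1 = t2"
        then have "integral {t1..1} f = (1 - t1) * (- r)" using t2(3) t1 by (simp add: G_def field_simps)
        then show False using tail1 False by simp
      qed
      then have t2': "0 < t2" "t2 < 1" using t t1 t2 by auto
      have "- r \<le> f u" if "t1 < u" "u < t2" for u
        using Gle[of t2] t2 t2' f_ge[of u t2] that t1 by simp
      moreover have "integral {t2..1} f = (1 - t2) * (- r)" using t2(3) t2' by (simp add: G_def field_simps)
      ultimately show ?thesis using t2' t2 by (intro exI[of _ t2]) auto
    qed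
    then obtain t2 where t2: "t1 \<le> t2" "t2 \<le> 1" "integral {t2..1} f = (1 - t2) * (- r)"
      "\<And>t. t1 < t \<Longrightarrow> t < t2 \<Longrightarrow> - r \<le> f t" "t2 < 1 \<Longrightarrow> 0 < t2" by blast
    have A: "integral {0..t1} (\<lambda>t. LL (f t)) \<le> integral {0..t1} (\<lambda>t. \<bar>f t\<bar>)"
    proof (cases "t1 = 0")
      case False
      then have t10: "0 < t1" using t1 by simp
      have "integral {0..t1} (\<lambda>t. exp (f t)) \<le> C * t1 * exp (integral {0..t1} f / t1)"
        using head_ineq[OF t10] t1 by simp
      also have "integral {0..t1} f / t1 = s" using t1(3) t10 by simp
      also have "C * t1 * exp s = t1 * (1 / (1 - s))" unfolding s(3)[symmetric] by simp
      finally have "integral {0..t1} (\<lambda>t. LL (f t)) \<le> al * (t1 * s) + k * (t1 * (1 / (1 - s)) - t1)"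
        using LLI[of 0 t1] t1 k0 by simp
      also have "\<dots> = t1 * s"
      proof -
        have "t1 * (1 / (1 - s)) - t1 = t1 * (s / (1 - s))" using s by (simp add: field_simps)
        then show ?thesis by (simp add: al_def algebra_simps)
      qed
      also have "\<dots> \<le> integral {0..t1} (\<lambda>t. \<bar>f t\<bar>)" using abs_ge[of 0 t1] t1 by simp
      finally show ?thesis .
    qed simp
    have B: "integral {t2..1} (\<lambda>t. LL (f t)) \<le> integral {t2..1} (\<lambda>t. \<bar>f t\<bar>)"
    proof (cases "t2 = 1")
      case False
      then have t20: "0 < t2" "t2 < 1" using t2 by auto
      have "integral {t2..1} (\<lambda>t. exp (f t)) \<le> C * (1 - t2) * exp (integral {t2..1} f / (1 - t2))"
        by (rule tail_ineq[OF t20])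
      also have "integral {t2..1} f / (1 - t2) = - r" using t2(3) t20 by simp
      also have "C * (1 - t2) * exp (- r) = (1 - t2) * (1 / (1 + r))" unfolding r(2)[symmetric] by simp
      finally have "integral {t2..1} (\<lambda>t. LL (f t)) \<le> al * ((1 - t2) * (- r)) + k * ((1 - t2) * (1 / (1 + r)) - (1 - t2))"
        using LLI[of t2 1] t2 t20 k0 by simp
      also have "\<dots> = - ((1 - t2) * r) * (al + k / (1 + r))"
      proof -
        have "(1 - t2) * (1 / (1 + r)) - (1 - t2) = - (1 - t2) * (r / (1 + r))" using r by (simp add: field_simps)
        then show ?thesis by (simp add: algebra_simps)
      qed
      also have "\<dots> = (1 - t2) * r" unfolding al2 by simp
      also have "\<dots> \<le> integral {t2..1} (\<lambda>t. \<bar>f t\<bar>)"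
        using abs_ge[of t2 1] t2 t20 r by (simp add: abs_mult)
      finally show ?thesis .
    qed simp
    have M: "integral {t1..t2} (\<lambda>t. LL (f t)) \<le> integral {t1..t2} (\<lambda>t. \<bar>f t\<bar>)"
      by (rule integral_le_open)
        (use integrable_on_sub[OF LLi, of t1 t2] integrable_on_sub[OF fa, of t1 t2] t1 t2 in \<open>auto intro!: mid\<close>)
    have "k * (\<rho> - 1) = integral {0..1} (\<lambda>t. LL (f t))" using LLI[of 0 1] m0 by (simp add: \<rho>_def)
    also have "\<dots> = integral {0..t1} (\<lambda>t. LL (f t)) + integral {t1..t2} (\<lambda>t. LL (f t)) + integral {t2..1} (\<lambda>t. LL (f t))"
      using integral_split[OF LLi, of t2 1] integral_split[OF LLi, of t1 t2] t1 t2 by simp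
    also have "\<dots> \<le> integral {0..t1} (\<lambda>t. \<bar>f t\<bar>) + integral {t1..t2} (\<lambda>t. \<bar>f t\<bar>) + integral {t2..1} (\<lambda>t. \<bar>f t\<bar>)"
      using A B M by simp
    also have "\<dots> = integral {0..1} (\<lambda>t. \<bar>f t\<bar>)"
      using integral_split[OF fa, of t2 1] integral_split[OF fa, of t1 t2] t1 t2 by simp
    finally show ?thesis .
  qed
  then show ?thesis unfolding \<rho> aI by (simp add: k_def r_def s_def)
qed

section \<open>Weights on arbitrary intervals\<close>

lemma finite_interval_endpoints:
  assumes "finite_interval J"
  obtains a b where "a < b" "{a<..<b} \<subseteq> J" "J \<subseteq> {a..b}"
proof -
  define a b where "a = Inf J" and "b = Sup J"
  have J: "is_interval J" "bounded J" "interior J \<noteq> {}" using assms by (auto simp: finite_interval_def)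
  then have ne: "J \<noteq> {}" using interior_subset by blast
  have bdd: "bdd_below J" "bdd_above J" using J(2) by (auto simp: bounded_imp_bdd_below bounded_imp_bdd_above)
  have sub: "J \<subseteq> {a..b}" using cInf_lower[OF _ bdd(1)] cSup_upper[OF _ bdd(2)] by (auto simp: a_def b_def)
  have in_J: "{a<..<b} \<subseteq> J"
  proof
    fix x assume "x \<in> {a<..<b}"
    then obtain y z where "y \<in> J" "y < x" "z \<in> J" "x < z"
      using cInf_less_iff[OF ne bdd(1), of x] less_cSup_iff[OF ne bdd(2), of x]
      unfolding a_def b_def greaterThanLessThan_iff by metis
    then show "x \<in> J" using J(1) unfolding is_interval_1 by (meson less_imp_le)
  qed
  have "a < b"
  proof (rule ccontr)
    assume "\<not> a < b"
    then have "J \<subseteq> {a}" using sub by auto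
    then have "interior J \<subseteq> interior {a}" by (rule interior_mono)
    then show False using J(3) by simp
  qed
  then show ?thesis using that in_J sub by blast
qed

lemma open_interval_in_subintervals:
  "a < b \<Longrightarrow> {a<..<b} \<subseteq> Q \<Longrightarrow> {a<..<b::real} \<in> subintervals Q"
  by (auto simp: subintervals_def finite_interval_def is_interval_1)

text \<open>\<open>J\<close> and \<open>{a..b}\<close> differ at most in the two endpoints, so
  averages over intervals of any kind are computed on compact ones.\<close>

locale interval_endpoints =
  fixes J :: "real set" and a b :: real
  assumes ab: "a < b" and J: "{a<..<b} \<subseteq> J" "J \<subseteq> {a..b}"
begin

lemma null: "negligible (S - T)" if "S \<subseteq> {a..b}" "{a<..<b} \<subseteq> T"
proof (rule negligible_subset[of "{a, b}"])
  show "S - T \<subseteq> {a, b}" using that by force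
qed simp

lemma sets_J[simp]: "J \<in> sets lebesgue"
proof -
  have "J = {a<..<b} \<union> (J - {a<..<b})" using J by blast
  moreover have "J - {a<..<b} \<in> sets lebesgue"
    using null[of J "{a<..<b}"] J by (simp add: negligible_imp_sets)
  ultimately show ?thesis by (metis sets.Un lmeasurable_interval(2) fmeasurableD box_real(1))
qed

lemma AE_J: "AE x in lebesgue. x \<in> J \<longleftrightarrow> x \<in> {a..b}"
proof (rule AE_I'[of "{a, b}"])
  show "{a, b} \<in> null_sets lebesgue" using negligible_iff_null_sets by blast
  show "{x \<in> space lebesgue. \<not> (x \<in> J \<longleftrightarrow> x \<in> {a..b})} \<subseteq> {a, b}" using J by force
qed

lemma emeasure_J[simp]: "emeasure lebesgue J = ennreal (b - a)"
proof -
  have "emeasure lebesgue J = emeasure lebesgue {a..b}" by (rule emeasure_eq_AE[OF AE_J]) auto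
  then show ?thesis using ab by simp
qed

lemma measure_J[simp]: "measure lebesgue J = b - a"
  using ab by (simp add: measure_def)

lemma set_integrable_J: "set_integrable lebesgue J f \<longleftrightarrow> f absolutely_integrable_on {a..b}" for f :: "real \<Rightarrow> real"
proof -
  have 1: "negligible {x \<in> {a..b} - J. f x \<noteq> 0}"
    by (rule negligible_subset[OF null[of "{a..b}" J]]) (use J in auto)
  have "{x \<in> J - {a..b}. f x \<noteq> 0} = {}" using J(2) by blast
  then have 2: "negligible {x \<in> J - {a..b}. f x \<noteq> 0}" by (metis negligible_empty)
  show ?thesis using absolutely_integrable_spike_set[OF _ 1 2] absolutely_integrable_spike_set[OF _ 2 1] by blast
qed

lemma set_integral_J: "(LINT x:J|lebesgue. f x) = (LINT x:{a..b}|lebesgue. f x)"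
  if "f absolutely_integrable_on {a..b}" for f :: "real \<Rightarrow> real"
  unfolding set_lebesgue_integral_def
proof (rule integral_cong_AE)
  show "(\<lambda>x. indicat_real J x *\<^sub>R f x) \<in> borel_measurable lebesgue"
    using that[folded set_integrable_J] by (auto simp: set_integrable_def)
  show "(\<lambda>x. indicat_real {a..b} x *\<^sub>R f x) \<in> borel_measurable lebesgue"
    using that by (auto simp: set_integrable_def)
  show "AE x in lebesgue. indicat_real J x *\<^sub>R f x = indicat_real {a..b} x *\<^sub>R f x"
    using AE_J by eventually_elim (auto simp: indicator_def)
qed

lemma avg_J: "avg J f = integral {a..b} f / (b - a)" if "f absolutely_integrable_on {a..b}"
  using set_integral_J[OF that] set_lebesgue_integral_eq_integral(2)[OF that] by (simp add: avg_def)

lemma nn_avg_J: "nn_avg J f = (\<integral>\<^sup>+x\<in>{a..b}. ennreal (f x) \<partial>lebesgue) / ennreal (b - a)"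
proof -
  have "(\<integral>\<^sup>+x\<in>J. ennreal (f x) \<partial>lebesgue) = (\<integral>\<^sup>+x\<in>{a..b}. ennreal (f x) \<partial>lebesgue)"
    by (rule nn_integral_cong_AE) (use AE_J in \<open>eventually_elim, auto simp: indicator_def\<close>)
  then show ?thesis by (simp add: nn_avg_def)
qed

lemma nn_avg_J_real:
  assumes "f absolutely_integrable_on {a..b}" "\<And>x. 0 \<le> f x"
  shows "nn_avg J f = ennreal (integral {a..b} f / (b - a))"
proof -
  have "(\<integral>\<^sup>+x\<in>{a..b}. ennreal (f x) \<partial>lebesgue) = (\<integral>\<^sup>+x. ennreal (indicator {a..b} x *\<^sub>R f x) \<partial>lebesgue)"
    by (rule nn_integral_cong) (auto simp: indicator_def)
  also have "\<dots> = ennreal (LINT x:{a..b}|lebesgue. f x)"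
    unfolding set_lebesgue_integral_def using assms by (intro nn_integral_eq_integral) (auto simp: set_integrable_def)
  also have "\<dots> = ennreal (integral {a..b} f)"
    using set_lebesgue_integral_eq_integral(2)[OF assms(1)] by simp
  finally have 1: "(\<integral>\<^sup>+x\<in>{a..b}. ennreal (f x) \<partial>lebesgue) = ennreal (integral {a..b} f)" .
  have "0 \<le> integral {a..b} f"
    by (rule Henstock_Kurzweil_Integration.integral_nonneg) (use assms in \<open>auto intro: set_lebesgue_integral_eq_integral(1)\<close>)
  then show ?thesis unfolding nn_avg_J 1 using ab by (simp add: divide_ennreal)
qed

lemma nn_avg_J_finite:
  assumes "set_borel_measurable lebesgue {a..b} f" "\<And>x. 0 \<le> f x" "nn_avg J f < \<infinity>"
  shows "f absolutely_integrable_on {a..b}"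
proof -
  have eq: "(\<integral>\<^sup>+x\<in>{a..b}. ennreal (f x) \<partial>lebesgue) = (\<integral>\<^sup>+x. ennreal (indicator {a..b} x *\<^sub>R f x) \<partial>lebesgue)"
    by (rule nn_integral_cong) (auto simp: indicator_def)
  have "(\<integral>\<^sup>+x\<in>{a..b}. ennreal (f x) \<partial>lebesgue) < \<infinity>"
    using assms(3) ab unfolding nn_avg_J by (auto simp: ennreal_divide_eq_top_iff top.not_eq_extremum[symmetric])
  then show ?thesis unfolding set_integrable_def eq
    using assms by (intro integrableI_bounded) (auto simp: set_borel_measurable_def abs_mult)
qed

end

lemma subinterval_endpoints:
  assumes "J \<in> subintervals Q"
  obtains a b where "interval_endpoints J a b" "{a<..<b} \<subseteq> Q"
proof -
  have J: "finite_interval J" "J \<subseteq> Q" using assms by (auto simp: subintervals_def)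
  obtain a b where ab: "a < b" "{a<..<b} \<subseteq> J" "J \<subseteq> {a..b}"
    by (rule finite_interval_endpoints[OF J(1)])
  then have "interval_endpoints J a b" by unfold_locales
  moreover have "{a<..<b} \<subseteq> Q" using ab(2) J(2) by (rule subset_trans)
  ultimately show ?thesis by (rule that)
qed

text \<open>Subtracting a constant multiplies both sides by the same factor, so the mean may be
  normalised to 0.\<close>

lemma reverse_jensen_shift:
  assumes "reverse_jensen \<phi> exp a b C" shows "reverse_jensen (\<lambda>x. \<phi> x - c) exp a b C"
proof -
  interpret reverse_jensen \<phi> exp a b C by (rule assms)
  have e: "exp (\<phi> x - c) = exp (- c) * exp (\<phi> x)" for x by (simp add: exp_diff exp_minus field_simps)
  show ?thesis
  proof
    show "(\<lambda>x. \<phi> x - c) absolutely_integrable_on {a..b}"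
      by (intro set_integral_diff int) (simp add: absolutely_integrable_on_const)
    show "(\<lambda>x. exp (\<phi> x - c)) absolutely_integrable_on {a..b}" unfolding e by (intro set_integrable_mult_right intP)
    fix p q assume pq: "a \<le> p" "p < q" "q \<le> b"
    have i: "\<phi> integrable_on {p..q}"
      by (rule integrable_on_subinterval[OF set_lebesgue_integral_eq_integral(1)[OF int]]) (use pq in auto)
    have m: "integral {p..q} (\<lambda>x. \<phi> x - c) / (q - p) = integral {p..q} \<phi> / (q - p) - c"
      using i pq by (subst Henstock_Kurzweil_Integration.integral_diff) (auto simp: field_simps)
    have "integral {p..q} (\<lambda>x. exp (\<phi> x - c)) = exp (- c) * integral {p..q} (\<lambda>x. exp (\<phi> x))"
      unfolding e by simp
    also have "\<dots> \<le> exp (- c) * (C * (q - p) * exp (integral {p..q} \<phi> / (q - p)))"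
      using rev[OF pq] by (intro mult_left_mono) auto
    also have "\<dots> = C * (q - p) * exp (integral {p..q} \<phi> / (q - p) - c)" by (simp add: exp_diff exp_minus field_simps)
    finally show "integral {p..q} (\<lambda>x. exp (\<phi> x - c)) \<le> C * (q - p) * exp (integral {p..q} (\<lambda>x. \<phi> x - c) / (q - p))"
      unfolding m .
  qed (use ab convP C1 in auto)
qed

lemma integral_centered:
  assumes "\<phi> absolutely_integrable_on {a..b}" "a < b"
  shows "integral {a..b} (\<lambda>x. \<phi> x - integral {a..b} \<phi> / (b - a)) = (0::real)"
  using set_lebesgue_integral_eq_integral(1)[OF assms(1)] assms(2)
  by (subst Henstock_Kurzweil_Integration.integral_diff) auto

text \<open>The upper estimate concerns the weight formed from \<open>exp (- u)\<close>, so it is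
  applied to the negative of the centred function; the strict inequality for \<open>\<eta>\<close>
  is the slack of the candidate.\<close>

lemma variance_bound:
  assumes "reverse_jensen \<phi> exp a b C" and \<eta>: "\<bar>xi_minus C\<bar> < \<eta>"
  defines "c \<equiv> integral {a..b} \<phi> / (b - a)"
  shows "(\<lambda>x. (\<phi> x - c)\<^sup>2) absolutely_integrable_on {a..b}"
    "integral {a..b} (\<lambda>x. (\<phi> x - c)\<^sup>2) / (b - a) \<le> \<eta>\<^sup>2"
proof -
  interpret reverse_jensen \<phi> exp a b C by (rule assms(1))
  interpret s: reverse_jensen "\<lambda>x. \<phi> x - c" exp a b C by (rule reverse_jensen_shift[OF assms(1)])
  have C: "C = exp \<bar>xi_minus C\<bar> / (1 + \<bar>xi_minus C\<bar>)"
    using xi_minus_props[OF C1] by simp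
  have rj: "reverse_jensen (\<lambda>x. - (\<phi> x - c)) (\<lambda>u. exp (- u)) a b (exp \<bar>xi_minus C\<bar> / (1 + \<bar>xi_minus C\<bar>))"
    using s.uminus C by simp
  have mean: "integral {a..b} (\<lambda>x. - (\<phi> x - c)) = 0"
    unfolding integral_neg c_def using integral_centered[OF int ab] by simp
  show "(\<lambda>x. (\<phi> x - c)\<^sup>2) absolutely_integrable_on {a..b}"
    using reverse_jensen_upper(1)[OF rj _ \<eta> mean] by (simp only: power2_minus abs_ge_zero)
  show "integral {a..b} (\<lambda>x. (\<phi> x - c)\<^sup>2) / (b - a) \<le> \<eta>\<^sup>2"
    using reverse_jensen_upper(2)[OF rj _ \<eta> mean] by (simp only: power2_minus abs_ge_zero)
qed

lemma open_interval_exhaustion: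
  fixes a b :: real
  assumes "a < b"
  obtains e :: "nat \<Rightarrow> real" where "\<And>n. 0 < e n" "\<And>n. a + e n < b - e n" "\<And>n k. n \<le> k \<Longrightarrow> e k \<le> e n"
    "(\<Union>n. {a + e n..b - e n}) = {a<..<b}"
proof
  define e where "e n = (b - a) / (real n + 3)" for n :: nat
  show e0: "0 < e n" for n using assms by (simp add: e_def)
  show "a + e n < b - e n" for n
  proof -
    have "e n \<le> (b - a) / 3" unfolding e_def using assms by (intro divide_left_mono) auto
    then show ?thesis using assms by (simp add: field_simps)
  qed
  show "e k \<le> e n" if "n \<le> k" for n k using that assms by (auto simp: e_def intro!: divide_left_mono)
  have e_lim: "e \<longlonglongrightarrow> 0" unfolding e_def[abs_def] by real_asymp
  show "(\<Union>n. {a + e n..b - e n}) = {a<..<b}"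
  proof (intro equalityI subsetI)
    fix x assume "x \<in> (\<Union>n. {a + e n..b - e n})"
    then obtain n where "x \<in> {a + e n..b - e n}" by blast
    then show "x \<in> {a<..<b}" using e0[of n] by auto
  next
    fix x assume x: "x \<in> {a<..<b}"
    then have "0 < min (x - a) (b - x)" by auto
    then have "eventually (\<lambda>n. e n < min (x - a) (b - x)) sequentially" using e_lim by (rule order_tendstoD(2)[rotated])
    then obtain n where "e n < min (x - a) (b - x)" by (auto simp: eventually_sequentially)
    then have "x \<in> {a + e n..b - e n}" by auto
    then show "x \<in> (\<Union>n. {a + e n..b - e n})" by blast
  qed
qed

lemma locally_integrable_measurable:
  assumes "\<phi> locally_integrable_on Q" "{a<..<b} \<subseteq> Q" "a < b"
  shows "set_borel_measurable lebesgue {a..b} \<phi>"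
proof -
  obtain e :: "nat \<Rightarrow> real" where e_anti: "\<And>n k. n \<le> k \<Longrightarrow> e k \<le> e n"
    and U: "(\<Union>n. {a + e n..b - e n}) = {a<..<b}"
    using open_interval_exhaustion[OF assms(3)] by metis
  define A where "A n = {a + e n..b - e n}" for n
  have Amono: "incseq A" using e_anti by (force simp: A_def incseq_def)
  have UA: "(\<Union>n. A n) = {a<..<b}" using U by (simp add: A_def)
  have "(\<lambda>x. indicat_real (\<Union>n. A n) x *\<^sub>R \<phi> x) \<in> borel_measurable lebesgue"
  proof (rule borel_measurable_LIMSEQ_real)
    fix x
    show "(\<lambda>i. indicat_real (A i) x *\<^sub>R \<phi> x) \<longlonglongrightarrow> indicat_real (\<Union>n. A n) x *\<^sub>R \<phi> x"
      using LIMSEQ_indicator_incseq[OF Amono, of x] by (intro tendsto_intros) auto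
    show "(\<lambda>x. indicat_real (A i) x *\<^sub>R \<phi> x) \<in> borel_measurable lebesgue" for i
    proof -
      have "A i \<subseteq> Q" using UA assms(2) by blast
      then have "set_integrable lebesgue (A i) \<phi>"
        using assms(1) unfolding locally_integrable_on_def by (simp add: A_def)
      then show ?thesis by (auto simp: set_integrable_def)
    qed
  qed
  then have 1: "(\<lambda>x. indicat_real {a<..<b} x *\<^sub>R \<phi> x) \<in> borel_measurable lebesgue" by (simp add: UA)
  have eq: "indicat_real {a..b} x *\<^sub>R \<phi> x = indicat_real {a<..<b} x *\<^sub>R \<phi> x + (indicat_real {a} x * \<phi> a + indicat_real {b} x * \<phi> b)" for x
    using assms(3) by (auto simp: indicator_def)
  show ?thesis unfolding set_borel_measurable_def eq
    by (intro borel_measurable_add 1 borel_measurable_times borel_measurable_indicator) auto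
qed

section \<open>Members of the class and their integrability\<close>

locale class_member =
  fixes Q :: "real set" and C :: real and \<phi> :: "real \<Rightarrow> real"
  assumes C1: "1 \<le> C" and mem: "\<phi> \<in> exp_A_infty_class Q C"
begin

lemma loc_int:
  assumes "{c..d} \<subseteq> Q" shows "\<phi> absolutely_integrable_on {c..d}" "(\<lambda>x. exp (\<phi> x)) absolutely_integrable_on {c..d}"
  using mem assms by (auto simp: exp_A_infty_class_def A_infty_def locally_integrable_on_def)

lemma const_eq: "(SUP J\<in>subintervals Q. nn_avg J (\<lambda>x. exp (\<phi> x)) * ennreal (exp (- avg J \<phi>))) = ennreal C"
  using mem by (simp add: exp_A_infty_class_def A_infty_const_def)

lemma const_le: "J \<in> subintervals Q \<Longrightarrow> nn_avg J (\<lambda>x. exp (\<phi> x)) * ennreal (exp (- avg J \<phi>)) \<le> ennreal C"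
  unfolding const_eq[symmetric] by (rule SUP_upper)

lemma ratio:
  assumes "interval_endpoints J a b" "\<phi> absolutely_integrable_on {a..b}" "(\<lambda>x. exp (\<phi> x)) absolutely_integrable_on {a..b}"
  shows "nn_avg J (\<lambda>x. exp (\<phi> x)) * ennreal (exp (- avg J \<phi>))
    = ennreal (integral {a..b} (\<lambda>x. exp (\<phi> x - integral {a..b} \<phi> / (b - a))) / (b - a))"
proof -
  interpret interval_endpoints J a b by fact
  define c where "c = integral {a..b} \<phi> / (b - a)"
  have "integral {a..b} (\<lambda>x. exp (\<phi> x - c)) = exp (- c) * integral {a..b} (\<lambda>x. exp (\<phi> x))"
    by (simp add: exp_diff exp_minus field_simps)
  moreover have "0 \<le> integral {a..b} (\<lambda>x. exp (\<phi> x)) / (b - a)"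
    using ab assms(3) by (intro divide_nonneg_pos Henstock_Kurzweil_Integration.integral_nonneg set_lebesgue_integral_eq_integral(1)) auto
  ultimately show ?thesis
    using nn_avg_J_real[OF assms(3)] avg_J[OF assms(2)] by (simp add: c_def ennreal_mult[symmetric] mult.commute)
qed

lemma reverse_jensenI:
  assumes "a < b" "{a<..<b} \<subseteq> Q" "\<phi> absolutely_integrable_on {a..b}" "(\<lambda>x. exp (\<phi> x)) absolutely_integrable_on {a..b}"
  shows "reverse_jensen \<phi> exp a b C"
proof
  fix p q assume pq: "a \<le> p" "p < q" "q \<le> b"
  have sub: "{p..q} \<subseteq> {a..b}" "{p<..<q} \<subseteq> Q" using pq assms(2) by (auto simp: subset_iff)
  have i: "\<phi> absolutely_integrable_on {p..q}" "(\<lambda>x. exp (\<phi> x)) absolutely_integrable_on {p..q}"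
    using set_integrable_subset[OF assms(3)] set_integrable_subset[OF assms(4)] sub by auto
  have ie: "interval_endpoints {p<..<q} p q" using pq by unfold_locales auto
  define c where "c = integral {p..q} \<phi> / (q - p)"
  have "ennreal (integral {p..q} (\<lambda>x. exp (\<phi> x - c)) / (q - p)) \<le> ennreal C"
    using const_le[OF open_interval_in_subintervals[OF pq(2) sub(2)]] ratio[OF ie i] by (simp add: c_def)
  then have "integral {p..q} (\<lambda>x. exp (\<phi> x - c)) / (q - p) \<le> C" using C1 by simp
  moreover have "integral {p..q} (\<lambda>x. exp (\<phi> x - c)) = exp (- c) * integral {p..q} (\<lambda>x. exp (\<phi> x))"
    by (simp add: exp_diff exp_minus field_simps)
  ultimately show "integral {p..q} (\<lambda>x. exp (\<phi> x)) \<le> C * (q - p) * exp (integral {p..q} \<phi> / (q - p))"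
    using pq unfolding c_def[symmetric]
  proof -
    assume 1: "integral {p..q} (\<lambda>x. exp (\<phi> x - c)) / (q - p) \<le> C"
      and 2: "integral {p..q} (\<lambda>x. exp (\<phi> x - c)) = exp (- c) * integral {p..q} (\<lambda>x. exp (\<phi> x))"
    have "exp c * integral {p..q} (\<lambda>x. exp (\<phi> x - c)) \<le> exp c * (C * (q - p))"
      using 1 pq by (intro mult_left_mono) (auto simp: pos_divide_le_eq)
    moreover have "exp c * (exp (- c) * integral {p..q} (\<lambda>x. exp (\<phi> x))) = integral {p..q} (\<lambda>x. exp (\<phi> x))"
      by (simp add: exp_minus)
    ultimately show "integral {p..q} (\<lambda>x. exp (\<phi> x)) \<le> C * (q - p) * exp c"
      unfolding 2 by (simp only: mult.commute)
  qed
qed (use assms C1 exp_convex in auto)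

text \<open>A crude bound by the variance, through \<open>\<bar>u\<bar> \<le> u\<^sup>2 + 1\<close>.
  What matters is that, relative to the length, it is the same for all compact subintervals of
  \<open>Q\<close>.\<close>

lemma mean_osc_bound:
  assumes "{c..d} \<subseteq> Q" "c < d"
  shows "integral {c..d} (\<lambda>x. \<bar>\<phi> x - integral {c..d} \<phi> / (d - c)\<bar>) \<le> (d - c) * ((\<bar>xi_minus C\<bar> + 1)\<^sup>2 + 1)"
proof -
  let ?m = "integral {c..d} \<phi> / (d - c)"
  have rj: "reverse_jensen \<phi> exp c d C"
  proof (rule reverse_jensenI[OF assms(2) _ loc_int[OF assms(1)]])
    show "{c<..<d} \<subseteq> Q" using assms(1) by (auto simp: subset_iff)
  qed
  note v = variance_bound[OF rj, of "\<bar>xi_minus C\<bar> + 1"]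
  have i1: "(\<lambda>x. \<bar>\<phi> x - ?m\<bar>) absolutely_integrable_on {c..d}"
    by (intro set_integrable_abs set_integral_diff loc_int assms) (simp add: absolutely_integrable_on_const)
  have i2: "(\<lambda>x. (\<phi> x - ?m)\<^sup>2) integrable_on {c..d}" using v(1) by (intro set_lebesgue_integral_eq_integral(1)) simp
  have "integral {c..d} (\<lambda>x. \<bar>\<phi> x - ?m\<bar>) \<le> integral {c..d} (\<lambda>x. (\<phi> x - ?m)\<^sup>2 + 1)"
  proof (rule integral_le)
    show "(\<lambda>x. \<bar>\<phi> x - ?m\<bar>) integrable_on {c..d}" using i1 by (rule set_lebesgue_integral_eq_integral(1))
    show "(\<lambda>x. (\<phi> x - ?m)\<^sup>2 + 1) integrable_on {c..d}"
      by (intro Henstock_Kurzweil_Integration.integrable_add i2) auto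
    have "\<bar>u\<bar> \<le> u\<^sup>2 + 1" for u :: real
    proof -
      have "0 \<le> (\<bar>u\<bar> - 1)\<^sup>2" by simp
      then show ?thesis by (simp add: power2_eq_square algebra_simps)
    qed
    then show "\<bar>\<phi> x - ?m\<bar> \<le> (\<phi> x - ?m)\<^sup>2 + 1" for x .
  qed
  also have "\<dots> = integral {c..d} (\<lambda>x. (\<phi> x - ?m)\<^sup>2) + (d - c)"
    using i2 assms(2) by (subst Henstock_Kurzweil_Integration.integral_add) auto
  also have "\<dots> \<le> (d - c) * (\<bar>xi_minus C\<bar> + 1)\<^sup>2 + (d - c)"
    using v(2) assms(2) by (simp add: field_simps)
  finally show ?thesis by (simp add: algebra_simps)
qed

text \<open>On an interval whose endpoints need not belong to \<open>Q\<close>, integrability follows from the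
  uniform oscillation bound on the compact intervals that exhaust it.\<close>

lemma phi_integrable:
  assumes "a < b" "{a<..<b} \<subseteq> Q" shows "\<phi> absolutely_integrable_on {a..b}"
proof -
  obtain e :: "nat \<Rightarrow> real" where e0: "\<And>n. 0 < e n" and len: "\<And>n. a + e n < b - e n"
    and e_anti: "\<And>n k. n \<le> k \<Longrightarrow> e k \<le> e n" and U: "(\<Union>n. {a + e n..b - e n}) = {a<..<b}"
    using open_interval_exhaustion[OF assms(1)] by metis
  define A where "A n = {a + e n..b - e n}" for n
  have UA: "(\<Union>n. A n) = {a<..<b}" using U by (simp add: A_def)
  have AQ: "A n \<subseteq> Q" for n using UA assms(2) by blast
  have Amono: "A n \<subseteq> A k" if "n \<le> k" for n k using e_anti[OF that] by (auto simp: A_def)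
  have int: "\<phi> absolutely_integrable_on A n" for n using loc_int(1)[of "a + e n" "b - e n"] AQ[of n] by (simp add: A_def)
  define mm where "mm n = integral (A n) \<phi> / (b - e n - (a + e n))" for n
  define E where "E = (b - a) * ((\<bar>xi_minus C\<bar> + 1)\<^sup>2 + 1)"
  have osc: "integral (A n) (\<lambda>x. \<bar>\<phi> x - mm n\<bar>) \<le> E" for n
  proof -
    have "integral (A n) (\<lambda>x. \<bar>\<phi> x - mm n\<bar>) \<le> (b - e n - (a + e n)) * ((\<bar>xi_minus C\<bar> + 1)\<^sup>2 + 1)"
      using mean_osc_bound[of "a + e n" "b - e n"] AQ[of n] len[of n] by (simp add: A_def mm_def)
    also have "\<dots> \<le> E" unfolding E_def using e0[of n] by (intro mult_right_mono) auto
    finally show ?thesis .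
  qed
  have iabs: "(\<lambda>x. \<bar>\<phi> x - c\<bar>) absolutely_integrable_on A n" for n c
    by (intro set_integrable_abs set_integral_diff int) (simp add: A_def absolutely_integrable_on_const)
  note iabs' = set_lebesgue_integral_eq_integral(1)[OF iabs]
  define L where "L = b - e 0 - (a + e 0)"
  have L0: "0 < L" using len[of 0] by (simp add: L_def)
  \<comment> \<open>\<open>A 0\<close> is contained in \<open>A n\<close>, so the oscillation over
    \<open>A n\<close> controls the distance between the two means.\<close>
  have mm_bound: "\<bar>mm n\<bar> \<le> \<bar>mm 0\<bar> + E / L" for n
  proof -
    have "integral (A 0) (\<lambda>x. \<phi> x - mm n) = L * (mm 0 - mm n)"
      using set_lebesgue_integral_eq_integral(1)[OF int[of 0]] L0
      unfolding A_def by (subst Henstock_Kurzweil_Integration.integral_diff) (auto simp: mm_def A_def L_def field_simps)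
    then have "L * \<bar>mm 0 - mm n\<bar> = \<bar>integral (A 0) (\<lambda>x. \<phi> x - mm n)\<bar>" using L0 by (simp add: abs_mult)
    also have "\<dots> \<le> integral (A 0) (\<lambda>x. \<bar>\<phi> x - mm n\<bar>)"
    proof -
      have "(\<lambda>x. \<phi> x - mm n) absolutely_integrable_on A 0"
        by (intro set_integral_diff int) (simp add: A_def absolutely_integrable_on_const)
      then have "(\<lambda>x. \<phi> x - mm n) integrable_on A 0" by (rule set_lebesgue_integral_eq_integral(1))
      from integral_norm_bound_integral[OF this iabs'[of "mm n" 0]] show ?thesis by simp
    qed
    also have "\<dots> \<le> integral (A n) (\<lambda>x. \<bar>\<phi> x - mm n\<bar>)"
      by (rule integral_subset_le) (use Amono[of 0 n] iabs' in auto)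
    also have "\<dots> \<le> E" by (rule osc)
    finally have "\<bar>mm 0 - mm n\<bar> \<le> E / L" using L0 by (simp add: field_simps)
    then show ?thesis by linarith
  qed
  define B where "B = E + (\<bar>mm 0\<bar> + E / L) * (b - a)"
  have bound: "(LINT x:A n|lebesgue. \<bar>\<phi> x\<bar>) \<le> B" for n
  proof -
    have i0: "(\<lambda>x. \<bar>\<phi> x\<bar>) absolutely_integrable_on A n" using iabs[of n 0] by simp
    have "(LINT x:A n|lebesgue. \<bar>\<phi> x\<bar>) = integral (A n) (\<lambda>x. \<bar>\<phi> x\<bar>)" by (rule set_lebesgue_integral_eq_integral(2)[OF i0])
    also have "\<dots> \<le> integral (A n) (\<lambda>x. \<bar>\<phi> x - mm n\<bar> + \<bar>mm n\<bar>)"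
    proof (rule integral_le)
      show "(\<lambda>x. \<bar>\<phi> x\<bar>) integrable_on A n" using i0 by (rule set_lebesgue_integral_eq_integral(1))
      show "(\<lambda>x. \<bar>\<phi> x - mm n\<bar> + \<bar>mm n\<bar>) integrable_on A n"
        by (intro Henstock_Kurzweil_Integration.integrable_add iabs') (auto simp: A_def)
    qed auto
    also have "\<dots> = integral (A n) (\<lambda>x. \<bar>\<phi> x - mm n\<bar>) + \<bar>mm n\<bar> * (b - e n - (a + e n))"
      using iabs'[of "mm n" n] len[of n] unfolding A_def
      by (subst Henstock_Kurzweil_Integration.integral_add) auto
    also have "\<dots> \<le> B" unfolding B_def
      using osc[of n] mm_bound[of n] e0[of n] len[of n] by (intro add_mono mult_mono) auto
    finally show ?thesis .
  qed
  have inc: "incseq (\<lambda>n. LINT x:A n|lebesgue. \<bar>\<phi> x\<bar>)"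
  proof (rule incseq_SucI)
    fix n
    show "(LINT x:A n|lebesgue. \<bar>\<phi> x\<bar>) \<le> (LINT x:A (Suc n)|lebesgue. \<bar>\<phi> x\<bar>)"
      unfolding set_lebesgue_integral_def
      by (rule integral_mono)
        (use iabs[of n 0] iabs[of "Suc n" 0] Amono[of n "Suc n"] in \<open>auto simp: set_integrable_def indicator_def\<close>)
  qed
  obtain l where l: "(\<lambda>n. LINT x:A n|lebesgue. \<bar>\<phi> x\<bar>) \<longlonglongrightarrow> l"
    using incseq_convergent[OF inc, of B] bound by metis
  have "set_integrable lebesgue (\<Union>n. A n) (\<lambda>x. \<bar>\<phi> x\<bar>)"
  proof (rule pos_integrable_to_top[OF _ _ _ _ l])
    show "mono A" using Amono by (auto simp: mono_def)
    show "set_integrable lebesgue (A n) (\<lambda>x. \<bar>\<phi> x\<bar>)" for n using iabs[of n 0] by simp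
  qed (auto simp: A_def)
  then have i: "(\<lambda>x. \<bar>\<phi> x\<bar>) absolutely_integrable_on {a..b}"
    unfolding UA using absolutely_integrable_on_open_interval[of a b "\<lambda>x. \<bar>\<phi> x\<bar>"] by simp
  have "\<phi> locally_integrable_on Q" using mem by (simp add: exp_A_infty_class_def A_infty_def)
  then have "set_borel_measurable lebesgue {a..b} \<phi>"
    by (rule locally_integrable_measurable[OF _ assms(2,1)])
  then show ?thesis by (rule set_integrable_bound[OF i]) simp
qed

lemma exp_integrable:
  assumes "a < b" "{a<..<b} \<subseteq> Q" shows "(\<lambda>x. exp (\<phi> x)) absolutely_integrable_on {a..b}"
proof -
  interpret interval_endpoints "{a<..<b}" a b using assms(1) by unfold_locales auto
  have "nn_avg {a<..<b} (\<lambda>x. exp (\<phi> x)) * ennreal (exp (- avg {a<..<b} \<phi>)) \<le> ennreal C"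
    by (rule const_le[OF open_interval_in_subintervals[OF assms]])
  then have "nn_avg {a<..<b} (\<lambda>x. exp (\<phi> x)) * ennreal (exp (- avg {a<..<b} \<phi>)) < \<infinity>"
    by (rule le_less_trans) simp
  then have "nn_avg {a<..<b} (\<lambda>x. exp (\<phi> x)) < \<infinity>" by (auto simp: ennreal_mult_less_top)
  moreover have "set_borel_measurable lebesgue {a..b} (\<lambda>x. exp (\<phi> x))"
    by (rule borel_measurable_indicator_compose[OF set_integrable_imp_set_borel_measurable[OF phi_integrable[OF assms]]]) auto
  ultimately show ?thesis by (intro nn_avg_J_finite) auto
qed

lemma reverse_jensen_phi: "a < b \<Longrightarrow> {a<..<b} \<subseteq> Q \<Longrightarrow> reverse_jensen \<phi> exp a b C"
  by (intro reverse_jensenI phi_integrable exp_integrable)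

end

lemma ennreal_powr_le_iff:
  assumes "0 < r" "0 \<le> B"
  shows "ennreal_powr x (1 / r) \<le> ennreal B \<longleftrightarrow> x \<le> ennreal (B powr r)"
proof (cases x)
  case (real y)
  have "y powr (1 / r) \<le> B \<longleftrightarrow> y \<le> B powr r"
  proof
    assume "y powr (1 / r) \<le> B"
    then have "(y powr (1 / r)) powr r \<le> B powr r" using assms by (intro powr_mono2) auto
    then show "y \<le> B powr r" using assms real by (simp add: powr_powr powr_one')
  next
    assume "y \<le> B powr r"
    then have "y powr (1 / r) \<le> (B powr r) powr (1 / r)" using assms real by (intro powr_mono2) auto
    then show "y powr (1 / r) \<le> B" using assms by (simp add: powr_powr powr_one')
  qed
  then show ?thesis using real assms by (simp add: ennreal_powr_def)
next
  case top
  then show ?thesis by (simp add: ennreal_powr_def top_unique)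
qed

lemma bmo_norm_le_iff:
  assumes "0 < p" "0 \<le> B"
  shows "bmo_norm p Q \<phi> \<le> ennreal B \<longleftrightarrow>
    (\<forall>J\<in>subintervals Q. nn_avg J (\<lambda>x. \<bar>\<phi> x - avg J \<phi>\<bar> powr p) \<le> ennreal (B powr p))"
  unfolding bmo_norm_def SUP_le_iff using ennreal_powr_le_iff[OF assms] by simp

lemma ennreal_le_bmo_normI:
  assumes "\<And>B. 0 \<le> B \<Longrightarrow> bmo_norm p Q \<phi> \<le> ennreal B \<Longrightarrow> x \<le> B"
  shows "ennreal x \<le> bmo_norm p Q \<phi>"
proof (cases "bmo_norm p Q \<phi>")
  case (real B)
  then show ?thesis using assms[of B] by (simp add: ennreal_leI)
qed simp

section \<open>From single intervals to norms\<close>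

context class_member
begin

lemma osc_power:
  assumes ie: "interval_endpoints J a b" and sub: "{a<..<b} \<subseteq> Q" and p: "0 < p"
    and le: "nn_avg J (\<lambda>x. \<bar>\<phi> x - avg J \<phi>\<bar> powr p) \<le> ennreal (B powr p)"
  defines "c \<equiv> integral {a..b} \<phi> / (b - a)"
  shows "(\<lambda>x. \<bar>\<phi> x - c\<bar> powr p) absolutely_integrable_on {a..b}"
    "integral {a..b} (\<lambda>x. \<bar>\<phi> x - c\<bar> powr p) / (b - a) \<le> B powr p"
proof -
  interpret interval_endpoints J a b by (rule ie)
  have i: "\<phi> absolutely_integrable_on {a..b}" by (rule phi_integrable[OF ab sub])
  have c: "avg J \<phi> = c" unfolding c_def by (rule avg_J[OF i])
  have m: "set_borel_measurable lebesgue {a..b} (\<lambda>x. \<bar>\<phi> x - c\<bar> powr p)"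
    by (rule borel_measurable_indicator_compose[OF set_integrable_imp_set_borel_measurable[OF i], of "\<lambda>u. \<bar>u - c\<bar> powr p"]) auto
  show 1: "(\<lambda>x. \<bar>\<phi> x - c\<bar> powr p) absolutely_integrable_on {a..b}"
    by (rule nn_avg_J_finite[OF m]) (use le in \<open>auto simp: c intro: le_less_trans\<close>)
  show "integral {a..b} (\<lambda>x. \<bar>\<phi> x - c\<bar> powr p) / (b - a) \<le> B powr p"
    using le nn_avg_J_real[OF 1] by (simp add: c)
qed

text \<open>The supremum that defines the constant need not be attained, so an interval of
  prescribed small defect takes the place of an extremal one.\<close>

lemma near_extremal:
  assumes "0 < \<epsilon>"
  obtains J a b where "J \<in> subintervals Q" "interval_endpoints J a b" "{a<..<b} \<subseteq> Q"
    "C - \<epsilon> < integral {a..b} (\<lambda>x. exp (\<phi> x - integral {a..b} \<phi> / (b - a))) / (b - a)"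
proof -
  have "ennreal (C - \<epsilon>) < ennreal C" using assms C1 by (intro ennreal_lessI) auto
  then obtain J where J: "J \<in> subintervals Q" "ennreal (C - \<epsilon>) < nn_avg J (\<lambda>x. exp (\<phi> x)) * ennreal (exp (- avg J \<phi>))"
    unfolding const_eq[symmetric] less_SUP_iff by blast
  obtain a b where ab: "interval_endpoints J a b" "{a<..<b} \<subseteq> Q" by (rule subinterval_endpoints[OF J(1)])
  have l: "a < b" using ab(1) by (simp add: interval_endpoints_def)
  have "ennreal (C - \<epsilon>) < ennreal (integral {a..b} (\<lambda>x. exp (\<phi> x - integral {a..b} \<phi> / (b - a))) / (b - a))"
    using J(2) ratio[OF ab(1) phi_integrable[OF l ab(2)] exp_integrable[OF l ab(2)]] by simp
  then have "C - \<epsilon> < integral {a..b} (\<lambda>x. exp (\<phi> x - integral {a..b} \<phi> / (b - a))) / (b - a)"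
    by (meson ennreal_leI leD leI)
  then show ?thesis using that J(1) ab by blast
qed

lemma bmo_two_le: "bmo_norm 2 Q \<phi> \<le> ennreal \<bar>xi_minus C\<bar>"
proof -
  have "nn_avg J (\<lambda>x. \<bar>\<phi> x - avg J \<phi>\<bar> powr 2) \<le> ennreal (\<bar>xi_minus C\<bar> powr 2)" if J: "J \<in> subintervals Q" for J
  proof -
    obtain a b where ab: "interval_endpoints J a b" "{a<..<b} \<subseteq> Q" by (rule subinterval_endpoints[OF J])
    have l: "a < b" using ab(1) by (simp add: interval_endpoints_def)
    have rj: "reverse_jensen \<phi> exp a b C" by (rule reverse_jensen_phi[OF l ab(2)])
    define c where "c = integral {a..b} \<phi> / (b - a)"
    have c: "avg J \<phi> = c" unfolding c_def by (rule interval_endpoints.avg_J[OF ab(1) phi_integrable[OF l ab(2)]])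
    have sq: "\<bar>u\<bar> powr 2 = u\<^sup>2" for u :: real by (cases "u = 0") (auto simp: powr_numeral)
    have i: "(\<lambda>x. (\<phi> x - c)\<^sup>2) absolutely_integrable_on {a..b}"
      using variance_bound(1)[OF rj, of "\<bar>xi_minus C\<bar> + 1"] by (simp add: c_def)
    \<comment> \<open>\<open>variance_bound\<close> requires a strictly larger
      \<open>\<eta>\<close>; letting it decrease to the root gives the exact constant.\<close>
    have "integral {a..b} (\<lambda>x. (\<phi> x - c)\<^sup>2) / (b - a) \<le> \<bar>xi_minus C\<bar>\<^sup>2"
    proof (rule tendsto_lowerbound[where F = "at_right \<bar>xi_minus C\<bar>"])
      show "((\<lambda>\<eta>. \<eta>\<^sup>2) \<longlongrightarrow> \<bar>xi_minus C\<bar>\<^sup>2) (at_right \<bar>xi_minus C\<bar>)" by (intro tendsto_intros)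
      show "eventually (\<lambda>\<eta>. integral {a..b} (\<lambda>x. (\<phi> x - c)\<^sup>2) / (b - a) \<le> \<eta>\<^sup>2) (at_right \<bar>xi_minus C\<bar>)"
        unfolding eventually_at_right_field
        by (intro exI[of _ "\<bar>xi_minus C\<bar> + 1"]) (use variance_bound(2)[OF rj] in \<open>auto simp: c_def\<close>)
    qed simp
    then show ?thesis unfolding c sq using interval_endpoints.nn_avg_J_real[OF ab(1) i] by (simp add: ennreal_leI)
  qed
  then show ?thesis using bmo_norm_le_iff[of 2 "\<bar>xi_minus C\<bar>" Q \<phi>] by simp
qed

lemma bmo_one_ge: "ennreal (k_const C) \<le> bmo_norm 1 Q \<phi>"
proof (cases "C = 1")
  case True
  then show ?thesis by (simp add: k_const_def)
next
  case False
  then have C: "1 < C" using C1 by simp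
  define k where "k = 2 * ((1 - xi_minus C) * (1 - xi_plus C) / (xi_plus C - xi_minus C))"
  have k0: "0 < k" unfolding k_def using xi_plus_props(2)[OF C1] xi_plus_pos[OF C] xi_minus_neg[OF C]
    by (intro mult_pos_pos divide_pos_pos) auto
  show ?thesis
  proof (rule ennreal_le_bmo_normI)
    fix B assume B: "0 \<le> B" "bmo_norm 1 Q \<phi> \<le> ennreal B"
    have "k * (C - 1) \<le> B + e" if "0 < e" for e
    proof -
      have "0 < e / k" using that k0 by simp
      then obtain J a b where J: "J \<in> subintervals Q" "interval_endpoints J a b" "{a<..<b} \<subseteq> Q"
        "C - e / k < integral {a..b} (\<lambda>x. exp (\<phi> x - integral {a..b} \<phi> / (b - a))) / (b - a)"
        by (rule near_extremal)
      define c where "c = integral {a..b} \<phi> / (b - a)"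
      have l: "a < b" using J(2) by (simp add: interval_endpoints_def)
      have "k * (integral {a..b} (\<lambda>x. exp (\<phi> x - c)) / (b - a) - 1) \<le> integral {a..b} (\<lambda>x. \<bar>\<phi> x - c\<bar>) / (b - a)"
        unfolding k_def c_def
        by (rule reverse_jensen_lower_one[OF reverse_jensen_shift[OF reverse_jensen_phi[OF l J(3)]] C integral_centered[OF phi_integrable[OF l J(3)] l]])
      also have "\<dots> \<le> B"
        using osc_power(2)[OF J(2,3), of 1 B] B J(1) bmo_norm_le_iff[of 1 B Q \<phi>] by (simp add: c_def powr_one')
      finally have "k * (integral {a..b} (\<lambda>x. exp (\<phi> x - c)) / (b - a) - 1) \<le> B" .
      moreover have "k * (C - e / k - 1) \<le> k * (integral {a..b} (\<lambda>x. exp (\<phi> x - c)) / (b - a) - 1)"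
        using J(4) k0 by (intro mult_left_mono) (auto simp: c_def)
      moreover have "k * (C - e / k - 1) = k * (C - 1) - e" using k0 by (simp add: field_simps)
      ultimately show ?thesis by simp
    qed
    then have "k * (C - 1) \<le> B" by (rule field_le_epsilon)
    then show "k_const C \<le> B" using False by (simp add: k_const_def k_def)
  qed
qed

text \<open>Two defects are at most \<open>\<epsilon>\<close> each: the interval is nearly extremal,
  and \<open>\<xi>\<close> lies above \<open>xi_plus C\<close> so closely that its own constant
  exceeds \<open>C\<close> by less than \<open>\<epsilon>\<close>. The loss in
  \<open>reverse_jensen_lower\<close> is then at most \<open>2 * \<epsilon>\<close> times its
  coefficient, and \<open>K\<close> bounds that coefficient for all such \<open>\<xi>\<close>, so
  \<open>\<epsilon>\<close> can be fixed beforehand. The case \<open>p = 2\<close> is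
  included.\<close>

lemma bmo_p_ge:
  assumes p: "1 < p" "p \<le> 2" and Cp: "exp (p - 2) / (p - 1) \<le> C"
  shows "ennreal (exponent.M p (- 1) powr (1 / p) * xi_plus C) \<le> bmo_norm p Q \<phi>"
proof (cases "xi_plus C = 0")
  case False
  interpret exponent p using p by unfold_locales
  define \<xi>0 where "\<xi>0 = xi_plus C"
  have \<xi>0: "0 < \<xi>0" "\<xi>0 < 1" "C = exp (- \<xi>0) / (1 - \<xi>0)"
    using xi_plus_props[OF C1] False by (auto simp: \<xi>0_def)
  have "2 - p \<le> \<xi>0" unfolding \<xi>0_def by (rule xi_plus_ge) (use C1 p Cp in auto)
  have M0: "0 < M (- 1)" by (rule M_pos) simp
  define K where "K = 2 * p * \<xi>0 powr (p - 2) * exp 1"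
  have K0: "0 < K" using p \<xi>0 by (simp add: K_def)
  show ?thesis
  proof (rule ennreal_le_bmo_normI)
    fix B assume B: "0 \<le> B" "bmo_norm p Q \<phi> \<le> ennreal B"
    have "\<xi>0 powr p * M (- 1) \<le> B powr p + e" if "0 < e" for e
    proof -
      define \<epsilon> where "\<epsilon> = e / (2 * K)"
      have \<epsilon>: "0 < \<epsilon>" using that K0 by (simp add: \<epsilon>_def)
      then obtain J a b where J: "J \<in> subintervals Q" "interval_endpoints J a b" "{a<..<b} \<subseteq> Q"
        "C - \<epsilon> < integral {a..b} (\<lambda>x. exp (\<phi> x - integral {a..b} \<phi> / (b - a))) / (b - a)"
        by (rule near_extremal)
      define c where "c = integral {a..b} \<phi> / (b - a)"
      define \<rho> where "\<rho> = integral {a..b} (\<lambda>x. exp (\<phi> x - c)) / (b - a)"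
      have l: "a < b" using J(2) by (simp add: interval_endpoints_def)
      have "((\<lambda>\<xi>. exp (- \<xi>) / (1 - \<xi>)) \<longlongrightarrow> exp (- \<xi>0) / (1 - \<xi>0)) (at_right \<xi>0)"
        using \<xi>0 by (intro tendsto_intros) auto
      then have "eventually (\<lambda>\<xi>. exp (- \<xi>) / (1 - \<xi>) < C + \<epsilon>) (at_right \<xi>0)"
        using \<epsilon> \<xi>0(3) by (intro order_tendstoD(2)) auto
      moreover have "eventually (\<lambda>\<xi>. \<xi> \<in> {\<xi>0<..<1}) (at_right \<xi>0)"
        using \<xi>0(2) by (intro eventually_at_right_real)
      ultimately have "eventually (\<lambda>\<xi>. exp (- \<xi>) / (1 - \<xi>) < C + \<epsilon> \<and> \<xi> \<in> {\<xi>0<..<1}) (at_right \<xi>0)"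
        by (rule eventually_conj)
      then obtain \<xi> where \<xi>: "exp (- \<xi>) / (1 - \<xi>) < C + \<epsilon>" "\<xi>0 < \<xi>" "\<xi> < 1"
        using eventually_happens'[of "at_right \<xi>0"] by force
      interpret exponent_xi p \<xi> using \<xi> \<xi>0 \<open>2 - p \<le> \<xi>0\<close> by unfold_locales auto
      have rj: "reverse_jensen (\<lambda>x. \<phi> x - c) exp a b (exp (- \<xi>0) / (1 - \<xi>0))"
        using reverse_jensen_shift[OF reverse_jensen_phi[OF l J(3)], of c] \<xi>0(3) by (simp only:)
      have le: "nn_avg J (\<lambda>x. \<bar>\<phi> x - avg J \<phi>\<bar> powr p) \<le> ennreal (B powr p)"
        using bmo_norm_le_iff[of p B Q \<phi>] B J(1) p by simp
      have p0: "0 < p" using p by simp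
      note op = osc_power[OF J(2,3) p0 le, folded c_def]
      have "\<xi> powr p * M (- 1) - kap (- \<xi>) * exp \<xi> * (exp (- \<xi>) / (1 - \<xi>) - \<rho>) \<le> integral {a..b} (\<lambda>x. \<bar>\<phi> x - c\<bar> powr p) / (b - a)"
        unfolding \<rho>_def
        by (rule reverse_jensen_lower[OF rj exponent_xi_axioms _ \<xi>(2) _ op(1)])
          (use \<xi>0 integral_centered[OF phi_integrable[OF l J(3)] l] in \<open>auto simp: c_def\<close>)
      also have "\<dots> \<le> B powr p" by (rule op(2))
      finally have 1: "\<xi> powr p * M (- 1) \<le> B powr p + kap (- \<xi>) * exp \<xi> * (exp (- \<xi>) / (1 - \<xi>) - \<rho>)" by simp
      have "kap (- \<xi>) * exp \<xi> \<le> (2 * p * \<xi> powr (p - 2)) * exp 1"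
        using kap_le[of "- \<xi>"] kap_nonneg[of "- \<xi>"] \<xi> p by (intro mult_mono) auto
      also have "\<dots> \<le> K" unfolding K_def using \<xi> \<xi>0 p by (intro mult_right_mono mult_left_mono powr_mono2') auto
      finally have kK: "kap (- \<xi>) * exp \<xi> \<le> K" .
      have "exp (- \<xi>) / (1 - \<xi>) - \<rho> \<le> 2 * \<epsilon>" using \<xi>(1) J(4) by (simp add: \<rho>_def c_def)
      then have "kap (- \<xi>) * exp \<xi> * (exp (- \<xi>) / (1 - \<xi>) - \<rho>) \<le> kap (- \<xi>) * exp \<xi> * (2 * \<epsilon>)"
        using kap_nonneg[of "- \<xi>"] by (intro mult_left_mono) auto
      also have "\<dots> \<le> K * (2 * \<epsilon>)" using kK \<epsilon> by (intro mult_right_mono) auto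
      also have "\<dots> = e" using K0 by (simp add: \<epsilon>_def)
      finally have 2: "\<xi> powr p * M (- 1) \<le> B powr p + e" using 1 by simp
      have "\<xi>0 powr p * M (- 1) \<le> \<xi> powr p * M (- 1)" using M0 \<xi> \<xi>0 p by (intro mult_right_mono powr_mono2) auto
      then show ?thesis using 2 by simp
    qed
    then have "\<xi>0 powr p * M (- 1) \<le> B powr p" by (rule field_le_epsilon)
    then have "(\<xi>0 powr p * M (- 1)) powr (1 / p) \<le> (B powr p) powr (1 / p)"
      using M0 p by (intro powr_mono2) auto
    then show "M (- 1) powr (1 / p) * xi_plus C \<le> B"
      using M0 p B \<xi>0(1) by (simp add: powr_mult powr_powr powr_one' \<xi>0_def[symmetric] mult.commute)
  qed
qed simp

end

section \<open>Logarithmic extremals\<close>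

lemma has_integral_translate:
  fixes f :: "real \<Rightarrow> real"
  assumes "(f has_integral I) {c..d}" shows "((\<lambda>x. f (x - a)) has_integral I) {a + c..a + d}"
  using has_integral_affinity'[of f I c d 1 "- a"] assms by (simp add: add.commute)

lemma tendsto_x_ln_x: "((\<lambda>x::real. x * (1 - ln x)) \<longlongrightarrow> 0) (at_right 0)"
  by real_asymp

lemma ln_antiderivative_cont: "continuous_on {0..} (\<lambda>x::real. x * (1 - ln x))"
proof (rule continuous_on_eq_continuous_within[THEN iffD2], intro ballI)
  fix x :: real assume "x \<in> {0..}"
  then consider "x = 0" | "0 < x" by fastforce
  then show "continuous (at x within {0..}) (\<lambda>x. x * (1 - ln x))"
  proof cases
    case 1
    then show ?thesis using tendsto_x_ln_x by (simp add: continuous_within at_within_Ici_at_right)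
  next
    case 2
    then have "isCont (\<lambda>x. x * (1 - ln x)) x" by (intro continuous_intros) auto
    then show ?thesis by (rule continuous_at_imp_continuous_at_within)
  qed
qed

lemma ln_has_integral:
  fixes c d :: real
  assumes "0 \<le> c" "c \<le> d"
  shows "((\<lambda>t. - ln t) has_integral (d * (1 - ln d) - c * (1 - ln c))) {c..d}"
proof (rule fundamental_theorem_of_calculus_interior[OF assms(2)])
  show "continuous_on {c..d} (\<lambda>t. t * (1 - ln t))"
    by (rule continuous_on_subset[OF ln_antiderivative_cont]) (use assms in auto)
  fix x assume x: "x \<in> {c<..<d}"
  then show "((\<lambda>t. t * (1 - ln t)) has_vector_derivative - ln x) (at x)"
    unfolding has_real_derivative_iff_has_vector_derivative[symmetric]
    using assms by (auto intro!: derivative_eq_intros simp: field_simps)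
qed

lemma powr_has_integral:
  fixes c d \<xi> :: real
  assumes "0 \<le> c" "c \<le> d" "\<xi> < 1"
  shows "((\<lambda>t. t powr (- \<xi>)) has_integral (d powr (1 - \<xi>) - c powr (1 - \<xi>)) / (1 - \<xi>)) {c..d}"
proof -
  have "((\<lambda>t. t powr (- \<xi>)) has_integral (d powr (1 - \<xi>) / (1 - \<xi>) - c powr (1 - \<xi>) / (1 - \<xi>))) {c..d}"
  proof (rule fundamental_theorem_of_calculus_interior[OF assms(2)])
    show "continuous_on {c..d} (\<lambda>t. t powr (1 - \<xi>) / (1 - \<xi>))"
      using assms by (intro continuous_intros continuous_on_powr') auto
    fix x assume x: "x \<in> {c<..<d}"
    then have "0 < x" using assms by simp
    from powr_has_deriv[OF this, of "1 - \<xi>"]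
    have "((\<lambda>t. t powr (1 - \<xi>) / (1 - \<xi>)) has_real_derivative (1 - \<xi>) * x powr (1 - \<xi> - 1) / (1 - \<xi>)) (at x)"
      by (rule DERIV_cdivide)
    then show "((\<lambda>t. t powr (1 - \<xi>) / (1 - \<xi>)) has_vector_derivative x powr (- \<xi>)) (at x)"
      unfolding has_real_derivative_iff_has_vector_derivative[symmetric] using assms by simp
  qed
  then show ?thesis by (simp add: diff_divide_distrib)
qed

context exponent
begin

text \<open>By the product rule and the equation for \<open>M\<close>, the function
  \<open>t * M (- ln t - u)\<close> is an antiderivative. It equals
  \<open>exp (- u) * K (- ln t - u)\<close> for positive \<open>t\<close>, hence tends to 0 at 0.
  The condition on \<open>d\<close> keeps all arguments in the range where \<open>M\<close> is
  differentiable.\<close>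

lemma log_power_has_integral:
  assumes "0 \<le> c" "c < d" "- 2 < - ln d - u"
  shows "((\<lambda>t. \<bar>- ln t - u\<bar> powr p) has_integral (d * M (- ln d - u) - c * M (- ln c - u))) {c..d}"
proof (rule fundamental_theorem_of_calculus_interior)
  have d: "0 < d" using assms by simp
  have gt: "- 2 < - ln x - u" if "0 < x" "x \<le> d" for x
    using ln_le_cancel_iff[OF that(1) d] that assms(3) by linarith
  have D: "((\<lambda>t. t * M (- ln t - u)) has_real_derivative \<bar>- ln x - u\<bar> powr p) (at x)" if x: "0 < x" "x \<le> d" for x
  proof -
    have "((\<lambda>t. M (- ln t - u)) has_real_derivative m (- ln x - u) * (- (1 / x))) (at x)"
      by (rule DERIV_chain2[where f = M and g = "\<lambda>t. - ln t - u", OF M_deriv[OF gt[OF x]]])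
        (use x in \<open>auto intro!: derivative_eq_intros simp: divide_inverse\<close>)
    from DERIV_mult[OF DERIV_ident this]
    have "((\<lambda>t. t * M (- ln t - u)) has_real_derivative (M (- ln x - u) - m (- ln x - u))) (at x)"
      using x by (auto elim!: DERIV_cong)
    then show ?thesis by (simp add: m_def)
  qed
  show "continuous_on {c..d} (\<lambda>t. t * M (- ln t - u))"
    unfolding continuous_on_eq_continuous_within
  proof
    fix x assume x: "x \<in> {c..d}"
    show "continuous (at x within {c..d}) (\<lambda>t. t * M (- ln t - u))"
    proof (cases "x = 0")
      case False
      then have "isCont (\<lambda>t. t * M (- ln t - u)) x" using DERIV_isCont[OF D[of x]] x assms by simp
      then show ?thesis by (rule continuous_at_imp_continuous_at_within)
    next
      case True
      have "filterlim (\<lambda>t::real. - ln t - u) at_top (at_right 0)" by real_asymp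
      then have "((\<lambda>t. K (- ln t - u)) \<longlongrightarrow> 0) (at_right 0)" using K_tendsto by (rule filterlim_compose[rotated])
      then have "((\<lambda>t. exp (- u) * K (- ln t - u)) \<longlongrightarrow> exp (- u) * 0) (at_right 0)" by (intro tendsto_intros)
      then have z: "((\<lambda>t. exp (- u) * K (- ln t - u)) \<longlongrightarrow> 0) (at_right 0)" by simp
      have "((\<lambda>t. t * M (- ln t - u)) \<longlongrightarrow> 0) (at_right 0)"
      proof (rule Lim_transform_eventually[OF z])
        show "\<forall>\<^sub>F t in at_right 0. exp (- u) * K (- ln t - u) = t * M (- ln t - u)"
          unfolding eventually_at_right_field
          by (intro exI[of _ 1]) (auto simp: M_def exp_diff exp_minus field_simps)
      qed
      then have "((\<lambda>t. t * M (- ln t - u)) \<longlongrightarrow> 0) (at 0 within {0<..})" by simp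
      then have "((\<lambda>t. t * M (- ln t - u)) \<longlongrightarrow> 0) (at 0 within {c..d})"
        by (subst (asm) at_within_Ici_at_right[symmetric]) (rule tendsto_within_subset, auto simp: assms(1)[THEN order_trans] assms)
      then show ?thesis using True by (simp add: continuous_within)
    qed
  qed
  fix x assume "x \<in> {c<..<d}"
  then show "((\<lambda>t. t * M (- ln t - u)) has_vector_derivative \<bar>- ln x - u\<bar> powr p) (at x)"
    unfolding has_real_derivative_iff_has_vector_derivative[symmetric] using D[of x] assms by simp
qed (use assms in simp)

text \<open>The hypothesis says that \<open>u\<close> is the mean of \<open>- ln t\<close> over the
  interval from \<open>c\<close> to \<open>d\<close>. It makes \<open>- ln d - u\<close> a convex
  combination of \<open>- 1\<close> and \<open>- ln c - u\<close> with weights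
  \<open>1 - c / d\<close> and \<open>c / d\<close>, and convexity of \<open>M\<close> gives the
  second claim. For \<open>c = 0\<close> there is equality: intervals that reach the singularity are
  extremal.\<close>

lemma log_mean_le:
  assumes "0 \<le> c" "c < d" "(d - c) * u = d * (1 - ln d) - c * (1 - ln c)"
  shows "- 1 \<le> - ln d - u" "d * M (- ln d - u) - c * M (- ln c - u) \<le> (d - c) * M (- 1)"
proof -
  have "c * (1 - ln d) \<le> c * (1 - ln c)"
    using assms by (cases "c = 0") (auto intro!: mult_left_mono)
  then have "(d - c) * u \<le> (d - c) * (1 - ln d)" using assms(3) by (simp add: algebra_simps)
  then have "u \<le> 1 - ln d" using assms(2) by (simp only: mult_le_cancel_left_pos diff_gt_0_iff_gt)
  then show 1: "- 1 \<le> - ln d - u" by simp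
  show "d * M (- ln d - u) - c * M (- ln c - u) \<le> (d - c) * M (- 1)"
  proof (cases "c = 0")
    case True
    then have "d * u = d * (1 - ln d)" using assms(3) by simp
    then have "u = 1 - ln d" using assms True by simp
    then show ?thesis using True by simp
  next
    case False
    then have c: "0 < c" using assms by simp
    have "ln c \<le> ln d" using c assms by simp
    then have 2: "- 1 \<le> - ln c - u" using 1 by simp
    have "M ((1 - c / d) *\<^sub>R (- 1) + (c / d) *\<^sub>R (- ln c - u)) \<le> (1 - c / d) * M (- 1) + (c / d) * M (- ln c - u)"
      by (rule convex_onD[OF M_convex]) (use c assms 2 in auto)
    also have "(1 - c / d) *\<^sub>R (- 1) + (c / d) *\<^sub>R (- ln c - u) = - ln d - u"
    proof -
      have "d * ((1 - c / d) *\<^sub>R (- 1) + (c / d) *\<^sub>R (- ln c - u)) = (c - d) + c * (- ln c - u)"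
        using assms by (simp add: field_simps)
      also have "\<dots> = d * (- ln d - u)" using assms(3) by (simp add: algebra_simps)
      finally show ?thesis using assms by simp
    qed
    finally have "d * M (- ln d - u) \<le> d * ((1 - c / d) * M (- 1) + (c / d) * M (- ln c - u))"
      using assms by (intro mult_left_mono) auto
    also have "\<dots> = (d - c) * M (- 1) + c * M (- ln c - u)" using assms by (simp add: field_simps)
    finally show ?thesis by simp
  qed
qed

end

definition log_weight :: "real \<Rightarrow> real \<Rightarrow> real \<Rightarrow> real" where
  "log_weight \<xi> a x = \<xi> * (- ln (x - a))"

lemma abs_integrable_on_log:
  assumes "0 \<le> c" "c < d" shows "(\<lambda>t::real. - ln t) absolutely_integrable_on {c..d}"
proof -
  have "(\<lambda>t. - ln t + ln d) absolutely_integrable_on {c<..<d}"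
  proof (rule nonnegative_absolutely_integrable_1)
    have "(\<lambda>t. - ln t + ln d) integrable_on {c..d}"
      using ln_has_integral[of c d] assms by (intro Henstock_Kurzweil_Integration.integrable_add) auto
    then show "(\<lambda>t. - ln t + ln d) integrable_on {c<..<d}" by (simp add: integrable_on_Icc_iff_Ioo)
    show "0 \<le> - ln t + ln d" if "t \<in> {c<..<d}" for t using that assms by auto
  qed
  then have "(\<lambda>t. - ln t + ln d) absolutely_integrable_on {c..d}"
    using absolutely_integrable_on_open_interval[of c d "\<lambda>t. - ln t + ln d"] by simp
  from set_integral_diff(1)[OF this absolutely_integrable_on_const[of "{c..d}" "ln d"]]
  show ?thesis by simp
qed

lemma abs_integrable_translate:
  fixes f :: "real \<Rightarrow> real"
  assumes "f absolutely_integrable_on {c..d}" shows "(\<lambda>x. f (x - a)) absolutely_integrable_on {a + c..a + d}"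
proof -
  have "f integrable_on {c..d}" "(\<lambda>x. \<bar>f x\<bar>) integrable_on {c..d}"
    using assms set_integrable_abs[OF assms] set_lebesgue_integral_eq_integral(1) by blast+
  then obtain i j where "(f has_integral i) {c..d}" "((\<lambda>x. \<bar>f x\<bar>) has_integral j) {c..d}" by blast
  from has_integral_translate[OF this(1), of a] has_integral_translate[OF this(2), of a]
  show ?thesis unfolding absolutely_integrable_on_def by auto
qed

text \<open>Here \<open>c\<close> and \<open>d\<close> are the distances of the endpoints from the
  singularity at \<open>a\<close>, so \<open>c = 0\<close> means that \<open>J\<close> reaches
  it.\<close>

locale log_interval = interval_endpoints J "a + c" "a + d" for J a c d +
  assumes c0: "0 \<le> c"
begin

lemma cd: "c < d" using ab by simp

definition u :: real where "u = (d * (1 - ln d) - c * (1 - ln c)) / (d - c)"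

lemma u_eq: "(d - c) * u = d * (1 - ln d) - c * (1 - ln c)" using cd by (simp add: u_def)

lemma log_int: "log_weight \<xi> a absolutely_integrable_on {a + c..a + d}"
  unfolding log_weight_def[abs_def]
  by (intro set_integrable_mult_right abs_integrable_translate[OF abs_integrable_on_log[OF c0 cd]])

lemma log_avg: "avg J (log_weight \<xi> a) = \<xi> * u"
proof -
  have "((\<lambda>x. \<xi> * (- ln (x - a))) has_integral \<xi> * (d * (1 - ln d) - c * (1 - ln c))) {a + c..a + d}"
    using has_integral_translate[OF ln_has_integral[OF c0 less_imp_le[OF cd]]] by (rule has_integral_mult_right)
  then have "integral {a + c..a + d} (log_weight \<xi> a) = \<xi> * (d * (1 - ln d) - c * (1 - ln c))"
    unfolding log_weight_def[abs_def] by (rule integral_unique)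
  then show ?thesis using avg_J[OF log_int] by (simp add: u_def)
qed

lemma log_osc:
  assumes "exponent p"
  shows "nn_avg J (\<lambda>x. \<bar>log_weight \<xi> a x - avg J (log_weight \<xi> a)\<bar> powr p)
    = ennreal (\<bar>\<xi>\<bar> powr p * ((d * exponent.M p (- ln d - u) - c * exponent.M p (- ln c - u)) / (d - c)))"
proof -
  interpret exponent p by (rule assms)
  have "- 2 < - ln d - u" using log_mean_le(1)[OF c0 cd u_eq] by simp
  note h = has_integral_translate[OF log_power_has_integral[OF c0 cd this], of a]
  have eq: "\<bar>log_weight \<xi> a x - avg J (log_weight \<xi> a)\<bar> powr p = \<bar>\<xi>\<bar> powr p * \<bar>- ln (x - a) - u\<bar> powr p" for x
  proof -
    have "log_weight \<xi> a x - avg J (log_weight \<xi> a) = \<xi> * (- ln (x - a) - u)"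
      unfolding log_avg by (simp add: log_weight_def algebra_simps)
    then show ?thesis by (simp add: abs_mult powr_mult)
  qed
  have i: "(\<lambda>x. \<bar>- ln (x - a) - u\<bar> powr p) absolutely_integrable_on {a + c..a + d}"
    using h by (intro nonnegative_absolutely_integrable_1) auto
  show ?thesis unfolding eq
    using nn_avg_J_real[OF set_integrable_mult_right[OF i]] h by (simp add: integral_unique)
qed

lemma log_ratio:
  assumes "\<xi> < 1"
  shows "nn_avg J (\<lambda>x. exp (log_weight \<xi> a x)) * ennreal (exp (- avg J (log_weight \<xi> a)))
    = ennreal (((d powr (1 - \<xi>) - c powr (1 - \<xi>)) / (1 - \<xi>)) / (d - c) * exp (- \<xi> * u))"
    and "(\<lambda>x. exp (log_weight \<xi> a x)) absolutely_integrable_on {a + c..a + d}"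
proof -
  have "((\<lambda>t. exp (\<xi> * (- ln t))) has_integral (d powr (1 - \<xi>) - c powr (1 - \<xi>)) / (1 - \<xi>)) {c..d}"
  proof (rule has_integral_spike_finite[rotated 2, OF powr_has_integral[OF c0 less_imp_le[OF cd] assms]])
    show "finite {0::real}" by simp
    show "exp (\<xi> * (- ln t)) = t powr (- \<xi>)" if "t \<in> {c..d} - {0}" for t using that c0 by (simp add: powr_def)
  qed
  note h = has_integral_translate[OF this, of a, folded log_weight_def]
  show i: "(\<lambda>x. exp (log_weight \<xi> a x)) absolutely_integrable_on {a + c..a + d}"
    using h by (intro nonnegative_absolutely_integrable_1) auto
  have "0 \<le> (d powr (1 - \<xi>) - c powr (1 - \<xi>)) / (1 - \<xi>) / (d - c)"
    using cd c0 assms by (intro divide_nonneg_pos) (auto intro!: powr_mono2)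
  then show "nn_avg J (\<lambda>x. exp (log_weight \<xi> a x)) * ennreal (exp (- avg J (log_weight \<xi> a)))
    = ennreal (((d powr (1 - \<xi>) - c powr (1 - \<xi>)) / (1 - \<xi>)) / (d - c) * exp (- \<xi> * u))"
  proof -
    assume nn: "0 \<le> (d powr (1 - \<xi>) - c powr (1 - \<xi>)) / (1 - \<xi>) / (d - c)"
    have "nn_avg J (\<lambda>x. exp (log_weight \<xi> a x)) = ennreal ((d powr (1 - \<xi>) - c powr (1 - \<xi>)) / (1 - \<xi>) / (d - c))"
      using nn_avg_J_real[OF i] integral_unique[OF h] by simp
    then show ?thesis unfolding log_avg using nn by (simp only: ennreal_mult exp_ge_zero mult_minus_left)
  qed
qed

text \<open>The averages over \<open>(0, t)\<close> run along the curve \<open>y = C e\<^sup>x\<close>, and the average over \<open>(c, d)\<close>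
  lies on the extension of a chord of this convex curve.\<close>

lemma log_ratio_le:
  assumes "\<xi> < 1"
  shows "((d powr (1 - \<xi>) - c powr (1 - \<xi>)) / (1 - \<xi>)) / (d - c) * exp (- \<xi> * u) \<le> exp (- \<xi>) / (1 - \<xi>)"
proof -
  \<comment> \<open>The mean of the logarithm over the interval from the singularity to distance
    \<open>t\<close> is \<open>\<xi> * (1 - ln t)\<close>; this expresses \<open>t\<close> times its
    exponential through the antiderivative of the weight.\<close>
  have e: "t * exp (\<xi> * (1 - ln t)) = exp \<xi> * t powr (1 - \<xi>)" if "0 \<le> t" for t
  proof (cases "t = 0")
    case False
    then have "0 < t" using that by simp
    then have "exp \<xi> * t powr (1 - \<xi>) = exp (\<xi> + (1 - \<xi>) * ln t)" by (simp add: powr_def exp_add)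
    also have "\<xi> + (1 - \<xi>) * ln t = ln t + (\<xi> - \<xi> * ln t)" by (simp add: algebra_simps)
    also have "exp \<dots> = exp (ln t) * exp (\<xi> - \<xi> * ln t)" by (rule exp_add)
    also have "exp (ln t) = t" using \<open>0 < t\<close> by simp
    finally show ?thesis by (simp add: algebra_simps)
  qed simp
  have d0: "0 < d" using c0 cd by simp
  have "exp ((1 - c / d) *\<^sub>R (\<xi> * u) + (c / d) *\<^sub>R (\<xi> * (1 - ln c))) \<le> (1 - c / d) * exp (\<xi> * u) + (c / d) * exp (\<xi> * (1 - ln c))"
    by (rule convex_onD[OF exp_convex]) (use c0 cd d0 in auto)
  also have "(1 - c / d) *\<^sub>R (\<xi> * u) + (c / d) *\<^sub>R (\<xi> * (1 - ln c)) = \<xi> * (1 - ln d)"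
  proof -
    have "d * ((1 - c / d) *\<^sub>R (\<xi> * u) + (c / d) *\<^sub>R (\<xi> * (1 - ln c))) = \<xi> * ((d - c) * u + c * (1 - ln c))"
      using d0 by (simp add: field_simps)
    also have "\<dots> = d * (\<xi> * (1 - ln d))" unfolding u_eq by simp
    finally show ?thesis using d0 by simp
  qed
  finally have "d * exp (\<xi> * (1 - ln d)) \<le> d * ((1 - c / d) * exp (\<xi> * u) + (c / d) * exp (\<xi> * (1 - ln c)))"
    using d0 by (intro mult_left_mono) auto
  also have "\<dots> = (d - c) * exp (\<xi> * u) + c * exp (\<xi> * (1 - ln c))" using d0 by (simp add: field_simps)
  finally have "exp \<xi> * d powr (1 - \<xi>) - exp \<xi> * c powr (1 - \<xi>) \<le> (d - c) * exp (\<xi> * u)"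
    using e[of d] e[of c] c0 d0 by simp
  then have "exp \<xi> * (d powr (1 - \<xi>) - c powr (1 - \<xi>)) * (exp (- \<xi>) * exp (- \<xi> * u)) \<le> (d - c) * exp (\<xi> * u) * (exp (- \<xi>) * exp (- \<xi> * u))"
    by (intro mult_right_mono) (auto simp: algebra_simps)
  moreover have "exp \<xi> * (d powr (1 - \<xi>) - c powr (1 - \<xi>)) * (exp (- \<xi>) * exp (- \<xi> * u)) = (d powr (1 - \<xi>) - c powr (1 - \<xi>)) * exp (- \<xi> * u)"
    by (simp add: exp_minus)
  moreover have "(d - c) * exp (\<xi> * u) * (exp (- \<xi>) * exp (- \<xi> * u)) = (d - c) * exp (- \<xi>)" by (simp add: exp_minus)
  ultimately have "(d powr (1 - \<xi>) - c powr (1 - \<xi>)) * exp (- \<xi> * u) \<le> (d - c) * exp (- \<xi>)" by (simp only:)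
  then have "(d powr (1 - \<xi>) - c powr (1 - \<xi>)) * exp (- \<xi> * u) / ((1 - \<xi>) * (d - c)) \<le> (d - c) * exp (- \<xi>) / ((1 - \<xi>) * (d - c))"
    using assms cd by (intro divide_right_mono) auto
  then show ?thesis using cd by (simp add: mult.commute)
qed

end

lemma log_intervalI:
  assumes "interval_endpoints J x y" "a \<le> x" shows "log_interval J a (x - a) (y - a)"
  using assms by (simp add: log_interval_def log_interval_axioms_def)

lemma subinterval_log_interval:
  assumes "Q \<subseteq> {a..}" "J \<in> subintervals Q"
  obtains c d where "log_interval J a c d"
proof -
  obtain x y where ie: "interval_endpoints J x y" and sub: "{x<..<y} \<subseteq> Q" by (rule subinterval_endpoints[OF assms(2)])
  have "x < y" using ie by (simp add: interval_endpoints_def)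
  have "a \<le> x"
  proof (rule dense_ge_bounded[OF \<open>x < y\<close>])
    fix z assume "x < z" "z < y"
    then show "a \<le> z" using sub assms(1) by auto
  qed
  then show ?thesis using that log_intervalI[OF ie] by blast
qed

lemma log_weight_bmo_le:
  assumes "exponent p" "Q \<subseteq> {a..}"
  shows "bmo_norm p Q (log_weight \<xi> a) \<le> ennreal (\<bar>\<xi>\<bar> * exponent.M p (- 1) powr (1 / p))"
proof -
  interpret exponent p by (rule assms(1))
  have M0: "0 < M (- 1)" by (rule M_pos) simp
  have B: "(\<bar>\<xi>\<bar> * M (- 1) powr (1 / p)) powr p = \<bar>\<xi>\<bar> powr p * M (- 1)"
    using M0 p by (simp add: powr_mult powr_powr powr_one')
  have "nn_avg J (\<lambda>x. \<bar>log_weight \<xi> a x - avg J (log_weight \<xi> a)\<bar> powr p) \<le> ennreal (\<bar>\<xi>\<bar> powr p * M (- 1))"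
    if J: "J \<in> subintervals Q" for J
  proof -
    obtain c d where "log_interval J a c d" by (rule subinterval_log_interval[OF assms(2) J])
    then interpret log_interval J a c d .
    have "(d * M (- ln d - u) - c * M (- ln c - u)) / (d - c) \<le> M (- 1)"
      using log_mean_le(2)[OF c0 cd u_eq] cd by (simp add: field_simps)
    then show ?thesis unfolding log_osc[OF assms(1)] by (intro ennreal_leI mult_left_mono) auto
  qed
  then show ?thesis using bmo_norm_le_iff[of p "\<bar>\<xi>\<bar> * M (- 1) powr (1 / p)" Q "log_weight \<xi> a"] p M0 B by simp
qed

text \<open>The bound for all subintervals is attained on the whole interval, which reaches the
  singularity.\<close>

lemma log_weight_bmo_eq:
  assumes "exponent p" "Q \<subseteq> {a..}" "{a<..<b} \<subseteq> Q" "a < b"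
  shows "bmo_norm p Q (log_weight \<xi> a) = ennreal (\<bar>\<xi>\<bar> * exponent.M p (- 1) powr (1 / p))"
proof (rule antisym[OF log_weight_bmo_le[OF assms(1,2)]])
  interpret exponent p by (rule assms(1))
  have M0: "0 < M (- 1)" by (rule M_pos) simp
  interpret log_interval "{a<..<b}" a 0 "b - a" using assms(4) by unfold_locales auto
  have "u = 1 - ln (b - a)" using assms(4) by (simp add: u_def)
  then have osc: "nn_avg {a<..<b} (\<lambda>x. \<bar>log_weight \<xi> a x - avg {a<..<b} (log_weight \<xi> a)\<bar> powr p) = ennreal (\<bar>\<xi>\<bar> powr p * M (- 1))"
    using log_osc[OF assms(1), of \<xi>] assms(4) by simp
  show "ennreal (\<bar>\<xi>\<bar> * M (- 1) powr (1 / p)) \<le> bmo_norm p Q (log_weight \<xi> a)"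
  proof (rule ennreal_le_bmo_normI)
    fix B assume B: "0 \<le> B" "bmo_norm p Q (log_weight \<xi> a) \<le> ennreal B"
    have "\<bar>\<xi>\<bar> powr p * M (- 1) \<le> B powr p"
      using bmo_norm_le_iff[of p B Q "log_weight \<xi> a"] B p osc open_interval_in_subintervals[OF assms(4,3)] by force
    then have "(\<bar>\<xi>\<bar> powr p * M (- 1)) powr (1 / p) \<le> (B powr p) powr (1 / p)"
      using M0 p by (intro powr_mono2) auto
    then show "\<bar>\<xi>\<bar> * M (- 1) powr (1 / p) \<le> B" using M0 p B by (simp add: powr_mult powr_powr powr_one')
  qed
qed

lemma log_weight_locally_integrable:
  assumes "a < b" "Q \<subseteq> {a..b}"
  shows "log_weight \<xi> a locally_integrable_on Q"
    and "\<xi> < 1 \<Longrightarrow> (\<lambda>x. exp (log_weight \<xi> a x)) locally_integrable_on Q"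
proof -
  interpret log_interval "{a<..<b}" a 0 "b - a" using assms(1) by unfold_locales auto
  have sub: "set_integrable lebesgue K f" if "f absolutely_integrable_on {a..b}" "compact K" "K \<subseteq> Q" for f :: "real \<Rightarrow> real" and K
    by (rule set_integrable_subset[OF that(1)]) (use that assms in \<open>auto simp: lmeasurable_compact fmeasurableD\<close>)
  show "log_weight \<xi> a locally_integrable_on Q"
    unfolding locally_integrable_on_def using sub log_int[of \<xi>] by simp
  show "(\<lambda>x. exp (log_weight \<xi> a x)) locally_integrable_on Q" if "\<xi> < 1"
    unfolding locally_integrable_on_def using sub log_ratio(2)[OF that] by simp
qed

text \<open>\<open>log_ratio_le\<close> bounds every ratio, and the whole interval attains the
  bound. The sign of \<open>\<xi>\<close> is free, so both roots are covered;
  \<open>\<xi> < 1\<close> makes the weight integrable at \<open>a\<close>.\<close>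

lemma log_weight_in_class:
  assumes "a < b" "{a<..<b} \<subseteq> Q" "Q \<subseteq> {a..b}" "\<xi> < 1" "C = exp (- \<xi>) / (1 - \<xi>)"
  shows "log_weight \<xi> a \<in> exp_A_infty_class Q C"
proof -
  have const: "A_infty_const Q (\<lambda>x. exp (log_weight \<xi> a x)) = ennreal C"
    unfolding A_infty_const_def ln_exp
  proof (rule antisym)
    show "(SUP J\<in>subintervals Q. nn_avg J (\<lambda>x. exp (log_weight \<xi> a x)) * ennreal (exp (- avg J (\<lambda>x. log_weight \<xi> a x)))) \<le> ennreal C"
    proof (rule SUP_least)
      fix J assume J: "J \<in> subintervals Q"
      have Q: "Q \<subseteq> {a..}" using assms(3) by auto
      obtain c d where "log_interval J a c d" by (rule subinterval_log_interval[OF Q J])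
      then interpret log_interval J a c d .
      show "nn_avg J (\<lambda>x. exp (log_weight \<xi> a x)) * ennreal (exp (- avg J (\<lambda>x. log_weight \<xi> a x))) \<le> ennreal C"
        unfolding log_ratio(1)[OF assms(4)] assms(5) by (rule ennreal_leI[OF log_ratio_le[OF assms(4)]])
    qed
    interpret log_interval "{a<..<b}" a 0 "b - a" using assms(1) by unfold_locales auto
    define L where "L = b - a"
    have L: "0 < L" using assms(1) by (simp add: L_def)
    have "u = 1 - ln L" using assms(1) by (simp add: u_def L_def)
    then have "exp (- \<xi> * u) = exp (- \<xi>) * L powr \<xi>" 
      using L by (simp add: powr_def right_diff_distrib flip: exp_add)
    then have "((L powr (1 - \<xi>) - 0 powr (1 - \<xi>)) / (1 - \<xi>)) / (L - 0) * exp (- \<xi> * u) = (L powr (1 - \<xi>) * L powr \<xi>) / L * (exp (- \<xi>) / (1 - \<xi>))"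
      by (simp add: mult_ac)
    also have "L powr (1 - \<xi>) * L powr \<xi> = L" using L by (simp flip: powr_add)
    finally have "nn_avg {a<..<b} (\<lambda>x. exp (log_weight \<xi> a x)) * ennreal (exp (- avg {a<..<b} (log_weight \<xi> a))) = ennreal C"
      unfolding log_ratio(1)[OF assms(4)] L_def using L assms(5) by (simp add: L_def)
    then show "ennreal C \<le> (SUP J\<in>subintervals Q. nn_avg J (\<lambda>x. exp (log_weight \<xi> a x)) * ennreal (exp (- avg J (\<lambda>x. log_weight \<xi> a x))))"
      by (metis (no_types, lifting) SUP_upper open_interval_in_subintervals[OF assms(1,2)])
  qed
  then show ?thesis
    unfolding exp_A_infty_class_def A_infty_def
    using log_weight_locally_integrable[OF assms(1,3)] assms(4) by simp
qed

section \<open>The John--Nirenberg constant\<close>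

lemma apow'_mono: assumes "1 < p" "s \<le> t" shows "apow' p s \<le> apow' p t"
  by (rule deriv_nonneg_imp_le_except_zero[where f' = "apow'' p"])
    (use assms apow'_deriv in \<open>auto simp: apow''_def intro: continuous_on_subset[OF apow'_cont]\<close>)

lemma apow_tangent: assumes "1 < p" shows "\<bar>x\<bar> powr p + apow' p x * (y - x) \<le> \<bar>y\<bar> powr p"
proof -
  note mono = apow'_mono[OF assms]
  define g where "g t = \<bar>t\<bar> powr p - apow' p x * t" for t
  have dg: "(g has_real_derivative apow' p t - apow' p x) (at t)" for t
    unfolding g_def[abs_def] by (rule DERIV_diff[OF apow_deriv[OF assms]]) (auto intro!: derivative_eq_intros)
  have "g x \<le> g y"
  proof (cases "x \<le> y")
    case True
    then show ?thesis
      by (rule DERIV_nonneg_imp_nondecreasing) (use dg mono[of x] in \<open>force intro!: exI[of _ "apow' p _ - apow' p x"]\<close>)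
  next
    case False
    then have "y \<le> x" by simp
    then have "- g y \<le> - g x"
    proof (rule DERIV_nonneg_imp_nondecreasing)
      fix t assume "y \<le> t" "t \<le> x"
      then show "\<exists>d. ((\<lambda>t. - g t) has_real_derivative d) (at t) \<and> 0 \<le> d"
        using DERIV_minus[OF dg[of t]] mono[of t x] by (intro exI[of _ "- (apow' p t - apow' p x)"]) auto
    qed
    then show ?thesis by simp
  qed
  then show ?thesis by (simp add: g_def algebra_simps)
qed

section \<open>Truncation\<close>

definition clamp_at :: "nat \<Rightarrow> real \<Rightarrow> real" where "clamp_at n u = max (- real n) (min (real n) u)"

lemma clamp_at_measurable[measurable]: "clamp_at n \<in> borel_measurable borel"
  unfolding clamp_at_def[abs_def] by measurable

lemma clamp_at_bound: "\<bar>clamp_at n u\<bar> \<le> real n"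
  by (auto simp: clamp_at_def)

lemma clamp_integrable:
  fixes F \<phi> :: "real \<Rightarrow> real" and a b B :: real
  assumes "set_borel_measurable lebesgue {a..b} \<phi>" "F \<in> borel_measurable borel"
    and "\<And>u. \<bar>u\<bar> \<le> real n \<Longrightarrow> \<bar>F u\<bar> \<le> B"
  shows "(\<lambda>x. F (clamp_at n (\<phi> x))) absolutely_integrable_on {a..b}"
proof (rule set_integrable_bound[where f = "\<lambda>_. B"])
  show "(\<lambda>_. B) absolutely_integrable_on {a..b}" by (simp add: absolutely_integrable_on_const)
  show "set_borel_measurable lebesgue {a..b} (\<lambda>x. F (clamp_at n (\<phi> x)))"
    by (rule borel_measurable_indicator_compose[OF assms(1), of "\<lambda>u. F (clamp_at n u)"])
      (use assms(2) in \<open>auto intro: measurable_compose[OF clamp_at_measurable]\<close>)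
  show "AE x in lebesgue. x \<in> {a..b} \<longrightarrow> norm (F (clamp_at n (\<phi> x))) \<le> norm B"
    using assms(3)[OF clamp_at_bound] by (intro AE_I2) (force intro: order_trans)
qed

text \<open>Truncation moves the values in a way that is comonotone with the values themselves; this is
  why it does not increase the mean oscillation.\<close>

lemma clamp_oscillation_le:
  fixes n :: nat and \<phi> :: "real \<Rightarrow> real"
  assumes p: "1 < p" and "a < b" and i: "\<phi> absolutely_integrable_on {a..b}"
    and ip: "(\<lambda>x. \<bar>\<phi> x - integral {a..b} \<phi> / (b - a)\<bar> powr p) absolutely_integrable_on {a..b}"
  defines "g \<equiv> \<lambda>x. clamp_at n (\<phi> x)"
  shows "g absolutely_integrable_on {a..b}"
    "(\<lambda>x. \<bar>g x - integral {a..b} g / (b - a)\<bar> powr p) absolutely_integrable_on {a..b}"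
    "integral {a..b} (\<lambda>x. \<bar>g x - integral {a..b} g / (b - a)\<bar> powr p)
      \<le> integral {a..b} (\<lambda>x. \<bar>\<phi> x - integral {a..b} \<phi> / (b - a)\<bar> powr p)"
proof -
  note m\<phi> = set_integrable_imp_set_borel_measurable[OF i]
  show ig: "g absolutely_integrable_on {a..b}"
    unfolding g_def by (rule clamp_integrable[OF m\<phi>, of "\<lambda>u. u" n "real n"]) auto
  define M where "M = integral {a..b} \<phi> / (b - a)"
  define m where "m = integral {a..b} g / (b - a)"
  define h where "h x = \<phi> x - g x" for x
  define D where "D x = apow' p (g x - m)" for x
  have bm: "\<bar>u - m\<bar> \<le> real n + \<bar>m\<bar>" if "\<bar>u\<bar> \<le> real n" for u using that by linarith
  have pm: "(\<lambda>u. \<bar>u - m\<bar> powr p) \<in> borel_measurable borel" by measurable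
  show igp: "(\<lambda>x. \<bar>g x - integral {a..b} g / (b - a)\<bar> powr p) absolutely_integrable_on {a..b}"
    unfolding g_def[symmetric] m_def[symmetric] unfolding g_def
  proof (rule clamp_integrable[OF m\<phi> pm, of n "(real n + \<bar>m\<bar>) powr p"])
    show "\<bar>\<bar>u - m\<bar> powr p\<bar> \<le> (real n + \<bar>m\<bar>) powr p" if "\<bar>u\<bar> \<le> real n" for u
      using bm[OF that] p by (simp add: powr_mono2)
  qed
  have dm: "(\<lambda>u. apow' p (u - m)) \<in> borel_measurable borel"
    by (rule measurable_compose[OF _ borel_measurable_continuous_onI[OF apow'_cont[OF p]]]) measurable
  have iD: "D absolutely_integrable_on {a..b}" unfolding D_def g_def
  proof (rule clamp_integrable[OF m\<phi> dm, of n "p * (real n + \<bar>m\<bar>) powr (p - 1)"])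
    fix u assume "\<bar>u\<bar> \<le> real n"
    then have "\<bar>u - m\<bar> powr (p - 1) \<le> (real n + \<bar>m\<bar>) powr (p - 1)" using bm p by (intro powr_mono2) auto
    then show "\<bar>apow' p (u - m)\<bar> \<le> p * (real n + \<bar>m\<bar>) powr (p - 1)"
      using p by (auto simp: apow'_def abs_mult sgn_if)
  qed
  define A where "A = integral {a..b} D / (b - a)"
  define L where "L = apow' p (- real n - m)"
  define R where "R = apow' p (real n - m)"
  have DLR: "L \<le> D x" "D x \<le> R" for x
    using clamp_at_bound[of n "\<phi> x"] p unfolding L_def R_def D_def g_def by (auto intro!: apow'_mono)
  have iD': "D integrable_on {a..b}" using iD by (rule set_lebesgue_integral_eq_integral(1))
  have AR: "A \<le> R"
  proof -
    have "integral {a..b} D \<le> integral {a..b} (\<lambda>_. R)" by (rule integral_le) (use iD' DLR in auto)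
    then show ?thesis using \<open>a < b\<close> by (simp add: A_def field_simps)
  qed
  have LA: "L \<le> A"
  proof -
    have "integral {a..b} (\<lambda>_. L) \<le> integral {a..b} D" by (rule integral_le) (use iD' DLR in auto)
    then show ?thesis using \<open>a < b\<close> by (simp add: A_def field_simps)
  qed
  \<comment> \<open>\<open>h\<close> is nonzero only where the truncation acts. There
    \<open>g\<close> is at an end of its range and so is \<open>D\<close>, a monotone function of
    \<open>g\<close>; hence \<open>D\<close> is on the right side of its mean
    \<open>A\<close>.\<close>
  have com: "0 \<le> (D x - A) * h x" for x
  proof -
    consider "\<phi> x > real n" | "\<phi> x < - real n" | "\<bar>\<phi> x\<bar> \<le> real n" by linarith
    then show ?thesis
    proof cases
      case 1
      then have "g x = real n" by (simp add: g_def clamp_at_def)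
      then show ?thesis using 1 AR by (simp add: D_def R_def h_def)
    next
      case 2
      then have "g x = - real n" by (simp add: g_def clamp_at_def)
      then show ?thesis using 2 LA by (intro mult_nonpos_nonpos) (simp_all add: D_def L_def h_def)
    next
      case 3
      then have "g x = \<phi> x" by (auto simp: g_def clamp_at_def)
      then show ?thesis by (simp add: h_def)
    qed
  qed
  \<comment> \<open>The tangent inequality at \<open>g x - m\<close>, with the nonnegative product
    from \<open>com\<close> dropped and the rest arranged so that everything added to
    \<open>\<bar>g x - m\<bar> powr p\<close> has integral 0.\<close>
  have tan: "\<bar>g x - m\<bar> powr p + (A * (h x - (M - m)) + (D x - A) * (- (M - m))) \<le> \<bar>\<phi> x - M\<bar> powr p" for x
  proof -
    have "\<bar>g x - m\<bar> powr p + D x * ((\<phi> x - M) - (g x - m)) \<le> \<bar>\<phi> x - M\<bar> powr p"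
      unfolding D_def by (rule apow_tangent[OF p])
    moreover have "(\<phi> x - M) - (g x - m) = h x - (M - m)" by (simp add: h_def)
    moreover have "D x * (h x - (M - m)) = (D x - A) * h x + (A * (h x - (M - m)) + (D x - A) * (- (M - m)))" by (simp add: algebra_simps)
    ultimately show ?thesis using com[of x] by simp
  qed
  have ih: "h integrable_on {a..b}" unfolding h_def
    using i ig by (intro Henstock_Kurzweil_Integration.integrable_diff set_lebesgue_integral_eq_integral(1))
  have c: "((\<lambda>_. k) has_integral k * (b - a)) {a..b}" for k :: real
    using has_integral_const_real[of k a b] \<open>a < b\<close> by (simp add: mult.commute)
  have hI: "integral {a..b} h = (b - a) * (M - m)"
    unfolding h_def using i ig \<open>a < b\<close>
    by (subst Henstock_Kurzweil_Integration.integral_diff) (auto intro: set_lebesgue_integral_eq_integral(1) simp: M_def m_def right_diff_distrib)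
  have DI: "integral {a..b} D = (b - a) * A" using \<open>a < b\<close> by (simp add: A_def)
  have igp': "((\<lambda>x. \<bar>g x - m\<bar> powr p) has_integral integral {a..b} (\<lambda>x. \<bar>g x - m\<bar> powr p)) {a..b}"
    using set_lebesgue_integral_eq_integral(1)[OF igp] by (simp add: m_def integrable_integral)
  have lhs: "((\<lambda>x. \<bar>g x - m\<bar> powr p + (A * (h x - (M - m)) + (D x - A) * (- (M - m)))) has_integral
     (integral {a..b} (\<lambda>x. \<bar>g x - m\<bar> powr p) + (A * (integral {a..b} h - (M - m) * (b - a)) + (integral {a..b} D - A * (b - a)) * (- (M - m))))) {a..b}"
    by (intro has_integral_add igp' has_integral_mult_right has_integral_mult_left has_integral_diff c integrable_integral ih iD')
  have rhs: "((\<lambda>x. \<bar>\<phi> x - M\<bar> powr p) has_integral integral {a..b} (\<lambda>x. \<bar>\<phi> x - M\<bar> powr p)) {a..b}"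
    using set_lebesgue_integral_eq_integral(1)[OF ip] by (simp add: M_def integrable_integral)
  show "integral {a..b} (\<lambda>x. \<bar>g x - integral {a..b} g / (b - a)\<bar> powr p)
      \<le> integral {a..b} (\<lambda>x. \<bar>\<phi> x - integral {a..b} \<phi> / (b - a)\<bar> powr p)"
    using has_integral_le[OF lhs rhs tan] unfolding hI DI M_def[symmetric] m_def[symmetric] by (simp add: mult.commute)
qed

lemma ratio_ge_one:
  fixes \<phi> :: "real \<Rightarrow> real"
  assumes "a < b" "\<phi> absolutely_integrable_on {a..b}" "(\<lambda>x. exp (\<phi> x)) absolutely_integrable_on {a..b}"
  shows "exp (integral {a..b} \<phi> / (b - a)) \<le> integral {a..b} (\<lambda>x. exp (\<phi> x)) / (b - a)"
proof -
  define c where "c = integral {a..b} \<phi> / (b - a)"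
  note i = set_lebesgue_integral_eq_integral(1)[OF assms(2)] set_lebesgue_integral_eq_integral(1)[OF assms(3)]
  obtain m where m: "\<And>u. exp c + m * (u - c) \<le> exp u" using exp_subgradient by blast
  have k: "((\<lambda>_. k) has_integral k * (b - a)) {a..b}" for k :: real
    using has_integral_const_real[of k a b] assms(1) by (simp add: mult.commute)
  have "((\<lambda>x. exp c + m * (\<phi> x - c)) has_integral exp c * (b - a) + m * (integral {a..b} \<phi> - c * (b - a))) {a..b}"
    by (intro has_integral_add has_integral_mult_right has_integral_diff k integrable_integral i)
  from has_integral_le[OF this integrable_integral[OF i(2)] m]
  have "exp c * (b - a) + m * (integral {a..b} \<phi> - c * (b - a)) \<le> integral {a..b} (\<lambda>x. exp (\<phi> x))" .
  moreover have "integral {a..b} \<phi> - c * (b - a) = 0" using assms(1) by (simp add: c_def)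
  ultimately show ?thesis using assms(1) by (simp add: c_def[symmetric] pos_le_divide_eq)
qed

lemma bounded_in_class:
  assumes "a0 < b0" "{a0<..<b0} \<subseteq> Q" "\<phi> locally_integrable_on Q"
  obtains C where "1 \<le> C" "(\<lambda>x. clamp_at n (\<phi> x)) \<in> exp_A_infty_class Q C"
proof -
  define g where "g x = clamp_at n (\<phi> x)" for x
  have gb: "\<bar>g x\<bar> \<le> real n" for x using clamp_at_bound by (simp add: g_def)
  have K: "set_integrable lebesgue K (\<lambda>x. F (g x))" if "compact K" "K \<subseteq> Q" "F \<in> borel_measurable borel" "\<And>u. \<bar>u\<bar> \<le> real n \<Longrightarrow> \<bar>F u\<bar> \<le> B" for K B and F :: "real \<Rightarrow> real"
  proof (rule set_integrable_bound[where f = "\<lambda>_. B"])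
    have lm: "K \<in> lmeasurable" by (rule lmeasurable_compact[OF that(1)])
    then show "(\<lambda>_. B) absolutely_integrable_on K" by (rule absolutely_integrable_on_const)
    have "set_borel_measurable lebesgue K \<phi>"
      using assms(3) that by (auto simp: locally_integrable_on_def intro: set_integrable_imp_set_borel_measurable)
    then show "set_borel_measurable lebesgue K (\<lambda>x. F (g x))" unfolding g_def
      by (rule borel_measurable_indicator_compose[where F = "\<lambda>u. F (clamp_at n u)"])
        (use lm that(3) in \<open>auto intro: measurable_compose[OF clamp_at_measurable]\<close>)
    show "AE x in lebesgue. x \<in> K \<longrightarrow> norm (F (g x)) \<le> norm B"
      using that(4)[OF gb] by (intro AE_I2) (force intro: order_trans)
  qed
  have li: "g locally_integrable_on Q" unfolding locally_integrable_on_def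
  proof (intro allI impI)
    fix S assume "compact S \<and> S \<subseteq> Q"
    then show "set_integrable lebesgue S g" using K[of S "\<lambda>u. u" "real n"] by simp
  qed
  have le: "(\<lambda>x. exp (g x)) locally_integrable_on Q" unfolding locally_integrable_on_def
  proof (intro allI impI)
    fix S assume "compact S \<and> S \<subseteq> Q"
    then show "set_integrable lebesgue S (\<lambda>x. exp (g x))" using K[of S exp "exp (real n)"] by simp
  qed
  have gi: "g absolutely_integrable_on {a..b}" "(\<lambda>x. exp (g x)) absolutely_integrable_on {a..b}"
    if "a < b" "{a<..<b} \<subseteq> Q" for a b
  proof -
    have m: "set_borel_measurable lebesgue {a..b} \<phi>"
      by (rule locally_integrable_measurable[OF assms(3) that(2,1)])
    show "g absolutely_integrable_on {a..b}" unfolding g_def by (rule clamp_integrable[OF m, of "\<lambda>u. u" n "real n"]) auto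
    show "(\<lambda>x. exp (g x)) absolutely_integrable_on {a..b}" unfolding g_def by (rule clamp_integrable[OF m, of exp n "exp (real n)"]) auto
  qed
  have val: "nn_avg J (\<lambda>x. exp (g x)) * ennreal (exp (- avg J g)) = ennreal (integral {a..b} (\<lambda>x. exp (g x)) / (b - a) * exp (- (integral {a..b} g / (b - a))))"
    if "interval_endpoints J a b" "{a<..<b} \<subseteq> Q" for J a b
  proof -
    interpret interval_endpoints J a b by fact
    have l: "a < b" by (rule ab)
    have "0 \<le> integral {a..b} (\<lambda>x. exp (g x)) / (b - a)"
      using l gi(2)[OF l that(2)] by (intro divide_nonneg_pos Henstock_Kurzweil_Integration.integral_nonneg set_lebesgue_integral_eq_integral(1)) auto
    then show ?thesis using nn_avg_J_real[OF gi(2)[OF l that(2)]] avg_J[OF gi(1)[OF l that(2)]] by (simp only: ennreal_mult exp_ge_zero)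
  qed
  define S where "S = A_infty_const Q (\<lambda>x. exp (g x))"
  have S_alt: "S = (SUP J\<in>subintervals Q. nn_avg J (\<lambda>x. exp (g x)) * ennreal (exp (- avg J g)))"
    by (simp add: S_def A_infty_const_def)
  have S_le: "S \<le> ennreal (exp (real n) * exp (real n))"
    unfolding S_alt
  proof (rule SUP_least)
    fix J assume J: "J \<in> subintervals Q"
    obtain a b where ie: "interval_endpoints J a b" "{a<..<b} \<subseteq> Q" by (rule subinterval_endpoints[OF J])
    have l: "a < b" using ie(1) by (simp add: interval_endpoints_def)
    note ii = set_lebesgue_integral_eq_integral(1)[OF gi(1)[OF l ie(2)]] set_lebesgue_integral_eq_integral(1)[OF gi(2)[OF l ie(2)]]
    have "integral {a..b} (\<lambda>x. exp (g x)) \<le> integral {a..b} (\<lambda>_. exp (real n))"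
      by (rule integral_le) (use ii gb in \<open>auto simp: abs_le_iff\<close>)
    then have 1: "integral {a..b} (\<lambda>x. exp (g x)) / (b - a) \<le> exp (real n)" using l by (simp add: field_simps)
    have "integral {a..b} (\<lambda>_. - real n) \<le> integral {a..b} g"
    proof (rule integral_le)
      show "- real n \<le> g x" for x using gb[of x] by linarith
    qed (use ii in auto)
    then have 2: "- (integral {a..b} g / (b - a)) \<le> real n" using l by (simp add: field_simps)
    show "nn_avg J (\<lambda>x. exp (g x)) * ennreal (exp (- avg J g)) \<le> ennreal (exp (real n) * exp (real n))"
      unfolding val[OF ie] using 1 2 by (intro ennreal_leI mult_mono) auto
  qed
  then have S_fin: "S < \<infinity>" by (rule le_less_trans) simp
  define C where "C = enn2real S"
  have SC: "S = ennreal C" using S_fin by (simp add: C_def)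
  have "1 \<le> S"
  proof -
    have J: "{a0<..<b0} \<in> subintervals Q" by (rule open_interval_in_subintervals[OF assms(1,2)])
    have ie: "interval_endpoints {a0<..<b0} a0 b0" using assms(1) by unfold_locales auto
    define c where "c = integral {a0..b0} g / (b0 - a0)"
    have "exp c * exp (- c) \<le> integral {a0..b0} (\<lambda>x. exp (g x)) / (b0 - a0) * exp (- c)"
      using ratio_ge_one[OF assms(1) gi[OF assms(1,2)]] by (intro mult_right_mono) (auto simp: c_def)
    then have "ennreal 1 \<le> ennreal (integral {a0..b0} (\<lambda>x. exp (g x)) / (b0 - a0) * exp (- c))"
      by (intro ennreal_leI) (simp flip: exp_add)
    then have "1 \<le> nn_avg {a0<..<b0} (\<lambda>x. exp (g x)) * ennreal (exp (- avg {a0<..<b0} g))"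
      unfolding val[OF ie assms(2)] c_def by simp
    also have "\<dots> \<le> S" unfolding S_alt by (rule SUP_upper[OF J])
    finally show ?thesis .
  qed
  then have "1 \<le> C" unfolding SC by simp
  moreover have "g \<in> exp_A_infty_class Q C"
    unfolding exp_A_infty_class_def A_infty_def using li le SC S_fin by (simp add: S_def)
  ultimately show ?thesis using that by (simp add: g_def[abs_def])
qed

section \<open>The value of the constant\<close>

text \<open>A larger constant would make \<open>exp_const\<close> finite at the norm of log (1/t),
  although 1/t is not integrable on the unit interval.\<close>

lemma JN_const_le:
  assumes "exponent p" shows "JN_const p \<le> ennreal (exponent.M p (- 1) powr (1 / p))"
  unfolding JN_const_def
proof (rule Sup_least)
  interpret exponent p by (rule assms)
  define \<epsilon> where "\<epsilon> = M (- 1) powr (1 / p)"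
  fix e assume e: "e \<in> {e. \<forall>\<epsilon>\<ge>0. ennreal \<epsilon> < e \<longrightarrow> exp_const \<epsilon> p < \<infinity>}"
  show "e \<le> ennreal (M (- 1) powr (1 / p))"
  proof (rule ccontr)
    assume "\<not> e \<le> ennreal (M (- 1) powr (1 / p))"
    then have "exp_const \<epsilon> p < \<infinity>" using e by (auto simp: \<epsilon>_def)
    then obtain c where c: "c < \<infinity>" "\<forall>\<phi>\<in>BMO p {0<..<1}. bmo_norm p {0<..<1} \<phi> \<le> ennreal \<epsilon> \<longrightarrow>
        (\<forall>J\<in>subintervals {0<..<1}. nn_avg J (\<lambda>x. exp (\<phi> x)) \<le> c * ennreal (exp (avg J \<phi>)))"
      unfolding exp_const_def Inf_less_iff by blast
    define \<phi> where "\<phi> = log_weight 1 0"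
    have bmo: "bmo_norm p {0<..<1} \<phi> \<le> ennreal \<epsilon>"
      using log_weight_bmo_le[OF assms, of "{0<..<1}" 0 1] by (simp add: \<phi>_def \<epsilon>_def subset_iff)
    have "\<phi> locally_integrable_on {0<..<1}"
      unfolding \<phi>_def by (rule log_weight_locally_integrable(1)[of 0 1]) auto
    then have "\<phi> \<in> BMO p {0<..<1}" using bmo by (simp add: BMO_def le_less_trans)
    moreover have "{0<..<1} \<in> subintervals {0<..<1::real}" by (rule open_interval_in_subintervals) auto
    ultimately have "nn_avg {0<..<1} (\<lambda>x. exp (\<phi> x)) \<le> c * ennreal (exp (avg {0<..<1} \<phi>))" using c bmo by blast
    also have "\<dots> < \<infinity>" using c(1) by (simp add: ennreal_mult_less_top)
    finally have fin: "nn_avg {0<..<1} (\<lambda>x. exp (\<phi> x)) < \<infinity>" .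
    interpret log_interval "{0<..<1}" 0 0 1 by unfold_locales auto
    have "set_borel_measurable lebesgue {0..1} (\<lambda>x. exp (\<phi> x))"
      using borel_measurable_indicator_compose[OF set_integrable_imp_set_borel_measurable[OF log_int[of 1]], of exp]
      by (simp add: \<phi>_def)
    then have "(\<lambda>x. exp (\<phi> x)) absolutely_integrable_on {0..1}" using nn_avg_J_finite[of "\<lambda>x. exp (\<phi> x)"] fin by simp
    then have i: "(\<lambda>x. exp (\<phi> x)) integrable_on {0..1}" by (rule set_lebesgue_integral_eq_integral(1))
    define I where "I = integral {0..1} (\<lambda>x. exp (\<phi> x))"
    \<comment> \<open>Chosen so that \<open>- ln \<delta>\<close> is
      \<open>\<bar>I\<bar> + 1\<close> and exceeds the supposed integral.\<close>
    define \<delta> where "\<delta> = exp (- (\<bar>I\<bar> + 1))"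
    have \<delta>: "0 < \<delta>" "\<delta> \<le> 1" by (auto simp: \<delta>_def)
    have h: "((\<lambda>x. exp (\<phi> x)) has_integral (ln 1 - ln \<delta>)) {\<delta>..1}"
    proof (rule fundamental_theorem_of_calculus[OF \<delta>(2)])
      fix x assume x: "x \<in> {\<delta>..1}"
      then have "0 < x" using \<delta> by simp
      then have "exp (\<phi> x) = inverse x" by (simp add: \<phi>_def log_weight_def exp_minus)
      moreover have "(ln has_real_derivative inverse x) (at x within {\<delta>..1})"
        using DERIV_ln[OF \<open>0 < x\<close>] by (rule has_field_derivative_at_within)
      ultimately show "(ln has_vector_derivative exp (\<phi> x)) (at x within {\<delta>..1})"
        by (simp add: has_real_derivative_iff_has_vector_derivative)
    qed
    have "integral {\<delta>..1} (\<lambda>x. exp (\<phi> x)) \<le> I" unfolding I_def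
      by (rule integral_subset_le) (use h i \<delta> in auto)
    then have "- ln \<delta> \<le> I" using integral_unique[OF h] by simp
    then show False by (simp add: \<delta>_def)
  qed
qed

lemma clamp_at_tendsto: "(\<lambda>n. clamp_at n u) \<longlonglongrightarrow> u"
proof (rule tendsto_eventually)
  obtain N :: nat where "\<bar>u\<bar> \<le> N" using real_arch_simple by blast
  then show "eventually (\<lambda>n. clamp_at n u = u) sequentially"
    unfolding eventually_sequentially by (intro exI[of _ N]) (auto simp: clamp_at_def)
qed

text \<open>For a function that is not integrable, \<open>avg J \<phi>\<close> would be the default
  value 0. But a finite p-th moment about any constant forces integrability on a bounded interval,
  so the average in the norm is the true mean.\<close>

lemma BMO_integrable:
  assumes p: "1 < p" and \<phi>: "\<phi> locally_integrable_on Q" "bmo_norm p Q \<phi> \<le> ennreal \<epsilon>" "0 \<le> \<epsilon>"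
    and ie: "interval_endpoints J a b" "J \<in> subintervals Q" "{a<..<b} \<subseteq> Q"
  defines "c \<equiv> integral {a..b} \<phi> / (b - a)"
  shows "\<phi> absolutely_integrable_on {a..b}" "avg J \<phi> = c"
    "(\<lambda>x. \<bar>\<phi> x - c\<bar> powr p) absolutely_integrable_on {a..b}"
    "integral {a..b} (\<lambda>x. \<bar>\<phi> x - c\<bar> powr p) / (b - a) \<le> \<epsilon> powr p"
proof -
  interpret interval_endpoints J a b by (rule ie(1))
  have l: "a < b" by (rule ab)
  have m: "set_borel_measurable lebesgue {a..b} \<phi>" by (rule locally_integrable_measurable[OF \<phi>(1) ie(3) l])
  have le: "nn_avg J (\<lambda>x. \<bar>\<phi> x - avg J \<phi>\<bar> powr p) \<le> ennreal (\<epsilon> powr p)"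
    using bmo_norm_le_iff[of p \<epsilon> Q \<phi>] \<phi> ie p by simp
  have mp: "set_borel_measurable lebesgue {a..b} (\<lambda>x. \<bar>\<phi> x - k\<bar> powr p)" for k
    by (rule borel_measurable_indicator_compose[OF m, of "\<lambda>u. \<bar>u - k\<bar> powr p"]) auto
  have i: "(\<lambda>x. \<bar>\<phi> x - avg J \<phi>\<bar> powr p) absolutely_integrable_on {a..b}"
    by (rule nn_avg_J_finite[OF mp]) (use le in \<open>auto intro: le_less_trans\<close>)
  show 1: "\<phi> absolutely_integrable_on {a..b}"
  proof (rule set_integrable_bound[where f = "\<lambda>x. (1 + \<bar>avg J \<phi>\<bar>) + \<bar>\<phi> x - avg J \<phi>\<bar> powr p"])
    show "(\<lambda>x. (1 + \<bar>avg J \<phi>\<bar>) + \<bar>\<phi> x - avg J \<phi>\<bar> powr p) absolutely_integrable_on {a..b}"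
      by (intro set_integral_add i absolutely_integrable_on_const) auto
    show "AE x in lebesgue. x \<in> {a..b} \<longrightarrow> norm (\<phi> x) \<le> norm (1 + \<bar>avg J \<phi>\<bar> + \<bar>\<phi> x - avg J \<phi>\<bar> powr p)"
    proof (intro AE_I2 impI)
      fix x
      have "\<bar>\<phi> x - avg J \<phi>\<bar> \<le> 1 + \<bar>\<phi> x - avg J \<phi>\<bar> powr p"
      proof (cases "\<bar>\<phi> x - avg J \<phi>\<bar> \<le> 1")
        case True
        then show ?thesis by (simp add: add_increasing2)
      next
        case False
        then have "\<bar>\<phi> x - avg J \<phi>\<bar> powr 1 \<le> \<bar>\<phi> x - avg J \<phi>\<bar> powr p" using p by (intro powr_mono) auto
        then show ?thesis using False by simp
      qed
      then show "norm (\<phi> x) \<le> norm (1 + \<bar>avg J \<phi>\<bar> + \<bar>\<phi> x - avg J \<phi>\<bar> powr p)" by simp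
    qed
  qed (rule m)
  show 2: "avg J \<phi> = c" unfolding c_def by (rule avg_J[OF 1])
  show 3: "(\<lambda>x. \<bar>\<phi> x - c\<bar> powr p) absolutely_integrable_on {a..b}" using i by (simp add: 2)
  show "integral {a..b} (\<lambda>x. \<bar>\<phi> x - c\<bar> powr p) / (b - a) \<le> \<epsilon> powr p"
    using le nn_avg_J_real[OF 3] by (simp add: 2)
qed

lemma clamp_bmo_le:
  assumes p: "1 < p" and \<phi>: "\<phi> locally_integrable_on Q" "bmo_norm p Q \<phi> \<le> ennreal \<epsilon>" "0 \<le> \<epsilon>"
  shows "bmo_norm p Q (\<lambda>x. clamp_at n (\<phi> x)) \<le> ennreal \<epsilon>"
proof -
  have "nn_avg J (\<lambda>x. \<bar>clamp_at n (\<phi> x) - avg J (\<lambda>x. clamp_at n (\<phi> x))\<bar> powr p) \<le> ennreal (\<epsilon> powr p)"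
    if JQ: "J \<in> subintervals Q" for J
  proof -
    obtain a b where ie: "interval_endpoints J a b" "{a<..<b} \<subseteq> Q" by (rule subinterval_endpoints[OF JQ])
    interpret interval_endpoints J a b by (rule ie(1))
    have l: "a < b" by (rule ab)
    note bi = BMO_integrable[OF p \<phi> ie(1) JQ ie(2)]
    note co = clamp_oscillation_le[OF p l bi(1) bi(3), of n]
    have "integral {a..b} (\<lambda>x. \<bar>clamp_at n (\<phi> x) - integral {a..b} (\<lambda>x. clamp_at n (\<phi> x)) / (b - a)\<bar> powr p) / (b - a) \<le> \<epsilon> powr p"
      using divide_right_mono[OF co(3), of "b - a"] bi(4) l by simp
    then show ?thesis using nn_avg_J_real[OF co(2)] avg_J[OF co(1)] by (simp add: ennreal_leI)
  qed
  then show ?thesis using bmo_norm_le_iff[of p \<epsilon> Q "\<lambda>x. clamp_at n (\<phi> x)"] p \<phi> by simp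
qed

text \<open>The lower bound read backwards. If a truncation has constant \<open>C\<close>, then
  either \<open>C\<close> is below the threshold \<open>exp (p - 2) / (p - 1)\<close>, or
  \<open>bmo_p_ge\<close> gives \<open>xi_plus C \<le> z < 1\<close>, which bounds \<open>C\<close>.
  The maximum of the two bounds does not depend on the truncation, and Fatou's lemma carries it over
  to \<open>\<phi>\<close>.\<close>

lemma exp_avg_bound:
  assumes ex: "exponent p" and \<epsilon>: "0 \<le> \<epsilon>" "\<epsilon> < exponent.M p (- 1) powr (1 / p)"
    and \<phi>: "\<phi> locally_integrable_on {0<..<1}" "bmo_norm p {0<..<1} \<phi> \<le> ennreal \<epsilon>"
    and JQ: "J \<in> subintervals {0<..<1}"
  defines "z \<equiv> \<epsilon> / exponent.M p (- 1) powr (1 / p)"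
  shows "nn_avg J (\<lambda>x. exp (\<phi> x)) \<le> ennreal (max (exp (- z) / (1 - z)) (exp (p - 2) / (p - 1))) * ennreal (exp (avg J \<phi>))"
proof -
  interpret exponent p by (rule ex)
  define c0 where "c0 = max (exp (- z) / (1 - z)) (exp (p - 2) / (p - 1))"
  have c0: "0 < c0" unfolding c0_def using p by (simp add: less_max_iff_disj)
  define m where "m = M (- 1) powr (1 / p)"
  have m: "0 < m" using \<epsilon> unfolding m_def by linarith
  have z: "0 \<le> z" "z < 1" using \<epsilon> m unfolding z_def m_def[symmetric] by (auto simp: divide_less_eq)
  obtain a b where ie: "interval_endpoints J a b" "{a<..<b} \<subseteq> {0<..<1}" by (rule subinterval_endpoints[OF JQ])
  interpret interval_endpoints J a b by (rule ie(1))
  have l: "a < b" by (rule ab)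
  note bi = BMO_integrable[OF p(1) \<phi> \<epsilon>(1) ie(1) JQ ie(2)]
  have step: "integral {a..b} (\<lambda>x. exp (clamp_at n (\<phi> x))) \<le> c0 * (b - a) * exp (integral {a..b} (\<lambda>x. clamp_at n (\<phi> x)) / (b - a))"
    and gi: "(\<lambda>x. exp (clamp_at n (\<phi> x))) absolutely_integrable_on {a..b}" for n
  proof -
    obtain C where C: "1 \<le> C" "(\<lambda>x. clamp_at n (\<phi> x)) \<in> exp_A_infty_class {0<..<1} C"
      by (rule bounded_in_class[of 0 1 "{0<..<1}" \<phi> n]) (use \<phi> in auto)
    interpret class_member "{0<..<1}" C "\<lambda>x. clamp_at n (\<phi> x)" using C by unfold_locales
    have "C \<le> c0"
    proof (cases "exp (p - 2) / (p - 1) \<le> C")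
      case True
      have "ennreal (m * xi_plus C) \<le> ennreal \<epsilon>"
        using bmo_p_ge[OF p True] clamp_bmo_le[OF p(1) \<phi> \<epsilon>(1), of n] unfolding m_def by (rule order_trans)
      then have "m * xi_plus C \<le> \<epsilon>" using \<epsilon>(1) by simp
      then have "xi_plus C \<le> z" using m by (simp add: z_def m_def[symmetric] field_simps)
      then have "exp (- xi_plus C) / (1 - xi_plus C) \<le> exp (- z) / (1 - z)"
        using exp_div_strict_mono[of "xi_plus C" z] xi_plus_props(1)[OF C(1)] z by (cases "xi_plus C = z") auto
      then show ?thesis using xi_plus_props(3)[OF C(1)] by (simp add: c0_def)
    next
      case False
      then show ?thesis by (simp add: c0_def)
    qed
    interpret rj: reverse_jensen "\<lambda>x. clamp_at n (\<phi> x)" exp a b C by (rule reverse_jensen_phi[OF l ie(2)])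
    show "(\<lambda>x. exp (clamp_at n (\<phi> x))) absolutely_integrable_on {a..b}" by (rule rj.intP)
    have "integral {a..b} (\<lambda>x. exp (clamp_at n (\<phi> x))) \<le> C * (b - a) * exp (integral {a..b} (\<lambda>x. clamp_at n (\<phi> x)) / (b - a))"
      using rj.rev[of a b] l by simp
    also have "\<dots> \<le> c0 * (b - a) * exp (integral {a..b} (\<lambda>x. clamp_at n (\<phi> x)) / (b - a))"
      using \<open>C \<le> c0\<close> l by (intro mult_right_mono) auto
    finally show "integral {a..b} (\<lambda>x. exp (clamp_at n (\<phi> x))) \<le> c0 * (b - a) * exp (integral {a..b} (\<lambda>x. clamp_at n (\<phi> x)) / (b - a))" .
  qed
  have ci: "(\<lambda>x. clamp_at n (\<phi> x)) absolutely_integrable_on {a..b}" for n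
    by (rule clamp_oscillation_le(1)[OF p(1) l bi(1) bi(3)])
  have lim: "(\<lambda>n. integral {a..b} (\<lambda>x. clamp_at n (\<phi> x))) \<longlonglongrightarrow> integral {a..b} \<phi>"
  proof -
    have "(\<lambda>n. LINT x|lebesgue. indicator {a..b} x *\<^sub>R clamp_at n (\<phi> x)) \<longlonglongrightarrow> (LINT x|lebesgue. indicator {a..b} x *\<^sub>R \<phi> x)"
    proof (rule integral_dominated_convergence[where w = "\<lambda>x. indicator {a..b} x *\<^sub>R \<bar>\<phi> x\<bar>"])
      show "integrable lebesgue (\<lambda>x. indicator {a..b} x *\<^sub>R \<bar>\<phi> x\<bar>)"
        using set_integrable_abs[OF bi(1)] by (simp add: set_integrable_def)
      show "AE x in lebesgue. (\<lambda>n. indicator {a..b} x *\<^sub>R clamp_at n (\<phi> x)) \<longlonglongrightarrow> indicator {a..b} x *\<^sub>R \<phi> x"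
        by (intro AE_I2 tendsto_intros clamp_at_tendsto)
      show "AE x in lebesgue. norm (indicator {a..b} x *\<^sub>R clamp_at n (\<phi> x)) \<le> indicator {a..b} x *\<^sub>R \<bar>\<phi> x\<bar>" for n
        by (intro AE_I2) (auto simp: indicator_def clamp_at_def)
      show "(\<lambda>x. indicator {a..b} x *\<^sub>R \<phi> x) \<in> borel_measurable lebesgue"
        using bi(1) by (auto simp: set_integrable_def)
      show "(\<lambda>x. indicator {a..b} x *\<^sub>R clamp_at n (\<phi> x)) \<in> borel_measurable lebesgue" for n
        using ci[of n] by (auto simp: set_integrable_def)
    qed
    then show ?thesis
      using set_lebesgue_integral_eq_integral(2)[OF ci] set_lebesgue_integral_eq_integral(2)[OF bi(1)]
      by (simp add: set_lebesgue_integral_def)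
  qed
  define u where "u n x = ennreal (indicator {a..b} x *\<^sub>R exp (clamp_at n (\<phi> x)))" for n x
  have um: "u n \<in> borel_measurable lebesgue" for n
    using gi[of n] unfolding u_def[abs_def] by (auto simp: set_integrable_def)
  define r where "r n = ennreal (c0 * (b - a) * exp (integral {a..b} (\<lambda>x. clamp_at n (\<phi> x)) / (b - a)))" for n
  have ur: "(\<integral>\<^sup>+x. u n x \<partial>lebesgue) \<le> r n" for n
  proof -
    have "(\<integral>\<^sup>+x. u n x \<partial>lebesgue) = ennreal (LINT x|lebesgue. indicator {a..b} x *\<^sub>R exp (clamp_at n (\<phi> x)))"
      unfolding u_def using gi[of n] by (intro nn_integral_eq_integral) (auto simp: set_integrable_def)
    also have "\<dots> = ennreal (integral {a..b} (\<lambda>x. exp (clamp_at n (\<phi> x))))"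
      using set_lebesgue_integral_eq_integral(2)[OF gi[of n]] by (simp add: set_lebesgue_integral_def)
    also have "\<dots> \<le> r n" unfolding r_def by (rule ennreal_leI[OF step])
    finally show ?thesis .
  qed
  have "(\<integral>\<^sup>+x\<in>{a..b}. ennreal (exp (\<phi> x)) \<partial>lebesgue) = (\<integral>\<^sup>+x. liminf (\<lambda>n. u n x) \<partial>lebesgue)"
  proof (rule nn_integral_cong)
    fix x
    have "(\<lambda>n. u n x) \<longlonglongrightarrow> ennreal (indicator {a..b} x *\<^sub>R exp (\<phi> x))"
      unfolding u_def by (intro tendsto_ennrealI tendsto_intros clamp_at_tendsto)
    then have "liminf (\<lambda>n. u n x) = ennreal (indicator {a..b} x *\<^sub>R exp (\<phi> x))"
      by (intro lim_imp_Liminf) auto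
    then show "ennreal (exp (\<phi> x)) * indicator {a..b} x = liminf (\<lambda>n. u n x)" by (auto simp: indicator_def)
  qed
  also have "\<dots> \<le> liminf (\<lambda>n. \<integral>\<^sup>+x. u n x \<partial>lebesgue)" by (rule nn_integral_liminf[OF um])
  also have "\<dots> \<le> liminf r" by (intro Liminf_mono always_eventually allI ur)
  also have "liminf r = ennreal (c0 * (b - a) * exp (integral {a..b} \<phi> / (b - a)))"
  proof (rule lim_imp_Liminf)
    show "r \<longlonglongrightarrow> ennreal (c0 * (b - a) * exp (integral {a..b} \<phi> / (b - a)))"
      unfolding r_def[abs_def] using lim l by (intro tendsto_ennrealI tendsto_intros) auto
  qed simp
  finally have "nn_avg J (\<lambda>x. exp (\<phi> x)) \<le> ennreal (c0 * (b - a) * exp (integral {a..b} \<phi> / (b - a))) / ennreal (b - a)"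
    unfolding nn_avg_J by (rule divide_right_mono_ennreal)
  also have "\<dots> = ennreal (c0 * (b - a) * exp (integral {a..b} \<phi> / (b - a)) / (b - a))"
    using l c0 by (intro divide_ennreal) auto
  also have "c0 * (b - a) * exp (integral {a..b} \<phi> / (b - a)) / (b - a) = c0 * exp (avg J \<phi>)" using l bi(2) by simp
  finally show ?thesis using c0 by (simp add: c0_def ennreal_mult)
qed

lemma JN_const_ge:
  assumes ex: "exponent p" shows "ennreal (exponent.M p (- 1) powr (1 / p)) \<le> JN_const p"
  unfolding JN_const_def
proof (rule Sup_upper, intro CollectI allI impI)
  interpret exponent p by (rule ex)
  fix \<epsilon> :: real assume \<epsilon>: "0 \<le> \<epsilon>" "ennreal \<epsilon> < ennreal (M (- 1) powr (1 / p))"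
  then have \<epsilon>': "\<epsilon> < M (- 1) powr (1 / p)" by (simp add: ennreal_less_iff)
  define z where "z = \<epsilon> / M (- 1) powr (1 / p)"
  have "0 < M (- 1) powr (1 / p)" using \<epsilon>(1) \<epsilon>' by linarith
  then have z: "0 \<le> z" "z < 1" using \<epsilon>(1) \<epsilon>' by (auto simp: z_def divide_less_eq)
  define c where "c = max (exp (- z) / (1 - z)) (exp (p - 2) / (p - 1))"
  have "1 - z \<le> exp (- z)" using exp_ge_add_one_self[of "- z"] by simp
  then have "1 \<le> c" using z by (simp add: c_def le_max_iff_disj field_simps)
  then have "1 \<le> ennreal c" by simp
  moreover have "\<forall>\<phi>\<in>BMO p {0<..<1}. bmo_norm p {0<..<1} \<phi> \<le> ennreal \<epsilon> \<longrightarrow>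
        (\<forall>J\<in>subintervals {0<..<1}. nn_avg J (\<lambda>x. exp (\<phi> x)) \<le> ennreal c * ennreal (exp (avg J \<phi>)))"
    using exp_avg_bound[OF ex \<epsilon>(1) \<epsilon>'] by (auto simp: BMO_def c_def z_def)
  ultimately have "exp_const \<epsilon> p \<le> ennreal c" unfolding exp_const_def by (intro Inf_lower) auto
  then show "exp_const \<epsilon> p < \<infinity>" by (rule le_less_trans) simp
qed

lemma JN_const_eq: "exponent p \<Longrightarrow> JN_const p = ennreal (exponent.M p (- 1) powr (1 / p))"
  by (intro antisym JN_const_le JN_const_ge)

text \<open>\<open>M (- 1)\<close> is the variance of the standard exponential distribution, so for
  \<open>p = 2\<close> the factor in front of the root is 1.\<close>

lemma exponent_two: "exponent 2" "exponent.M 2 (- 1) = 1"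
proof -
  show e: "exponent 2" by unfold_locales auto
  show "exponent.M 2 (- 1) = 1" using exponent.M_two[OF e, of "- 1"] by simp
qed

theorem theorem1p7:
  fixes Q :: "real set" and C :: real
  assumes "finite_interval Q" and "1 \<le> C"
  shows
    "(\<forall>\<phi>\<in>exp_A_infty_class Q C.
        ennreal (xi_plus C) \<le> bmo_norm 2 Q \<phi> \<and> bmo_norm 2 Q \<phi> \<le> ennreal \<bar>xi_minus C\<bar> \<and>
        ennreal (k_const C) \<le> bmo_norm 1 Q \<phi> \<and>
        (\<forall>p. 1 < p \<and> p < 2 \<and> exp (p - 2) / (p - 1) \<le> C \<longrightarrow>
           JN_const p * ennreal (xi_plus C) \<le> bmo_norm p Q \<phi>)) \<and>
     (\<forall>b. (\<forall>\<phi>\<in>exp_A_infty_class Q C. b \<le> bmo_norm 2 Q \<phi>) \<longrightarrow> b \<le> ennreal (xi_plus C)) \<and>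
     (\<forall>b. (\<forall>\<phi>\<in>exp_A_infty_class Q C. bmo_norm 2 Q \<phi> \<le> b) \<longrightarrow> ennreal \<bar>xi_minus C\<bar> \<le> b) \<and>
     (\<forall>p. 1 < p \<and> p < 2 \<and> exp (p - 2) / (p - 1) \<le> C \<longrightarrow>
        (\<forall>b. (\<forall>\<phi>\<in>exp_A_infty_class Q C. b \<le> bmo_norm p Q \<phi>) \<longrightarrow>
             b \<le> JN_const p * ennreal (xi_plus C)))"
proof -
  obtain a b where ab: "a < b" "{a<..<b} \<subseteq> Q" "Q \<subseteq> {a..b}"
    by (rule finite_interval_endpoints[OF assms(1)])
  have Qa: "Q \<subseteq> {a..}" using ab(3) by auto
  note plus = xi_plus_props[OF assms(2)]
  note minus = xi_minus_props[OF assms(2)]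
  have in_plus: "log_weight (xi_plus C) a \<in> exp_A_infty_class Q C"
    by (rule log_weight_in_class[OF ab plus(2,3)])
  \<comment> \<open>Both roots solve the same equation, so one lemma puts both logarithms into the
    class.\<close>
  have "xi_minus C < 1" using minus(1) by simp
  then have in_minus: "log_weight (xi_minus C) a \<in> exp_A_infty_class Q C"
    by (rule log_weight_in_class[OF ab _ minus(2)])
  have norm2: "bmo_norm 2 Q (log_weight \<xi> a) = ennreal \<bar>\<xi>\<bar>" for \<xi>
    using log_weight_bmo_eq[OF exponent_two(1) Qa ab(2,1)] by (simp add: exponent_two(2))
  have JN: "JN_const p * ennreal (xi_plus C) = ennreal (exponent.M p (- 1) powr (1 / p) * xi_plus C)"
    if "1 < p" "p < 2" for p
  proof -
    have "exponent p" using that by unfold_locales auto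
    then show ?thesis using plus(1) by (simp add: JN_const_eq ennreal_mult)
  qed
  have bounds: "ennreal (xi_plus C) \<le> bmo_norm 2 Q \<phi> \<and> bmo_norm 2 Q \<phi> \<le> ennreal \<bar>xi_minus C\<bar> \<and>
        ennreal (k_const C) \<le> bmo_norm 1 Q \<phi> \<and>
        (\<forall>p. 1 < p \<and> p < 2 \<and> exp (p - 2) / (p - 1) \<le> C \<longrightarrow>
           JN_const p * ennreal (xi_plus C) \<le> bmo_norm p Q \<phi>)"
    if "\<phi> \<in> exp_A_infty_class Q C" for \<phi>
  proof -
    interpret class_member Q C \<phi> using that assms(2) by unfold_locales
    \<comment> \<open>For \<open>p = 2\<close> the threshold on the constant is 1, so every
      admissible \<open>C\<close> meets it.\<close>
    have "ennreal (xi_plus C) \<le> bmo_norm 2 Q \<phi>"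
      using bmo_p_ge[of 2] assms(2) by (simp add: exponent_two(2))
    moreover have "JN_const p * ennreal (xi_plus C) \<le> bmo_norm p Q \<phi>"
      if "1 < p" "p < 2" "exp (p - 2) / (p - 1) \<le> C" for p
      using bmo_p_ge[of p] that by (simp add: JN)
    ultimately show ?thesis using bmo_two_le bmo_one_ge by simp
  qed
  have sharp_p: "b' \<le> JN_const p * ennreal (xi_plus C)"
    if p: "1 < p" "p < 2" and b': "\<forall>\<phi>\<in>exp_A_infty_class Q C. b' \<le> bmo_norm p Q \<phi>" for p b'
  proof -
    have "exponent p" using p by unfold_locales auto
    then have "bmo_norm p Q (log_weight (xi_plus C) a) = JN_const p * ennreal (xi_plus C)"
      using log_weight_bmo_eq[OF _ Qa ab(2,1)] plus(1) by (simp add: JN[OF p] mult.commute)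
    then show ?thesis using b' in_plus by metis
  qed
  have sharp_lower: "b' \<le> ennreal (xi_plus C)" if "\<forall>\<phi>\<in>exp_A_infty_class Q C. b' \<le> bmo_norm 2 Q \<phi>" for b'
    using bspec[OF that in_plus] plus(1) by (simp add: norm2)
  have sharp_upper: "ennreal \<bar>xi_minus C\<bar> \<le> b'" if "\<forall>\<phi>\<in>exp_A_infty_class Q C. bmo_norm 2 Q \<phi> \<le> b'" for b'
    using bspec[OF that in_minus] by (simp add: norm2)
  show ?thesis
    by (rule conjI[OF ballI[OF bounds] conjI[OF allI[OF impI[OF sharp_lower]]
          conjI[OF allI[OF impI[OF sharp_upper]] allI[OF impI[OF allI[OF impI[OF sharp_p]]]]]]])
      (assumption | (elim conjE, assumption))+
qed


end
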